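(* Let $K\subset\mathbb{C}$ be non-polar, compact and polynomially convex, and let $(q_k)_{k\in\mathbb{N}}$ be a sequence of complex polynomials with degrees $n_k=\deg q_k\to\infty$. If $(q_k)_{k\in\mathbb{N}}$ is $K$-regular and centers on $K$, then $$\omega_{K(q_k)}\to\omega_K\quad\text{weak* as } k\to\infty,$$ where $K(q_k)$ denotes the filled-in Julia set of $q_k$.
   Context: $\mathbb{D}(R)=\{z\in\mathbb{C}:|z|<R\}$. For a polynomial $q$ of degree at least $2$, the filled-in Julia set is $K(q)=\{z\in\mathbb{C}: (q^j(z))_j \text{ is bounded}\}$, where $q^j$ is the $j$th iterate of $q$. Polynomially convex (full) for a compact $K\subset\mathbb{C}$ means that $\Omega:=\mathbb{C}\setminus K$ is connected. For a non-polar compact set $C\subset\mathbb{C}$, $\omega_C$ is the equilibrium measure of $C$, i.e. the unique Borel probability measure on $C$ maximizing the energy $I(\mu)=\iint\log|z-w|\,d\mu(w)\,d\mu(z)$. The Green's function of $\Omega$ with pole at $\infty$ is $g_\Omega(z)=\int\log|z-w|\,d\omega_K(w)-I(\omega_K)$. Weak* convergence $\mu_k\to\mu$ of probability measures means $\int f\,d\mu_k\to\int f\,d\mu$ for every compactly supported continuous $f$ on $\mathbb{C}$. All sequences of polynomials considered have degrees tending to infinity, so finitely many terms of degree too small for the expressions to make sense are disregarded. Centering: a sequence $(q_k)_k$ of polynomials centers on a non-empty compact set $C\subset\mathbb{C}$ if there exist $N\in\mathbb{N}$ and $R>0$ such that (1) $q_k^{-1}(\{0\})\subset\mathbb{D}(R)$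 for all $k\ge N$; and (2) for every closed set $L\subset\mathbb{C}$ with $L\cap C=\emptyset$ there exists $M=M(L)>0$ such that for all $k\ge N$ the number of zeros of $q_k$ in $L$, counted with multiplicity, is at most $M$. $K$-regularity: a sequence $(q_k)_k$ of polynomials of degrees $n_k$ is $K$-regular if for some $R>0$ (taken large enough that $K\subset\mathbb{D}(R)$) one has $\lim_{k\to\infty}\frac{1}{n_k}\log|q_k(z)|=g_\Omega(z)$ uniformly on $\mathbb{C}\setminus\mathbb{D}(R)$. *)

theory Defs
  imports
    "HOL-Probability.Probability_Measure"
    "HOL-Computational_Algebra.Polynomial"
begin

section \<open>Logarithmic potential theory in the plane\<close>

(* HOL has ln 0 = 0, so the pole of the logarithm at 0 is put in by hand. *)
definition log_kernel :: "complex \<Rightarrow> complex \<Rightarrow> ereal" where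
  "log_kernel z w = (if z = w then -\<infinity> else ereal (ln (cmod (z - w))))"

(* Positive part minus negative part, with e2ennreal truncating at 0. The value is the
   intended one as long as one of the two parts is finite. Below, the positive part is
   always finite, since log |z - w| is bounded above on bounded sets. *)
definition ereal_integral :: "'a measure \<Rightarrow> ('a \<Rightarrow> ereal) \<Rightarrow> ereal" where
  "ereal_integral M f =
     enn2ereal (\<integral>\<^sup>+ x. e2ennreal (f x) \<partial>M) - enn2ereal (\<integral>\<^sup>+ x. e2ennreal (- f x) \<partial>M)"

definition log_potential :: "complex measure \<Rightarrow> complex \<Rightarrow> ereal" where
  "log_potential \<mu> z = ereal_integral \<mu> (\<lambda>w. log_kernel z w)"

(* Sign convention: I(mu) is the double integral of log |z - w|, so it lies in
   [-\<infinity>, \<infinity>) and equilibrium measures maximize it. *)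
definition log_energy :: "complex measure \<Rightarrow> ereal" where
  "log_energy \<mu> = ereal_integral \<mu> (\<lambda>z. log_potential \<mu> z)"

definition prob_measures_on :: "complex set \<Rightarrow> complex measure set" where
  "prob_measures_on C = {\<mu>. sets \<mu> = sets borel \<and> prob_space \<mu> \<and> emeasure \<mu> C = 1}"

(* The usual definition quantifies over finite non-zero Borel measures with compact support
   in E. Normalizing the mass does not affect whether the energy is -\<infinity>. *)
definition polar :: "complex set \<Rightarrow> bool" where
  "polar E \<longleftrightarrow>
     (\<forall>C \<mu>. compact C \<and> C \<subseteq> E \<and> \<mu> \<in> prob_measures_on C \<longrightarrow> log_energy \<mu> = -\<infinity>)"

definition is_equilibrium_measure :: "complex set \<Rightarrow> complex measure \<Rightarrow> bool" where
  "is_equilibrium_measure C \<mu> \<longleftrightarrow>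
     \<mu> \<in> prob_measures_on C \<and> (\<forall>\<nu>\<in>prob_measures_on C. log_energy \<nu> \<le> log_energy \<mu>)"

(* Only meaningful for non-polar compact C, where the maximizer exists and is unique. *)
definition equilibrium_measure :: "complex set \<Rightarrow> complex measure" where
  "equilibrium_measure C = (THE \<mu>. is_equilibrium_measure C \<mu>)"

(* The Green's function with pole at infinity of the complement of K, as a function of K. *)
definition green_function :: "complex set \<Rightarrow> complex \<Rightarrow> ereal" where
  "green_function K z =
     log_potential (equilibrium_measure K) z - log_energy (equilibrium_measure K)"

definition polynomially_convex :: "complex set \<Rightarrow> bool" where
  "polynomially_convex K \<longleftrightarrow> connected (- K)"

definition weak_star_conv :: "(nat \<Rightarrow> complex measure) \<Rightarrow> complex measure \<Rightarrow> bool" where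
  "weak_star_conv \<mu>s \<mu> \<longleftrightarrow>
     (\<forall>f :: complex \<Rightarrow> real.
        continuous_on UNIV f \<and> compact (closure {z. f z \<noteq> 0}) \<longrightarrow>
        (\<lambda>k. \<integral>z. f z \<partial>\<mu>s k) \<longlonglongrightarrow> (\<integral>z. f z \<partial>\<mu>))"

section \<open>Sequences of polynomials\<close>

definition filled_julia :: "complex poly \<Rightarrow> complex set" where
  "filled_julia p = {z. bounded (range (\<lambda>j. (poly p ^^ j) z))}"

(* proots is the multiset of roots; proots 0 = {#} is harmless here because the first
   condition excludes the zero polynomial. *)
definition centers_on :: "(nat \<Rightarrow> complex poly) \<Rightarrow> complex set \<Rightarrow> bool" where
  "centers_on q C \<longleftrightarrow>
     (\<exists>(N::nat) (R::real). R > 0 \<and>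
        (\<forall>k\<ge>N. {z. poly (q k) z = 0} \<subseteq> ball 0 R) \<and>
        (\<forall>L. closed L \<and> L \<inter> C = {} \<longrightarrow>
           (\<exists>M::nat. M > 0 \<and> (\<forall>k\<ge>N. size (filter_mset (\<lambda>z. z \<in> L) (proots (q k))) \<le> M))))"

(* Off a disc containing the compact non-polar set K, the Green's function is finite and
   bounded below by a positive constant. Uniform convergence hence rules out zeros of q k
   there for large k, so that the convention ln 0 = 0 plays no role. *)
definition K_regular :: "complex set \<Rightarrow> (nat \<Rightarrow> complex poly) \<Rightarrow> bool" where
  "K_regular K q \<longleftrightarrow>
     (\<exists>R::real. R > 0 \<and> K \<subseteq> ball 0 R \<and>
        uniform_limit (- ball 0 R)
          (\<lambda>k z. ln (cmod (poly (q k) z)) / real (degree (q k)))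
          (\<lambda>z. real_of_ereal (green_function K z)) sequentially)"

end

theory Submission
  imports Defs "HOL-Probability.Probability" "HOL-Complex_Analysis.Complex_Analysis"
    "HOL-Computational_Algebra.Fundamental_Theorem_Algebra"
begin

text \<open>Write \<open>I\<close> for the logarithmic energy. Up to a constant \<open>- log |z - w|\<close> is a superposition of
  Gaussians, hence strictly positive definite on measures of total mass zero: \<open>2 I(\<mu>,\<nu>) \<ge> I(\<mu>) + I(\<nu>)\<close> with equality only for
  \<open>\<mu> = \<nu>\<close>; equilibrium measures exist by weak compactness and are unique.
  Pulling points back under iterates of a polynomial with degree \<open>n\<close> and leading coefficient \<open>a\<close> shows
  that the equilibrium energy of its filled Julia set is at least \<open>- log |a| / (n - 1)\<close>, and \<open>K\<close>-regularity
  makes these bounds converge to \<open>I(\<omega>\<^sub>K)\<close>.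
  Let \<open>\<nu>\<close> be a weak limit of the equilibrium measures of \<open>K(q\<^sub>k)\<close>, so that \<open>I(\<nu>) \<ge> I(\<omega>\<^sub>K)\<close> by
  semicontinuity and \<open>\<nu>\<close> has no atoms. The limit \<open>\<sigma>\<close> of the zero counting measures lives on \<open>K\<close>, and
  its potential equals that of \<open>\<omega>\<^sub>K\<close> off \<open>K\<close> by the identity theorem, \<open>K\<close> being full. Apart from the
  countably many points attracting zeros, a point of the support of \<open>\<nu>\<close> off \<open>K\<close> is approached by points
  \<open>z\<^sub>k\<close> of the Julia sets, where \<open>log |q\<^sub>k(z\<^sub>k)|\<close> is bounded; hence the potential of \<open>\<omega>\<^sub>K\<close> is at most \<open>I(\<omega>\<^sub>K)\<close> there.
  On \<open>K\<close> this bound holds on average by maximality of \<open>\<omega>\<^sub>K\<close>. So \<open>I(\<omega>\<^sub>K,\<nu>) \<le> I(\<omega>\<^sub>K)\<close>, and strict positive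
  definiteness forces \<open>\<nu> = \<omega>\<^sub>K\<close>.\<close>

section \<open>Weak compactness via a space-filling curve\<close>

text \<open>The main obstacle is the diagonal: the preimage measures that bound the Julia energies
  from below consist of point masses and have energy \<open>-\<infinity>\<close>. Their energies are
  therefore computed with the kernel cut off at a level that grows more slowly than the number of
  base points. The diagonal then vanishes on average, while the cut disappears in the limit.
  Energies are handled as integrals of \<open>ln (b / |z - w|)\<close>, with \<open>b\<close> at
  least the diameter of a disc carrying all measures. This kernel is nonnegative with values in
  \<open>ennreal\<close>, so that Tonelli and Fatou apply without integrability conditions. The sign
  is reversed: maximizing \<open>I\<close> means minimizing this integral. Weak limits are
  represented by pointwise convergent random variables, so that semicontinuity of the energy is
  Fatou's lemma and integrands moving with the index fall to dominated convergence. Helly selection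
  and Skorokhod's representation concern the line; a Borel right inverse of a space-filling curve
  takes measures on a disc to \<open>[0, 1]\<close>, and the curve itself takes the limits
  back.\<close>

definition digit_fun :: "real \<Rightarrow> real" where
  "digit_fun t = max 0 (min 1 (1/2 - cos (pi * t)))"

lemma digit_fun_bounds: "0 \<le> digit_fun t" "digit_fun t \<le> 1"
  by (auto simp: digit_fun_def)

lemma digit_fun_eq_0: "0 \<le> t \<Longrightarrow> t \<le> 1/3 \<Longrightarrow> digit_fun t = 0"
  using cos_monotone_0_pi_le[of "pi * t" "pi / 3"] mult_left_mono[of t "1/3" pi]
  by (auto simp: digit_fun_def cos_60)

lemma digit_fun_eq_1:
  assumes "2/3 \<le> t" "t \<le> 1"
  shows "digit_fun t = 1"
proof -
  have "cos (pi * t) \<le> cos (2 * pi / 3)"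
    using assms by (intro cos_monotone_0_pi_le) (auto simp: field_simps)
  moreover have "cos (2 * pi / 3) = - 1 / 2"
    using cos_120 by simp
  ultimately show ?thesis by (auto simp: digit_fun_def)
qed

lemma digit_fun_periodic: "digit_fun (2 * real n + t) = digit_fun t"
proof -
  have "cos (pi * (2 * real n + t)) = cos (pi * t + 2 * real n * pi)"
    by (simp add: algebra_simps)
  also have "\<dots> = cos (pi * t)"
    by (simp only: cos_add cos_2npi sin_2npi mult_1_right mult_zero_right diff_zero)
  finally show ?thesis by (simp add: digit_fun_def)
qed

text \<open>Coordinates of Schoenberg's space-filling curve. If \<open>t\<close> has ternary digits
  0 and 2 only, \<open>digit_fun (3 ^ j * t)\<close> recovers half of its \<open>j\<close>-th digit.
  The even positions serve as binary digits of one coordinate (\<open>k = 0\<close>), the odd ones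
  of the other (\<open>k = 1\<close>). The plateaus of \<open>digit_fun\<close> on the outer thirds
  of \<open>[0, 1]\<close> make this reading exact.\<close>

definition schoenberg_coord :: "nat \<Rightarrow> real \<Rightarrow> real" where
  "schoenberg_coord k t = (\<Sum>i. digit_fun (3 ^ (2 * i + k) * t) / 2 ^ Suc i)"

lemma continuous_on_schoenberg_coord: "continuous_on UNIV (schoenberg_coord k)"
proof -
  have cont: "continuous_on UNIV (\<lambda>t. \<Sum>i<n. digit_fun (3 ^ (2 * i + k) * t) / 2 ^ Suc i)" for n
    unfolding digit_fun_def by (intro continuous_intros) auto
  have "uniform_limit UNIV (\<lambda>n t. \<Sum>i<n. digit_fun (3 ^ (2 * i + k) * t) / 2 ^ Suc i)
          (\<lambda>t. \<Sum>i. digit_fun (3 ^ (2 * i + k) * t) / 2 ^ Suc i) sequentially"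
  proof (rule Weierstrass_m_test)
    show "norm (digit_fun (3 ^ (2 * i + k) * t) / 2 ^ Suc i) \<le> (1/2) ^ Suc i" for i t
      using digit_fun_bounds by (simp add: power_one_over divide_simps)
    show "summable (\<lambda>i. (1/2::real) ^ Suc i)"
      by (subst summable_Suc_iff) (auto intro: summable_geometric)
  qed
  then show ?thesis
    unfolding schoenberg_coord_def[abs_def]
    by (rule uniform_limit_theorem[rotated]) (simp_all only: cont eventually_True trivial_limit_sequentially not_False_eq_True)
qed

lemma binary_expansion:
  fixes x :: real
  assumes "0 \<le> x" "x < 1"
  obtains a :: "nat \<Rightarrow> real" where "\<And>i. a i \<in> {0, 1}" "(\<lambda>i. a i / 2 ^ Suc i) sums x"
proof
  define a where "a i = real_of_int (\<lfloor>2 ^ Suc i * x\<rfloor> - 2 * \<lfloor>2 ^ i * x\<rfloor>)" for i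
  show "a i \<in> {0, 1}" for i
  proof -
    have "\<lfloor>2 ^ Suc i * x\<rfloor> - 2 * \<lfloor>2 ^ i * x\<rfloor> = 0 \<or> \<lfloor>2 ^ Suc i * x\<rfloor> - 2 * \<lfloor>2 ^ i * x\<rfloor> = 1"
      unfolding power_Suc mult.assoc by linarith
    then show ?thesis by (auto simp: a_def)
  qed
  have partial: "(\<Sum>i<n. a i / 2 ^ Suc i) = \<lfloor>2 ^ n * x\<rfloor> / 2 ^ n" for n
  proof (induction n)
    case 0
    then show ?case using assms by (simp add: floor_eq_iff)
  next
    case (Suc n)
    then show ?case by (simp add: a_def field_simps)
  qed
  have "(\<lambda>n. \<lfloor>2 ^ n * x\<rfloor> / 2 ^ n) \<longlonglongrightarrow> x"
  proof (rule real_tendsto_sandwich)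
    show "\<forall>\<^sub>F n in sequentially. x - (1/2) ^ n \<le> \<lfloor>2 ^ n * x\<rfloor> / 2 ^ n"
    proof (rule always_eventually, rule allI)
      fix n
      have "2 ^ n * x - 1 \<le> \<lfloor>2 ^ n * x\<rfloor>" by linarith
      then show "x - (1/2) ^ n \<le> \<lfloor>2 ^ n * x\<rfloor> / 2 ^ n" 
        using divide_right_mono[of "2 ^ n * x - 1" "real_of_int \<lfloor>2 ^ n * x\<rfloor>" "2 ^ n"]
        by (simp add: diff_divide_distrib power_one_over)
    qed
    show "\<forall>\<^sub>F n in sequentially. \<lfloor>2 ^ n * x\<rfloor> / 2 ^ n \<le> x"
    proof (rule always_eventually, rule allI)
      fix n
      have "\<lfloor>2 ^ n * x\<rfloor> \<le> 2 ^ n * x" by linarith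
      then show "\<lfloor>2 ^ n * x\<rfloor> / 2 ^ n \<le> x" by (simp add: field_simps)
    qed
    have "(\<lambda>n. (1/2::real) ^ n) \<longlonglongrightarrow> 0" by (intro LIMSEQ_power_zero) simp
    from tendsto_diff[OF tendsto_const[of x] this] show "(\<lambda>n. x - (1/2::real) ^ n) \<longlonglongrightarrow> x" by simp
  qed simp
  then show "(\<lambda>i. a i / 2 ^ Suc i) sums x"
    by (simp only: sums_def partial)
qed

text \<open>\<open>T j\<close> is the tail of the ternary expansion with digits
  \<open>2 * c i\<close>, shifted by \<open>j\<close> places. All digits are even, so
  \<open>3 ^ j * T 0\<close> and \<open>T j\<close> differ by an even integer, a multiple of the
  period of \<open>digit_fun\<close>. From \<open>3 * T j = 2 * c j + T (Suc j)\<close> and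
  \<open>T (Suc j)\<close> in \<open>[0, 1]\<close> it follows that \<open>T j\<close> lies in the
  outer third belonging to \<open>c j\<close>.\<close>

lemma ternary_digits:
  fixes c :: "nat \<Rightarrow> real"
  assumes c: "\<And>i. c i \<in> {0, 1}"
  obtains t where "0 \<le> t" "t \<le> 1" "\<And>j. digit_fun (3 ^ j * t) = c j"
proof -
  define T where "T j = (\<Sum>i. 2 * c (i + j) / 3 ^ Suc i)" for j
  have cb: "0 \<le> c i" "c i \<le> 1" for i using c[of i] by auto
  have geo: "(\<lambda>i. 2 / 3 ^ Suc i :: real) sums 1"
  proof -
    have "(\<lambda>i. (1/3::real) ^ i) sums (1 / (1 - 1/3))" by (intro geometric_sums) simp
    from sums_mult[OF this, of "2/3"] show ?thesis by (simp add: power_one_over field_simps)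
  qed
  have summ: "summable (\<lambda>i. 2 * c (i + j) / 3 ^ Suc i)" for j
    by (rule summable_comparison_test'[OF sums_summable[OF geo], of 0]) (use cb in \<open>auto simp: field_simps\<close>)
  have T: "0 \<le> T j" "T j \<le> 1" for j
  proof -
    show "0 \<le> T j" unfolding T_def by (intro suminf_nonneg summ) (use cb in auto)
    have "T j \<le> (\<Sum>i. 2 / 3 ^ Suc i)" unfolding T_def
      by (intro suminf_le summ sums_summable[OF geo]) (use cb in \<open>auto simp: field_simps\<close>)
    then show "T j \<le> 1" using geo by (simp add: sums_iff)
  qed
  have Tstep: "3 * T j = 2 * c j + T (Suc j)" for j
  proof -
    have "T j = 2 * c j / 3 + (\<Sum>i. 2 * c (Suc i + j) / 3 ^ Suc (Suc i))"
      unfolding T_def using suminf_split_head[OF summ[of j]] by simp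
    also have "(\<Sum>i. 2 * c (Suc i + j) / 3 ^ Suc (Suc i)) = (\<Sum>i. (1/3) * (2 * c (i + Suc j) / 3 ^ Suc i))"
      by (intro suminf_cong) simp
    also have "\<dots> = T (Suc j) / 3"
      unfolding T_def using suminf_mult[OF summ[of "Suc j"], of "1/3"] by (simp only: times_divide_eq_left mult_1)
    finally show ?thesis by simp
  qed
  have "\<exists>N::nat. 3 ^ j * T 0 = 2 * real N + T j" for j
  proof (induction j)
    case 0
    show ?case by (intro exI[of _ 0]) simp
  next
    case (Suc j)
    then obtain N :: nat where N: "3 ^ j * T 0 = 2 * real N + T j" by blast
    have "3 ^ Suc j * T 0 = 2 * (3 * real N + c j) + T (Suc j)"
      using N Tstep[of j] by simp
    moreover obtain m :: nat where "c j = real m"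
      using c[of j] by (metis insert_iff of_nat_0 of_nat_1 singletonD)
    ultimately show ?case by (intro exI[of _ "3 * N + m"]) simp
  qed
  then have "digit_fun (3 ^ j * T 0) = digit_fun (T j)" for j
    using digit_fun_periodic by metis
  moreover have "digit_fun (T j) = c j" for j
    using c[of j] Tstep[of j] T[of "Suc j"] T[of j]
    by (auto intro!: digit_fun_eq_0 digit_fun_eq_1)
  ultimately show ?thesis using that[of "T 0"] T[of 0] by metis
qed

lemma schoenberg_surj:
  assumes "0 \<le> x" "x < 1" "0 \<le> y" "y < 1"
  obtains t where "0 \<le> t" "t \<le> 1" "schoenberg_coord 0 t = x" "schoenberg_coord 1 t = y"
proof -
  obtain a where a: "\<And>i. a i \<in> {0, 1}" "(\<lambda>i. a i / 2 ^ Suc i) sums x"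
    using binary_expansion assms by metis
  obtain b where b: "\<And>i. b i \<in> {0, 1}" "(\<lambda>i. b i / 2 ^ Suc i) sums y"
    using binary_expansion assms by metis
  define c where "c j = (if even j then a (j div 2) else b (j div 2))" for j
  have "c j \<in> {0, 1}" for j using a b by (auto simp: c_def)
  then obtain t where t: "0 \<le> t" "t \<le> 1" "\<And>j. digit_fun (3 ^ j * t) = c j"
    using ternary_digits by metis
  have "schoenberg_coord 0 t = x" "schoenberg_coord 1 t = y"
    using a(2) b(2) unfolding schoenberg_coord_def t(3) by (simp_all add: c_def sums_iff)
  with t that show thesis by blast
qed

text \<open>The right inverse \<open>s\<close> picks the first parameter value; its sublevel sets are images of compact
  intervals, which makes it Borel.\<close>

lemma space_filling_curve:
  fixes B :: real
  assumes "B > 0"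
  obtains S :: "real \<Rightarrow> complex" and s :: "complex \<Rightarrow> real"
  where "continuous_on UNIV S" "s \<in> borel_measurable borel"
    "\<And>z. s z \<in> {0..1}" "\<And>z. z \<in> cball 0 B \<Longrightarrow> S (s z) = z"
proof
  \<comment> \<open>The factor \<open>4 * B\<close> places the disc of radius \<open>B\<close> in
    the middle of the square filled by the curve: its points have coordinates between 1/4 and 3/4,
    away from the value 1 excluded in \<open>schoenberg_surj\<close>.\<close>
  define S where "S t = complex_of_real (4 * B) *
    Complex (schoenberg_coord 0 t - 1/2) (schoenberg_coord 1 t - 1/2)" for t
  define T where "T z = {t \<in> {0..1}. S t = z}" for z
  \<comment> \<open>The value 1 off the disc keeps those points out of every sublevel set with level
    below 1; for levels at least 1 the sublevel set is the whole plane.\<close>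
  define s where "s z = (if z \<in> cball 0 B then Inf (T z) else 1)" for z
  have S_alt: "S = (\<lambda>t. complex_of_real (4 * B) * (complex_of_real (schoenberg_coord 0 t - 1/2)
      + \<i> * complex_of_real (schoenberg_coord 1 t - 1/2)))"
    by (auto simp: S_def complex_eq_iff)
  show contS: "continuous_on UNIV S"
    unfolding S_alt by (intro continuous_intros continuous_on_schoenberg_coord)
  have T_ne: "T z \<noteq> {}" if "z \<in> cball 0 B" for z
  proof -
    have "\<bar>Re z\<bar> \<le> B" "\<bar>Im z\<bar> \<le> B"
      using that abs_Re_le_cmod[of z] abs_Im_le_cmod[of z] by auto
    then have "0 \<le> Re z / (4*B) + 1/2" "Re z / (4*B) + 1/2 < 1"
      "0 \<le> Im z / (4*B) + 1/2" "Im z / (4*B) + 1/2 < 1"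
      using \<open>B > 0\<close> by (auto simp: field_simps abs_le_iff)
    then obtain t where "0 \<le> t" "t \<le> 1" "schoenberg_coord 0 t = Re z / (4*B) + 1/2"
      "schoenberg_coord 1 t = Im z / (4*B) + 1/2"
      by (rule schoenberg_surj)
    then have "t \<in> T z" using \<open>B > 0\<close> by (auto simp: T_def S_def complex_eq_iff)
    then show ?thesis by blast
  qed
  have T_closed: "closed (T z)" for z
  proof -
    have "T z = {0..1} \<inter> S -` {z}" by (auto simp: T_def)
    moreover have "closed (S -` {z})"
      using contS by (intro closed_vimage) (auto simp: continuous_on_eq_continuous_within)
    ultimately show ?thesis by (auto intro: closed_Int)
  qed
  have s_in: "s z \<in> T z" if "z \<in> cball 0 B" for z
  proof -
    have "bdd_below (T z)" by (rule bdd_belowI[of _ 0]) (auto simp: T_def)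
    from closed_contains_Inf[OF T_ne[OF that] this T_closed] show ?thesis
      using that by (simp add: s_def)
  qed
  have s_le: "s z \<le> t" if "z \<in> cball 0 B" "t \<in> T z" for z t
  proof -
    have "bdd_below (T z)" by (rule bdd_belowI[of _ 0]) (auto simp: T_def)
    from cInf_lower[OF that(2) this] show ?thesis using that(1) by (simp add: s_def)
  qed
  show "s z \<in> {0..1}" for z
    using s_in[of z] by (cases "z \<in> cball 0 B") (auto simp: T_def s_def)
  show "S (s z) = z" if "z \<in> cball 0 B" for z
    using s_in[OF that] by (auto simp: T_def)
  show "s \<in> borel_measurable borel"
  proof (rule borel_measurable_iff_le[THEN iffD2], rule allI)
    fix a :: real
    show "{w \<in> space borel. s w \<le> a} \<in> sets borel"
    proof (cases "a \<ge> 1")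
      case True
      have "s w \<le> a" for w using \<open>\<And>z. s z \<in> {0..1}\<close>[of w] True by auto
      then show ?thesis by simp
    next
      case False
      have "{w. s w \<le> a} = cball 0 B \<inter> S ` {0..a}"
      proof (intro equalityI subsetI)
        fix w assume "w \<in> {w. s w \<le> a}"
        then have "w \<in> cball 0 B" "s w \<le> a" using False by (auto simp: s_def split: if_splits)
        with s_in[of w] have "S (s w) = w" "s w \<in> {0..a}" by (auto simp: T_def)
        then show "w \<in> cball 0 B \<inter> S ` {0..a}" using \<open>w \<in> cball 0 B\<close> by (metis IntI imageI)
      next
        fix w assume "w \<in> cball 0 B \<inter> S ` {0..a}"
        then obtain t where t: "w \<in> cball 0 B" "w = S t" "0 \<le> t" "t \<le> a" by auto
        then have "t \<in> T w" using False by (auto simp: T_def)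
        from s_le[OF t(1) this] t show "w \<in> {w. s w \<le> a}" by auto
      qed
      moreover have "compact (S ` {0..a})"
        by (intro compact_continuous_image continuous_on_subset[OF contS]) auto
      ultimately show ?thesis by (simp add: borel_closed closed_Int compact_imp_closed)
    qed
  qed
qed

text \<open>Helly selection and Skorokhod's representation on the line, transported to the plane.\<close>

theorem complex_skorohod_compactness:
  fixes \<sigma> :: "nat \<Rightarrow> complex measure"
  assumes sets: "\<And>n. sets (\<sigma> n) = sets borel" and prob: "\<And>n. prob_space (\<sigma> n)"
    and supp: "\<And>n. AE z in \<sigma> n. z \<in> cball 0 B"
  obtains r :: "nat \<Rightarrow> nat" and P :: "real measure" and X :: "nat \<Rightarrow> real \<Rightarrow> complex" and Y
  where "strict_mono r" "prob_space P" "\<And>n. X n \<in> borel_measurable P" "Y \<in> borel_measurable P"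
    "\<And>n. distr P borel (X n) = \<sigma> (r n)" "\<And>\<omega>. \<omega> \<in> space P \<Longrightarrow> (\<lambda>n. X n \<omega>) \<longlonglongrightarrow> Y \<omega>"
proof -
  define B' where "B' = max B 1"
  have "B' > 0" by (simp add: B'_def)
  obtain S :: "real \<Rightarrow> complex" and s :: "complex \<Rightarrow> real"
    where S: "continuous_on UNIV S" and [measurable]: "s \<in> borel_measurable borel"
    and s01: "\<And>z. s z \<in> {0..1}" and Ss: "\<And>z. z \<in> cball 0 B' \<Longrightarrow> S (s z) = z"
    by (rule space_filling_curve[OF \<open>B' > 0\<close>]) blast
  have [measurable]: "S \<in> borel_measurable borel"
    using S by (rule borel_measurable_continuous_onI)
  have sm: "s \<in> borel_measurable (\<sigma> n)" for n
    using measurable_cong_sets[OF sets[of n] refl, of borel]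
    by (metis \<open>s \<in> borel_measurable borel\<close>)
  define \<rho> where "\<rho> n = distr (\<sigma> n) borel s" for n
  have rd: "real_distribution (\<rho> n)" for n
  proof -
    interpret prob_space "\<sigma> n" by (rule prob)
    show ?thesis unfolding \<rho>_def by (intro real_distribution_distr sm)
  qed
  have "tight \<rho>"
    unfolding tight_def
  proof (intro conjI allI impI)
    fix \<epsilon> :: real assume "\<epsilon> > 0"
    have "measure (\<rho> n) {-1<..1} = 1" for n
    proof -
      interpret prob_space "\<sigma> n" by (rule prob)
      have "measure (\<rho> n) {-1<..1} = measure (\<sigma> n) (s -` {-1<..1} \<inter> space (\<sigma> n))"
        unfolding \<rho>_def by (intro measure_distr sm) auto
      also have "s -` {-1<..1} \<inter> space (\<sigma> n) = space (\<sigma> n)"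
        using s01 by (auto, smt (verit, best) atLeastAtMost_iff)
      finally show ?thesis by (simp add: prob_space)
    qed
    then show "\<exists>a b. a < b \<and> (\<forall>n. 1 - \<epsilon> < measure (\<rho> n) {a<..b})"
      using \<open>\<epsilon> > 0\<close> by (intro exI[of _ "-1"] exI[of _ 1]) auto
  qed (rule rd)
  from tight_imp_convergent_subsubsequence[OF this strict_mono_id]
  obtain r M where r: "strict_mono r" and M: "real_distribution M" "weak_conv_m (\<rho> \<circ> r) M"
    by (auto simp: comp_def id_def)
  from Skorohod[OF _ M(1) M(2)] rd
  obtain P :: "real measure" and X :: "nat \<Rightarrow> real \<Rightarrow> real" and Y
    where P: "prob_space P" and X: "\<And>n. X n \<in> measurable P borel"
      "\<And>n. distr P borel (X n) = \<rho> (r n)" and Y: "Y \<in> measurable P lborel"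
      and lim: "\<And>x. x \<in> space P \<Longrightarrow> (\<lambda>n. X n x) \<longlonglongrightarrow> Y x"
    by (auto simp: comp_def) metis
  have Y': "Y \<in> borel_measurable P" using Y by simp
  show thesis
  proof (rule that[of r P "\<lambda>n. S \<circ> X n" "S \<circ> Y"])
    show "S \<circ> X n \<in> borel_measurable P" for n using X(1) by measurable
    show "S \<circ> Y \<in> borel_measurable P" using Y' by measurable
    show "(\<lambda>n. (S \<circ> X n) \<omega>) \<longlonglongrightarrow> (S \<circ> Y) \<omega>" if "\<omega> \<in> space P" for \<omega>
      using continuous_on_tendsto_compose[OF S lim[OF that]] by simp
    fix n
    have "distr P borel (S \<circ> X n) = distr (distr P borel (X n)) borel S"
      using X(1) by (subst distr_distr) auto
    also have "\<dots> = distr (\<sigma> (r n)) borel (S \<circ> s)"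
      unfolding X(2) \<rho>_def using sm by (subst distr_distr) auto
    also have "\<dots> = distr (\<sigma> (r n)) borel (\<lambda>z. z)"
    proof (rule distr_cong_AE)
      show "AE x in \<sigma> (r n). (S \<circ> s) x = x"
        using supp[of "r n"] by eventually_elim (auto intro!: Ss simp: B'_def)
    qed (use sm[of "r n"] sets[of "r n"] in \<open>auto simp: measurable_ident_sets cong: measurable_cong_sets\<close>)
    also have "\<dots> = \<sigma> (r n)" using sets[of "r n"] by (intro distr_id2) auto
    finally show "distr P borel (S \<circ> X n) = \<sigma> (r n)" .
  qed (use r P in auto)
qed

section \<open>Frullani's integral and the Gaussian kernel\<close>

lemma nn_integral_exp_atLeast_0:
  assumes "s > 0"
  shows "(\<integral>\<^sup>+t. ennreal (exp (- (s * t))) * indicator {0..} t \<partial>lborel) = ennreal (1 / s)"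
proof -
  have "((\<lambda>t. - exp (- (s * t)) / s) \<longlongrightarrow> 0) at_top"
    using assms by real_asymp
  moreover have "((\<lambda>t. - exp (- (s * t)) / s) has_real_derivative exp (- (s * t))) (at t)" for t
    using assms by (auto intro!: derivative_eq_intros)
  ultimately show ?thesis
    using nn_integral_FTC_atLeast[of "\<lambda>t. exp (- (s * t))" 0 "\<lambda>t. - exp (- (s * t)) / s" 0]
    by simp
qed

text \<open>The integrand is the integral of \<open>exp (- (s * t))\<close> over \<open>s\<close> in
  \<open>[a, c]\<close>. After Tonelli the inner integral over \<open>t\<close> is
  \<open>1 / s\<close>, which integrates to the logarithm.\<close>

lemma frullani:
  assumes "0 < a" "a \<le> c"
  shows "(\<integral>\<^sup>+t. ennreal ((exp (- (a * t)) - exp (- (c * t))) / t) * indicator {0<..} t \<partial>lborel)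
    = ennreal (ln (c / a))"
proof -
  have inner: "(\<integral>\<^sup>+s. ennreal (exp (- (s * t))) * indicator {a..c} s \<partial>lborel)
      = ennreal ((exp (- (a * t)) - exp (- (c * t))) / t)" if "t > 0" for t
  proof -
    have "((\<lambda>s. - exp (- (s * t)) / t) has_real_derivative exp (- (s * t))) (at s)" for s
      using that by (auto intro!: derivative_eq_intros)
    then have "(\<integral>\<^sup>+s. ennreal (exp (- (s * t))) * indicator {a..c} s \<partial>lborel)
      = ennreal (- exp (- (c * t)) / t - - exp (- (a * t)) / t)"
      by (intro nn_integral_FTC_Icc) (use assms in auto)
    then show ?thesis by (simp add: diff_divide_distrib)
  qed
  have "(\<integral>\<^sup>+t. ennreal ((exp (- (a * t)) - exp (- (c * t))) / t) * indicator {0<..} t \<partial>lborel)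
    = (\<integral>\<^sup>+t. (\<integral>\<^sup>+s. ennreal (exp (- (s * t))) * indicator {a..c} s \<partial>lborel) * indicator {0<..} t \<partial>lborel)"
    by (intro nn_integral_cong) (auto simp: inner split: split_indicator)
  also have "\<dots> = (\<integral>\<^sup>+t. (\<integral>\<^sup>+s. ennreal (exp (- (s * t))) * indicator {a..c} s * indicator {0<..} t \<partial>lborel) \<partial>lborel)"
    by (intro nn_integral_cong) (auto intro!: nn_integral_multc[symmetric])
  also have "\<dots> = (\<integral>\<^sup>+s. (\<integral>\<^sup>+t. ennreal (exp (- (s * t))) * indicator {a..c} s * indicator {0<..} t \<partial>lborel) \<partial>lborel)"
    by (intro lborel_pair.Fubini') measurable
  also have "\<dots> = (\<integral>\<^sup>+s. ennreal (1 / s) * indicator {a..c} s \<partial>lborel)"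
  proof (intro nn_integral_cong)
    fix s :: real
    have "(\<integral>\<^sup>+t. ennreal (exp (- (s * t))) * indicator {a..c} s * indicator {0<..} t \<partial>lborel)
      = (\<integral>\<^sup>+t. indicator {a..c} s * (ennreal (exp (- (s * t))) * indicator {0..} t) \<partial>lborel)"
      by (intro nn_integral_cong_AE, use AE_lborel_singleton[of 0] in eventually_elim)
         (auto split: split_indicator)
    also have "\<dots> = indicator {a..c} s * (\<integral>\<^sup>+t. ennreal (exp (- (s * t))) * indicator {0..} t \<partial>lborel)"
      by (intro nn_integral_cmult) measurable
    also have "\<dots> = ennreal (1 / s) * indicator {a..c} s"
      using assms nn_integral_exp_atLeast_0[of s] by (auto split: split_indicator)
    finally show "(\<integral>\<^sup>+t. ennreal (exp (- (s * t))) * indicator {a..c} s * indicator {0<..} t \<partial>lborel)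
      = ennreal (1 / s) * indicator {a..c} s" .
  qed
  also have "\<dots> = ennreal (ln c - ln a)"
    by (intro nn_integral_FTC_Icc) (use assms in \<open>auto intro!: derivative_eq_intros simp: inverse_eq_divide\<close>)
  finally show ?thesis using assms by (simp add: ln_div)
qed

text \<open>If the value were \<open>r\<close>, the rate \<open>c * exp (- (r + 1))\<close> in place
  of 0 would give a smaller integrand, yet by Frullani's formula the integral
  \<open>r + 1\<close>.\<close>

lemma frullani_0:
  assumes "0 < c"
  shows "(\<integral>\<^sup>+t. ennreal ((1 - exp (- (c * t))) / t) * indicator {0<..} t \<partial>lborel) = \<top>" (is "?I = \<top>")
proof (rule ccontr)
  assume "?I \<noteq> \<top>"
  then obtain r where r: "?I = ennreal r" "r \<ge> 0" by (cases ?I) auto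
  have "ennreal (r + 1) = ennreal (ln (c / (c * exp (- (r + 1)))))"
    using assms by (simp add: ln_div add.commute)
  also have "\<dots> = (\<integral>\<^sup>+t. ennreal ((exp (- (c * exp (- (r + 1)) * t)) - exp (- (c * t))) / t) * indicator {0<..} t \<partial>lborel)"
    using assms r by (intro frullani[symmetric]) auto
  also have "\<dots> \<le> ?I"
    using assms by (intro nn_integral_mono) (auto split: split_indicator intro!: ennreal_leI divide_right_mono)
  finally show False using r by (simp add: ennreal_le_iff)
qed

text \<open>For points at distance at most \<open>b\<close> this is
  \<open>ln b - log |z - w|\<close>; for larger distances \<open>ennreal\<close> turns the negative
  logarithm into 0.\<close>

definition log_ker :: "real \<Rightarrow> complex \<Rightarrow> complex \<Rightarrow> ennreal" where
  "log_ker b z w = (if z = w then \<top> else ennreal (ln (b / dist z w)))"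

lemma measurable_log_ker [measurable]: "(\<lambda>(z, w). log_ker b z w) \<in> borel_measurable (borel \<Otimes>\<^sub>M borel)"
  unfolding log_ker_def by measurable

lemma log_ker_commute: "log_ker b z w = log_ker b w z"
  by (simp add: log_ker_def dist_commute)

text \<open>Frullani's formula with the rates \<open>(dist z w)\<^sup>2\<close> and
  \<open>b\<^sup>2\<close>; the squares double the logarithm, hence the weight
  \<open>1 / (2 * t)\<close>. This exhibits the kernel as a superposition of Gaussians, up to a term
  that does not depend on the points.\<close>

lemma log_ker_eq_frullani:
  assumes "b > 0" "dist z w \<le> b"
  shows "log_ker b z w = (\<integral>\<^sup>+t. ennreal (exp (- (t * (dist z w)\<^sup>2)) - exp (- (t * b\<^sup>2))) *
    (ennreal (1 / (2 * t)) * indicator {0<..} t) \<partial>lborel)"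
proof -
  let ?x = "(dist z w)\<^sup>2"
  have *: "(\<integral>\<^sup>+t. ennreal (exp (- (t * ?x)) - exp (- (t * b\<^sup>2))) * (ennreal (1 / (2 * t)) * indicator {0<..} t) \<partial>lborel)
    = ennreal (1/2) * (\<integral>\<^sup>+t. ennreal ((exp (- (?x * t)) - exp (- (b\<^sup>2 * t))) / t) * indicator {0<..} t \<partial>lborel)"
  proof (subst nn_integral_cmult[symmetric], measurable, intro nn_integral_cong)
    fix t :: real
    have "ennreal y * ennreal (1 / (2 * t)) = ennreal (1/2) * ennreal (y / t)" if "t > 0" for y
    proof -
      have "ennreal y * ennreal (1 / (2 * t)) = ennreal (y * (1 / (2 * t)))"
        by (rule ennreal_mult''[symmetric]) (use that in auto)
      also have "y * (1 / (2 * t)) = (1/2) * (y / t)" by simp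
      also have "ennreal \<dots> = ennreal (1/2) * ennreal (y / t)" by (rule ennreal_mult') simp
      finally show ?thesis .
    qed
    note split = this
    show "ennreal (exp (- (t * ?x)) - exp (- (t * b\<^sup>2))) * (ennreal (1 / (2 * t)) * indicator {0<..} t)
      = ennreal (1/2) * (ennreal ((exp (- (?x * t)) - exp (- (b\<^sup>2 * t))) / t) * indicator {0<..} t)"
    proof (cases "t > 0")
      case True
      then show ?thesis
        using split[OF True, of "exp (- (t * ?x)) - exp (- (t * b\<^sup>2))"]
        by (simp only: mult.commute[of ?x t] mult.commute[of "b\<^sup>2" t] indicator_simps mult_1_right greaterThan_iff)
    qed simp
  qed
  show ?thesis
  proof (cases "z = w")
    case True
    then show ?thesis unfolding * using frullani_0[of "b\<^sup>2"] assms by (simp add: log_ker_def ennreal_mult_top)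
  next
    case False
    then have d: "dist z w > 0" by simp
    have "?x \<le> b\<^sup>2" using assms by (intro power_mono) auto
    have "ln (b\<^sup>2 / ?x) = 2 * ln (b / dist z w)"
      using assms d by (simp add: ln_realpow power_divide[symmetric])
    then have "(\<integral>\<^sup>+t. ennreal ((exp (- (?x * t)) - exp (- (b\<^sup>2 * t))) / t) * indicator {0<..} t \<partial>lborel)
      = ennreal (2 * ln (b / dist z w))"
      using frullani[of ?x "b\<^sup>2"] \<open>?x \<le> b\<^sup>2\<close> d by simp
    moreover have "ennreal (1/2) * ennreal (2 * y) = ennreal y" for y
      using ennreal_mult'[of "1/2" "2 * y"] by simp
    ultimately show ?thesis unfolding * using False by (simp only: log_ker_def if_False)
  qed
qed

section \<open>Positive definiteness of the Gaussian kernel\<close>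

locale complex_prob = prob_space M for M :: "complex measure" +
  assumes sets_eq_borel [measurable_cong]: "sets M = sets borel"
begin

lemma space_eq_UNIV [simp]: "space M = UNIV"
  using sets_eq_imp_space_eq[OF sets_eq_borel] by simp

lemma integrable_bounded:
  fixes f :: "complex \<Rightarrow> real"
  assumes [measurable]: "f \<in> borel_measurable borel" and "AE z in M. \<bar>f z\<bar> \<le> C"
  shows "integrable M f"
  by (rule integrable_const_bound[of _ C]) (use assms in auto)

end

section \<open>Measures on a disc are determined by their Gaussian transforms\<close>

lemma measure_eq_if_continuous_integral_eq:
  assumes \<mu>: "complex_prob \<mu>" and \<nu>: "complex_prob \<nu>"
    and eq: "\<And>g :: complex \<Rightarrow> real. continuous_on UNIV g \<Longrightarrow> (\<And>z. 0 \<le> g z \<and> g z \<le> 1) \<Longrightarrow>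
      (\<integral>z. g z \<partial>\<mu>) = (\<integral>z. g z \<partial>\<nu>)"
  shows "\<mu> = \<nu>"
proof -
  interpret \<mu>: complex_prob \<mu> by (rule \<mu>)
  interpret \<nu>: complex_prob \<nu> by (rule \<nu>)
  have closed: "measure \<mu> C = measure \<nu> C" if "closed C" "C \<noteq> {}" for C
  proof -
    define g where "g n z = max 0 (1 - real n * infdist z C)" for n z
    have cont: "continuous_on UNIV (g n)" for n
      unfolding g_def by (intro continuous_intros)
    have bnd: "0 \<le> g n z \<and> g n z \<le> 1" for n z
      using infdist_nonneg[of z C] by (auto simp: g_def)
    have lim: "(\<lambda>n. g n z) \<longlonglongrightarrow> indicator C z" for z
    proof (cases "z \<in> C")
      case True
      then show ?thesis using that by (simp add: g_def)
    next
      case False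
      then have "infdist z C > 0" using that by (simp add: infdist_pos_not_in_closed)
      then obtain N :: nat where N: "real N * infdist z C > 1" using reals_Archimedean3 by blast
      have "g n z = 0" if "n \<ge> N" for n
      proof -
        have "real N * infdist z C \<le> real n * infdist z C"
          using that by (intro mult_right_mono infdist_nonneg) auto
        then show ?thesis using N by (simp add: g_def)
      qed
      then show ?thesis using False
        by (intro tendsto_eventually) (auto simp: eventually_sequentially)
    qed
    have "(\<lambda>n. \<integral>z. g n z \<partial>\<rho>) \<longlonglongrightarrow> measure \<rho> C" if \<rho>: "complex_prob \<rho>" for \<rho>
    proof -
      interpret \<rho>: complex_prob \<rho> by (rule \<rho>)
      have [measurable]: "g n \<in> borel_measurable borel" for n
        by (intro borel_measurable_continuous_onI cont)
      have [measurable]: "C \<in> sets borel" using \<open>closed C\<close> by (rule borel_closed)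
      have "(\<lambda>n. \<integral>z. g n z \<partial>\<rho>) \<longlonglongrightarrow> (\<integral>z. indicator C z \<partial>\<rho>)"
        by (rule integral_dominated_convergence[where w = "\<lambda>_. 1"]) (use lim bnd in auto)
      then show ?thesis by simp
    qed
    from this[OF \<mu>] this[OF \<nu>] show ?thesis
      using eq[OF cont bnd] by (auto intro: LIMSEQ_unique)
  qed
  show ?thesis
  proof (rule measure_eqI_generator_eq[where E = "Collect closed" and \<Omega> = UNIV and A = "\<lambda>_. UNIV"])
    show "Int_stable (Collect closed :: complex set set)" by (auto simp: Int_stable_def)
    show "emeasure \<mu> X = emeasure \<nu> X" if "X \<in> Collect closed" for X
      using closed[of X] that by (cases "X = {}") (auto simp: \<mu>.emeasure_eq_measure \<nu>.emeasure_eq_measure)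
  qed (auto simp: \<mu>.sets_eq_borel \<nu>.sets_eq_borel borel_eq_closed)
qed

text \<open>Sums suffice as closure rule: a product of two exponentials is again an exponential, so
  this span is already an algebra, as Stone--Weierstrass requires.\<close>

inductive_set exp_sums :: "(complex \<Rightarrow> real) set" where
  base: "(\<lambda>z. c * exp (u \<bullet> z)) \<in> exp_sums"
| add: "f \<in> exp_sums \<Longrightarrow> g \<in> exp_sums \<Longrightarrow> (\<lambda>z. f z + g z) \<in> exp_sums"

lemma exp_sums_mult:
  assumes "f \<in> exp_sums" "g \<in> exp_sums"
  shows "(\<lambda>z. f z * g z) \<in> exp_sums"
  using assms(1)
proof induction
  case (base c u)
  from assms(2) show ?case
  proof induction
    case (base d v)
    have "(\<lambda>z. c * exp (u \<bullet> z) * (d * exp (v \<bullet> z))) = (\<lambda>z. (c * d) * exp ((u + v) \<bullet> z))"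
      by (auto simp: inner_add_left exp_add)
    then show ?case by (simp only: exp_sums.base)
  next
    case (add f g)
    then show ?case by (auto simp: distrib_left intro: exp_sums.add)
  qed
next
  case (add f g)
  then show ?case by (auto simp: distrib_right intro: exp_sums.add)
qed

lemma continuous_on_exp_sums: "f \<in> exp_sums \<Longrightarrow> continuous_on S f"
  by (induction rule: exp_sums.induct) (auto intro!: continuous_intros)

lemma exp_sums_function_ring: "function_ring_on exp_sums (cball 0 B)"
proof
  show "(\<lambda>_. c) \<in> exp_sums" for c using exp_sums.base[of c 0] by simp
  fix x y :: complex assume "x \<noteq> y"
  have "(x - y) \<bullet> x \<noteq> (x - y) \<bullet> y"
    using \<open>x \<noteq> y\<close> by (metis inner_diff_right inner_eq_zero_iff right_minus_eq)
  then show "\<exists>f\<in>exp_sums. f x \<noteq> f y"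
    by (intro bexI[OF _ exp_sums.base[of 1 "x - y"]]) simp
qed (auto intro: exp_sums_mult exp_sums.add continuous_on_exp_sums)

text \<open>Up to the factor \<open>exp (-s |z|\<^sup>2)\<close> the functions \<open>z \<mapsto> exp (-s |z - u|\<^sup>2)\<close> are exponentials,
  whose linear span is dense in the continuous functions by Stone--Weierstrass.\<close>

lemma gauss_transform_determines_measure:
  assumes \<mu>: "complex_prob \<mu>" and \<nu>: "complex_prob \<nu>" and s: "s > 0"
    and supp: "AE z in \<mu>. z \<in> cball 0 B" "AE z in \<nu>. z \<in> cball 0 B"
    and eq: "\<And>u. (\<integral>z. exp (- (s * (dist z u)\<^sup>2)) \<partial>\<mu>) = (\<integral>z. exp (- (s * (dist z u)\<^sup>2)) \<partial>\<nu>)"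
  shows "\<mu> = \<nu>"
proof (rule measure_eq_if_continuous_integral_eq[OF \<mu> \<nu>])
  fix g :: "complex \<Rightarrow> real"
  assume g: "continuous_on UNIV g" and g01: "\<And>z. 0 \<le> g z \<and> g z \<le> 1"
  interpret \<mu>: complex_prob \<mu> by (rule \<mu>)
  interpret \<nu>: complex_prob \<nu> by (rule \<nu>)
  define w where "w z = exp (- (s * (norm z)\<^sup>2))" for z :: complex
  have w01: "0 \<le> w z" "w z \<le> 1" for z using s by (auto simp: w_def)
  have contw: "continuous_on UNIV w" unfolding w_def by (intro continuous_intros)
  have int: "integrable \<rho> (\<lambda>z. f z * w z)"
    if "complex_prob \<rho>" "AE z in \<rho>. z \<in> cball 0 B" "continuous_on UNIV f" for \<rho> f
  proof -
    interpret complex_prob \<rho> by fact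
    have "bounded ((\<lambda>z. f z * w z) ` cball 0 B)"
      by (intro compact_imp_bounded compact_continuous_image continuous_intros
          continuous_on_subset[OF that(3)] continuous_on_subset[OF contw]) auto
    then obtain C where "\<forall>x\<in>(\<lambda>z. f z * w z) ` cball 0 B. norm x \<le> C"
      unfolding bounded_iff by blast
    then have C: "\<bar>f z * w z\<bar> \<le> C" if "z \<in> cball 0 B" for z
      using that by (metis imageI real_norm_def)
    show ?thesis
    proof (rule integrable_bounded)
      show "(\<lambda>z. f z * w z) \<in> borel_measurable borel"
        by (intro borel_measurable_continuous_onI continuous_intros that contw)
      show "AE z in \<rho>. \<bar>f z * w z\<bar> \<le> C" using that(2) by eventually_elim (rule C)
    qed
  qed
  have expo: "(\<integral>z. f z * w z \<partial>\<mu>) = (\<integral>z. f z * w z \<partial>\<nu>)" if "f \<in> exp_sums" for f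
    using that
  proof induction
    case (base c u)
    \<comment> \<open>Completing the square: \<open>u \<bullet> z - s |z|\<^sup>2\<close> is a
      constant minus \<open>s |z - ?u|\<^sup>2\<close> exactly for this centre.\<close>
    let ?u = "u /\<^sub>R (2 * s)"
    have ce: "c * exp (u \<bullet> z) * w z = c * exp (s * (norm ?u)\<^sup>2) * exp (- (s * (dist z ?u)\<^sup>2))" for z
    proof -
      have "(dist z ?u)\<^sup>2 = (norm z)\<^sup>2 + (norm ?u)\<^sup>2 - 2 * (?u \<bullet> z)"
        unfolding dist_norm power2_norm_eq_inner
        by (simp add: inner_diff_left inner_diff_right inner_commute)
      then have "s * (dist z ?u)\<^sup>2 = s * (norm z)\<^sup>2 + s * (norm ?u)\<^sup>2 - 2 * s * (?u \<bullet> z)"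
        by (simp only: distrib_left right_diff_distrib ac_simps)
      moreover have "2 * s * (?u \<bullet> z) = u \<bullet> z" using s by simp
      ultimately have *: "u \<bullet> z + - (s * (norm z)\<^sup>2) = s * (norm ?u)\<^sup>2 + - (s * (dist z ?u)\<^sup>2)"
        by linarith
      show ?thesis unfolding w_def mult.assoc exp_add[symmetric] * ..
    qed
    show ?case unfolding ce integral_mult_right_zero eq ..
  next
    case (add f h)
    then show ?case
      using int[OF \<mu> supp(1)] int[OF \<nu> supp(2)] continuous_on_exp_sums[of _ UNIV]
      by (simp add: distrib_right Bochner_Integration.integral_add)
  qed
  have close: "\<bar>(\<integral>z. g z \<partial>\<mu>) - (\<integral>z. g z \<partial>\<nu>)\<bar> \<le> 2 * e" if e: "e > 0" for e
  proof -
    interpret function_ring_on exp_sums "cball 0 B" by (rule exp_sums_function_ring)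
    \<comment> \<open>The quotient by \<open>w\<close> is approximated rather than \<open>g\<close>
      itself, since the transforms control integrals of \<open>f * w\<close>. Multiplying back costs
      nothing because \<open>w \<le> 1\<close>.\<close>
    have "continuous_on (cball 0 B) (\<lambda>z. g z / w z)"
      by (intro continuous_on_divide continuous_on_subset[OF g] continuous_on_subset[OF contw])
         (auto simp: w_def)
    from Stone_Weierstrass_basic[OF this e] obtain f where f: "f \<in> exp_sums"
      and close: "\<And>z. z \<in> cball 0 B \<Longrightarrow> \<bar>g z / w z - f z\<bar> < e" by blast
    have *: "\<bar>(\<integral>z. g z \<partial>\<rho>) - (\<integral>z. f z * w z \<partial>\<rho>)\<bar> \<le> e"
      if "complex_prob \<rho>" "AE z in \<rho>. z \<in> cball 0 B" for \<rho>
    proof -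
      interpret \<rho>: complex_prob \<rho> by fact
      have gi: "integrable \<rho> g"
        by (rule \<rho>.integrable_bounded[of _ 1]) (use g01 g in \<open>auto intro: borel_measurable_continuous_onI\<close>)
      have fi: "integrable \<rho> (\<lambda>z. f z * w z)" by (intro int that continuous_on_exp_sums f)
      have ae: "AE z in \<rho>. norm (g z - f z * w z) \<le> e"
        using that(2)
      proof eventually_elim
        case (elim z)
        have "g z - f z * w z = (g z / w z - f z) * w z" by (simp add: w_def left_diff_distrib)
        then have "norm (g z - f z * w z) = \<bar>g z / w z - f z\<bar> * w z" using w01 by (simp add: abs_mult)
        also have "\<dots> \<le> e * 1" using close[OF elim] w01 e by (intro mult_mono) auto
        finally show ?case by simp
      qed
      have "\<bar>\<integral>z. g z - f z * w z \<partial>\<rho>\<bar> \<le> (\<integral>z. \<bar>g z - f z * w z\<bar> \<partial>\<rho>)"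
        by (rule integral_abs_bound)
      also have "\<dots> \<le> (\<integral>z. e \<partial>\<rho>)"
        using ae gi fi by (intro integral_mono_AE) auto
      finally show ?thesis using gi fi by (simp add: \<rho>.prob_space[simplified])
    qed
    from *[OF \<mu> supp(1)] *[OF \<nu> supp(2)] expo[OF f] show ?thesis by linarith
  qed
  show "(\<integral>z. g z \<partial>\<mu>) = (\<integral>z. g z \<partial>\<nu>)"
  proof (rule ccontr)
    assume "(\<integral>z. g z \<partial>\<mu>) \<noteq> (\<integral>z. g z \<partial>\<nu>)"
    then have "\<bar>(\<integral>z. g z \<partial>\<mu>) - (\<integral>z. g z \<partial>\<nu>)\<bar> > 0" by simp
    with close[of "\<bar>(\<integral>z. g z \<partial>\<mu>) - (\<integral>z. g z \<partial>\<nu>)\<bar> / 4"] show False by simp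
  qed
qed

lemma AE_lborel_continuous_eq:
  fixes f g :: "complex \<Rightarrow> real"
  assumes "AE u in lborel. f u = g u" "continuous_on UNIV f" "continuous_on UNIV g"
  shows "f u = g u"
proof (rule ccontr)
  assume "f u \<noteq> g u"
  have "open {u. f u \<noteq> g u}"
    using assms by (intro open_Collect_neq) auto
  moreover have "{u. f u \<noteq> g u} \<in> null_sets lborel"
  proof -
    have "{u. f u \<noteq> g u} \<in> sets lborel" using \<open>open {u. f u \<noteq> g u}\<close> by simp
    with assms(1) show ?thesis by (subst AE_iff_null_sets) auto
  qed
  ultimately show False
    using \<open>f u \<noteq> g u\<close> open_not_negligible[of "{u. f u \<noteq> g u}"] null_sets_completionI
    by (auto simp: negligible_iff_null_sets)
qed

section \<open>The Gaussian energy as an inner product of transforms\<close>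

definition gauss_form :: "real \<Rightarrow> complex measure \<Rightarrow> complex measure \<Rightarrow> ennreal" where
  "gauss_form t \<mu> \<nu> = (\<integral>\<^sup>+z. \<integral>\<^sup>+w. ennreal (exp (- (t * (dist z w)\<^sup>2))) \<partial>\<nu> \<partial>\<mu>)"

text \<open>The rate is \<open>2 * t\<close> because two Gaussians of this rate, multiplied and
  integrated over the common variable \<open>u\<close>, give one of rate \<open>t\<close> in the
  difference of their centres. The normalizing factor is the integral \<open>gauss_mass t\<close> of
  a Gaussian of rate \<open>4 * t\<close>.\<close>

definition gauss_transform :: "real \<Rightarrow> complex measure \<Rightarrow> complex \<Rightarrow> ennreal" where
  "gauss_transform t \<mu> u = (\<integral>\<^sup>+z. ennreal (exp (- (2 * t * (dist z u)\<^sup>2))) \<partial>\<mu>)"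

definition gauss_mass :: "real \<Rightarrow> ennreal" where
  "gauss_mass t = (\<integral>\<^sup>+u. ennreal (exp (- (4 * t * (norm (u :: complex))\<^sup>2))) \<partial>lborel)"

lemma nn_integral_gauss_real_finite:
  assumes "t > 0"
  shows "(\<integral>\<^sup>+x. ennreal (exp (- (t * x\<^sup>2))) \<partial>lborel) < \<top>"
proof -
  define \<sigma> where "\<sigma> = sqrt (1 / (2 * t))"
  have \<sigma>: "\<sigma> > 0" "\<sigma>\<^sup>2 = 1 / (2 * t)" using assms by (auto simp: \<sigma>_def)
  have "exp (- (t * x\<^sup>2)) = sqrt (2 * pi * \<sigma>\<^sup>2) * normal_density 0 \<sigma> x" for x
    using \<sigma> assms by (simp add: normal_density_def)
  then have "(\<integral>\<^sup>+x. ennreal (exp (- (t * x\<^sup>2))) \<partial>lborel)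
      = (\<integral>\<^sup>+x. ennreal (sqrt (2 * pi * \<sigma>\<^sup>2)) * ennreal (normal_density 0 \<sigma> x) \<partial>lborel)"
    by (simp add: ennreal_mult)
  also have "\<dots> = ennreal (sqrt (2 * pi * \<sigma>\<^sup>2)) * (\<integral>\<^sup>+x. ennreal (normal_density 0 \<sigma> x) \<partial>lborel)"
    by (intro nn_integral_cmult) auto
  also have "(\<integral>\<^sup>+x. ennreal (normal_density 0 \<sigma> x) \<partial>lborel) = 1"
    using integral_normal_density[OF \<sigma>(1), of 0] integrable_normal_density[OF \<sigma>(1), of 0]
    by (subst nn_integral_eq_integral) auto
  finally show ?thesis by (simp add: ennreal_mult_less_top)
qed

lemma gauss_mass_finite:
  assumes "t > 0"
  shows "gauss_mass t < \<top>"
proof -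
  have "gauss_mass t = (\<integral>\<^sup>+u. (\<Prod>b\<in>Basis. ennreal (exp (- (4 * t * ((u::complex) \<bullet> b)\<^sup>2)))) \<partial>lborel)"
    unfolding gauss_mass_def
    by (intro nn_integral_cong)
       (simp add: Basis_complex_def cmod_power2 ennreal_mult'[symmetric] exp_add[symmetric] algebra_simps inner_complex_def)
  also have "\<dots> = (\<Prod>b\<in>(Basis :: complex set). \<integral>\<^sup>+x. ennreal (exp (- (4 * t * x\<^sup>2))) \<partial>lborel)"
    by (intro nn_integral_lborel_prod) auto
  also have "\<dots> < \<top>"
    using nn_integral_gauss_real_finite[of "4 * t"] assms
    by (simp add: Basis_complex_def ennreal_mult_less_top)
  finally show ?thesis .
qed

lemma gauss_mass_pos:
  assumes "t > 0"
  shows "gauss_mass t > 0"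
proof -
  have "gauss_mass t \<noteq> 0"
  proof
    assume "gauss_mass t = 0"
    then have "AE u in lborel. exp (- (4 * t * (norm (u::complex))\<^sup>2)) = 0"
      unfolding gauss_mass_def by (subst (asm) nn_integral_0_iff_AE) auto
    moreover have "continuous_on UNIV (\<lambda>u::complex. exp (- (4 * t * (norm u)\<^sup>2)))"
      by (intro continuous_intros)
    ultimately have "exp (- (4 * t * (norm (0::complex))\<^sup>2)) = 0"
      by (rule AE_lborel_continuous_eq) (rule continuous_on_const)
    then show False by simp
  qed
  then show ?thesis by (simp add: zero_less_iff_neq_zero)
qed

text \<open>By the parallelogram law around the midpoint of \<open>z\<close> and \<open>w\<close>,
  the product of the two Gaussians in \<open>u\<close> splits into
  \<open>exp (- (t * (dist z w)\<^sup>2))\<close> and a Gaussian centred at the midpoint, whose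
  integral is translation invariant. The rest is Tonelli.\<close>

lemma gauss_form_eq_transform:
  assumes \<mu>: "complex_prob \<mu>" and \<nu>: "complex_prob \<nu>"
  shows "gauss_mass t * gauss_form t \<mu> \<nu> = (\<integral>\<^sup>+u. gauss_transform t \<mu> u * gauss_transform t \<nu> u \<partial>lborel)"
proof -
  interpret \<mu>: complex_prob \<mu> by (rule \<mu>)
  interpret \<nu>: complex_prob \<nu> by (rule \<nu>)
  interpret \<mu>L: pair_sigma_finite \<mu> "lborel :: complex measure" ..
  interpret \<nu>L: pair_sigma_finite \<nu> "lborel :: complex measure" ..
  let ?e = "\<lambda>z u. ennreal (exp (- (2 * t * (dist z u)\<^sup>2)))"
  have point: "(\<integral>\<^sup>+u. ?e z u * ?e w u \<partial>lborel) = gauss_mass t * ennreal (exp (- (t * (dist z w)\<^sup>2)))" for z w :: complex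
  proof -
    let ?m = "(z + w) /\<^sub>R 2"
    have par: "2 * (dist z u)\<^sup>2 + 2 * (dist w u)\<^sup>2 = (dist z w)\<^sup>2 + 4 * (norm (- ?m + u))\<^sup>2" for u
    proof -
      have "2 * (dist z u)\<^sup>2 + 2 * (dist w u)\<^sup>2 = (dist z w)\<^sup>2 + (norm (2 *\<^sub>R (- ?m + u)))\<^sup>2"
        unfolding dist_norm power2_norm_eq_inner
        by (simp add: inner_diff_left inner_diff_right inner_add_left inner_add_right inner_commute algebra_simps)
      then show ?thesis by (simp add: power_mult_distrib)
    qed
    have "?e z u * ?e w u = ennreal (exp (- (4 * t * (norm (- ?m + u))\<^sup>2))) * ennreal (exp (- (t * (dist z w)\<^sup>2)))" for u
    proof -
      have "- (2 * t * (dist z u)\<^sup>2) + - (2 * t * (dist w u)\<^sup>2)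
          = - (t * (2 * (dist z u)\<^sup>2 + 2 * (dist w u)\<^sup>2))" by (simp add: algebra_simps)
      also have "\<dots> = - (4 * t * (norm (- ?m + u))\<^sup>2) + - (t * (dist z w)\<^sup>2)"
        unfolding par by (simp add: algebra_simps)
      finally show ?thesis by (simp only: ennreal_mult'[symmetric] exp_ge_zero exp_add[symmetric])
    qed
    then have "(\<integral>\<^sup>+u. ?e z u * ?e w u \<partial>lborel) =
        (\<integral>\<^sup>+u. ennreal (exp (- (4 * t * (norm (- ?m + u))\<^sup>2))) \<partial>lborel) * ennreal (exp (- (t * (dist z w)\<^sup>2)))"
      by (simp only:) (intro nn_integral_multc, measurable)
    also have "(\<integral>\<^sup>+u. ennreal (exp (- (4 * t * (norm (- ?m + u))\<^sup>2))) \<partial>lborel)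
       = (\<integral>\<^sup>+u. ennreal (exp (- (4 * t * (norm u)\<^sup>2))) \<partial>distr lborel borel ((+) (- ?m)))"
      by (subst nn_integral_distr) auto
    also have "\<dots> = gauss_mass t" unfolding lborel_distr_plus gauss_mass_def ..
    finally show ?thesis .
  qed
  have "(\<integral>\<^sup>+u. gauss_transform t \<mu> u * gauss_transform t \<nu> u \<partial>lborel)
     = (\<integral>\<^sup>+u. \<integral>\<^sup>+z. \<integral>\<^sup>+w. ?e z u * ?e w u \<partial>\<nu> \<partial>\<mu> \<partial>lborel)"
    unfolding gauss_transform_def
    by (subst nn_integral_multc[symmetric], measurable, subst nn_integral_cmult, measurable)
  also have "\<dots> = (\<integral>\<^sup>+z. \<integral>\<^sup>+u. \<integral>\<^sup>+w. ?e z u * ?e w u \<partial>\<nu> \<partial>lborel \<partial>\<mu>)"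
    by (rule \<mu>L.Fubini') measurable
  also have "\<dots> = (\<integral>\<^sup>+z. \<integral>\<^sup>+w. \<integral>\<^sup>+u. ?e z u * ?e w u \<partial>lborel \<partial>\<nu> \<partial>\<mu>)"
    by (intro nn_integral_cong \<nu>L.Fubini') measurable
  also have "\<dots> = gauss_mass t * gauss_form t \<mu> \<nu>"
    unfolding point gauss_form_def by (subst nn_integral_cmult, measurable)+
  finally show ?thesis by simp
qed

lemma gauss_transform_le_1:
  assumes \<mu>: "complex_prob \<mu>" and "t > 0"
  shows "gauss_transform t \<mu> u \<le> 1"
proof -
  interpret \<mu>: complex_prob \<mu> by (rule \<mu>)
  have "gauss_transform t \<mu> u \<le> (\<integral>\<^sup>+z. 1 \<partial>\<mu>)"
    unfolding gauss_transform_def using assms by (intro nn_integral_mono) simp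
  then show ?thesis using \<mu>.emeasure_space_1 by simp
qed

lemma ennreal_am_gm:
  fixes x y :: ennreal
  assumes "x < \<top>" "y < \<top>"
  shows "2 * (x * y) \<le> x * x + y * y" and "x * x + y * y \<le> 2 * (x * y) \<Longrightarrow> x = y"
proof -
  obtain a where a: "x = ennreal a" "a \<ge> 0" using assms by (cases x) auto
  obtain b where b: "y = ennreal b" "b \<ge> 0" using assms by (cases y) auto
  have 1: "2 * (x * y) = ennreal (2 * (a * b))"
    using a b by (simp add: ennreal_mult)
  have 2: "x * x + y * y = ennreal (a * a + b * b)"
    using a b by (simp add: ennreal_mult)
  have "0 \<le> (a - b)\<^sup>2" by simp
  then show "2 * (x * y) \<le> x * x + y * y"
    unfolding 1 2 by (intro ennreal_leI) (simp add: power2_eq_square algebra_simps)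
  assume "x * x + y * y \<le> 2 * (x * y)"
  then have "a * a + b * b \<le> 2 * (a * b)" using a b unfolding 1 2 by (subst (asm) ennreal_le_iff) auto
  then have "(a - b)\<^sup>2 \<le> 0" by (simp add: power2_eq_square algebra_simps)
  then show "x = y" using a b by simp
qed

lemma gauss_form_le_1:
  assumes \<mu>: "complex_prob \<mu>" and \<nu>: "complex_prob \<nu>" and "t > 0"
  shows "gauss_form t \<mu> \<nu> \<le> 1"
proof -
  interpret \<mu>: complex_prob \<mu> by (rule \<mu>)
  interpret \<nu>: complex_prob \<nu> by (rule \<nu>)
  have "gauss_form t \<mu> \<nu> \<le> (\<integral>\<^sup>+z. \<integral>\<^sup>+w. 1 \<partial>\<nu> \<partial>\<mu>)"
    unfolding gauss_form_def using \<open>t > 0\<close> by (intro nn_integral_mono) simp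
  then show ?thesis using \<mu>.emeasure_space_1 \<nu>.emeasure_space_1 by simp
qed

text \<open>In terms of the transforms \<open>?a\<close> and \<open>?b\<close> this is
  \<open>2 a b \<le> a\<^sup>2 + b\<^sup>2\<close> integrated over the plane, a form without
  differences that suits \<open>ennreal\<close>. Equality of the integrals, which are finite, forces
  the transforms to agree almost everywhere, hence everywhere by continuity, and they determine the
  measures.\<close>

lemma gauss_form_positive_definite:
  assumes \<mu>: "complex_prob \<mu>" and \<nu>: "complex_prob \<nu>" and t: "t > 0"
  shows "2 * gauss_form t \<mu> \<nu> \<le> gauss_form t \<mu> \<mu> + gauss_form t \<nu> \<nu>"
    and "AE z in \<mu>. z \<in> cball 0 B \<Longrightarrow> AE z in \<nu>. z \<in> cball 0 B \<Longrightarrow>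
      gauss_form t \<mu> \<mu> + gauss_form t \<nu> \<nu> \<le> 2 * gauss_form t \<mu> \<nu> \<Longrightarrow> \<mu> = \<nu>"
proof -
  interpret \<mu>: complex_prob \<mu> by (rule \<mu>)
  interpret \<nu>: complex_prob \<nu> by (rule \<nu>)
  let ?a = "gauss_transform t \<mu>" and ?b = "gauss_transform t \<nu>"
  have [measurable]: "?a \<in> borel_measurable borel" "?b \<in> borel_measurable borel"
    unfolding gauss_transform_def[abs_def] by measurable
  have fin: "?a u < \<top>" "?b u < \<top>" for u
    by (auto intro: le_less_trans[OF gauss_transform_le_1[OF \<mu> t]] le_less_trans[OF gauss_transform_le_1[OF \<nu> t]])
  have L: "gauss_mass t * (2 * gauss_form t \<mu> \<nu>) = (\<integral>\<^sup>+u. 2 * (?a u * ?b u) \<partial>lborel)"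
    unfolding mult.left_commute[of "gauss_mass t"] gauss_form_eq_transform[OF \<mu> \<nu>]
    by (intro nn_integral_cmult[symmetric]) measurable
  have R: "gauss_mass t * (gauss_form t \<mu> \<mu> + gauss_form t \<nu> \<nu>) = (\<integral>\<^sup>+u. ?a u * ?a u + ?b u * ?b u \<partial>lborel)"
    using gauss_form_eq_transform[OF \<mu> \<mu>, of t] gauss_form_eq_transform[OF \<nu> \<nu>, of t]
    by (subst nn_integral_add) (auto simp: distrib_left)
  have cancel: "x \<le> y" if "gauss_mass t * x \<le> gauss_mass t * y" for x y
    using that gauss_mass_pos[OF t] gauss_mass_finite[OF t]
    by (metis ennreal_mult_le_mult_iff less_irrefl zero_less_iff_neq_zero)
  show "2 * gauss_form t \<mu> \<nu> \<le> gauss_form t \<mu> \<mu> + gauss_form t \<nu> \<nu>"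
    by (rule cancel, unfold L R, intro nn_integral_mono ennreal_am_gm fin)
  assume supp: "AE z in \<mu>. z \<in> cball 0 B" "AE z in \<nu>. z \<in> cball 0 B"
    and le: "gauss_form t \<mu> \<mu> + gauss_form t \<nu> \<nu> \<le> 2 * gauss_form t \<mu> \<nu>"
  have "AE u in lborel. ?a u * ?a u + ?b u * ?b u \<le> 2 * (?a u * ?b u)"
  proof (rule ccontr)
    assume neg: "\<not> ?thesis"
    have "gauss_mass t * (2 * gauss_form t \<mu> \<nu>) \<noteq> \<infinity>"
      using gauss_form_le_1[OF \<mu> \<nu> t] gauss_mass_finite[OF t]
      by (auto simp: ennreal_mult_eq_top_iff top_unique)
    then have "(\<integral>\<^sup>+u. 2 * (?a u * ?b u) \<partial>lborel) < (\<integral>\<^sup>+u. ?a u * ?a u + ?b u * ?b u \<partial>lborel)"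
      unfolding L using neg by (intro nn_integral_less) (auto intro!: ennreal_am_gm fin)
    then have "\<not> gauss_mass t * (gauss_form t \<mu> \<mu> + gauss_form t \<nu> \<nu>) \<le> gauss_mass t * (2 * gauss_form t \<mu> \<nu>)"
      unfolding L R by simp
    then show False using le by (auto intro: mult_left_mono)
  qed
  then have ae: "AE u in lborel. ?a u = ?b u"
    by eventually_elim (intro ennreal_am_gm(2) fin)
  define A where "A \<rho> u = (\<integral>z. exp (- (2 * t * (dist z u)\<^sup>2)) \<partial>\<rho>)" for \<rho> :: "complex measure" and u
  have A: "gauss_transform t \<rho> u = ennreal (A \<rho> u)" "A \<rho> u \<ge> 0" "continuous_on UNIV (A \<rho>)"
    if \<rho>: "complex_prob \<rho>" for \<rho> u
  proof -
    interpret \<rho>: complex_prob \<rho> by (rule \<rho>)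
    have "integrable \<rho> (\<lambda>z. exp (- (2 * t * (dist z u)\<^sup>2)))"
      by (rule \<rho>.integrable_bounded[of _ 1]) (use t in auto)
    then show "gauss_transform t \<rho> u = ennreal (A \<rho> u)"
      unfolding gauss_transform_def A_def by (intro nn_integral_eq_integral) auto
    show "A \<rho> u \<ge> 0" unfolding A_def by simp
    show "continuous_on UNIV (A \<rho>)"
      unfolding continuous_on_sequentially
    proof (intro allI ballI impI, elim conjE)
      fix x :: "nat \<Rightarrow> complex" and a assume x: "x \<longlonglongrightarrow> a"
      show "(A \<rho> \<circ> x) \<longlonglongrightarrow> A \<rho> a"
        unfolding A_def comp_def
      proof (rule integral_dominated_convergence[where w = "\<lambda>_. 1"])
        show "AE z in \<rho>. (\<lambda>i. exp (- (2 * t * (dist z (x i))\<^sup>2))) \<longlonglongrightarrow> exp (- (2 * t * (dist z a)\<^sup>2))"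
          by (intro AE_I2 tendsto_intros x)
      qed (use t in auto)
    qed
  qed
  have "AE u in lborel. A \<mu> u = A \<nu> u"
    using ae A(1,2)[OF \<mu>] A(1,2)[OF \<nu>] by simp
  then have "A \<mu> u = A \<nu> u" for u
    by (rule AE_lborel_continuous_eq) (intro A \<mu> \<nu>)+
  then show "\<mu> = \<nu>"
    using gauss_transform_determines_measure[OF \<mu> \<nu> _ supp, of "2 * t"] t by (simp add: A_def)
qed

section \<open>Mutual logarithmic energy\<close>

text \<open>For measures on a disc of diameter at most \<open>b\<close> this is
  \<open>ln b - I(\<mu>,\<nu>)\<close>, so that equilibrium measures become minimizers.\<close>

definition mutual_energy :: "real \<Rightarrow> complex measure \<Rightarrow> complex measure \<Rightarrow> ennreal" where
  "mutual_energy b \<mu> \<nu> = (\<integral>\<^sup>+z. \<integral>\<^sup>+w. log_ker b z w \<partial>\<nu> \<partial>\<mu>)"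

lemma mutual_energy_commute:
  assumes \<mu>: "complex_prob \<mu>" and \<nu>: "complex_prob \<nu>"
  shows "mutual_energy b \<mu> \<nu> = mutual_energy b \<nu> \<mu>"
proof -
  interpret \<mu>: complex_prob \<mu> by (rule \<mu>)
  interpret \<nu>: complex_prob \<nu> by (rule \<nu>)
  interpret P: pair_sigma_finite \<mu> \<nu> ..
  show ?thesis
    unfolding mutual_energy_def
    by (subst P.Fubini') (auto simp: log_ker_commute)
qed

locale disc_prob = complex_prob M for M :: "complex measure" and B :: real +
  assumes in_disc: "AE z in M. z \<in> cball 0 B"

text \<open>Frullani's formula for the kernel, integrated over both measures. The last property is
  stated as a sum to avoid subtraction in \<open>ennreal\<close>; its term
  \<open>exp (- (t * b\<^sup>2))\<close> is the same for all pairs of probability measures and hence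
  cancels in comparisons.\<close>

lemma mutual_energy_gauss:
  assumes \<mu>: "disc_prob \<mu> B" and \<nu>: "disc_prob \<nu> B" and b: "b > 0" "2 * B \<le> b"
  obtains D where "D \<in> borel_measurable borel"
    "mutual_energy b \<mu> \<nu> = (\<integral>\<^sup>+t. D t * (ennreal (1 / (2 * t)) * indicator {0<..} t) \<partial>lborel)"
    "\<And>t. t > 0 \<Longrightarrow> D t + ennreal (exp (- (t * b\<^sup>2))) = gauss_form t \<mu> \<nu>"
proof
  interpret \<mu>: disc_prob \<mu> B by (rule \<mu>)
  interpret \<nu>: disc_prob \<nu> B by (rule \<nu>)
  interpret \<mu>L: pair_sigma_finite "lborel :: real measure" \<mu> ..
  interpret \<nu>L: pair_sigma_finite "lborel :: real measure" \<nu> ..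
  let ?f = "\<lambda>t z w. ennreal (exp (- (t * (dist z w)\<^sup>2)) - exp (- (t * b\<^sup>2)))"
  let ?w = "\<lambda>t::real. ennreal (1 / (2 * t)) * indicator {0<..} t"
  define D where "D t = (\<integral>\<^sup>+z. \<integral>\<^sup>+w. ?f t z w \<partial>\<nu> \<partial>\<mu>)" for t
  show "D \<in> borel_measurable borel" unfolding D_def[abs_def] by measurable
  have dist_le: "dist z w \<le> b" if "z \<in> cball 0 B" "w \<in> cball 0 B" for z w :: complex
    using that b dist_triangle2[of z w 0] by (simp add: dist_commute)
  have "mutual_energy b \<mu> \<nu> = (\<integral>\<^sup>+z. \<integral>\<^sup>+w. \<integral>\<^sup>+t. ?f t z w * ?w t \<partial>lborel \<partial>\<nu> \<partial>\<mu>)"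
    unfolding mutual_energy_def
  proof (rule nn_integral_cong_AE)
    show "AE z in \<mu>. (\<integral>\<^sup>+w. log_ker b z w \<partial>\<nu>) = (\<integral>\<^sup>+w. \<integral>\<^sup>+t. ?f t z w * ?w t \<partial>lborel \<partial>\<nu>)"
      using \<mu>.in_disc
    proof eventually_elim
      case (elim z)
      show ?case
        by (rule nn_integral_cong_AE, use \<nu>.in_disc in eventually_elim)
           (intro log_ker_eq_frullani dist_le b elim)
    qed
  qed
  also have "\<dots> = (\<integral>\<^sup>+z. \<integral>\<^sup>+t. \<integral>\<^sup>+w. ?f t z w * ?w t \<partial>\<nu> \<partial>lborel \<partial>\<mu>)"
    by (intro nn_integral_cong \<nu>L.Fubini') measurable
  also have "\<dots> = (\<integral>\<^sup>+t. \<integral>\<^sup>+z. \<integral>\<^sup>+w. ?f t z w * ?w t \<partial>\<nu> \<partial>\<mu> \<partial>lborel)"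
    by (rule \<mu>L.Fubini') measurable
  also have "\<dots> = (\<integral>\<^sup>+t. D t * ?w t \<partial>lborel)"
    unfolding D_def by (subst nn_integral_multc, measurable)+
  finally show "mutual_energy b \<mu> \<nu> = (\<integral>\<^sup>+t. D t * ?w t \<partial>lborel)" .
  fix t :: real assume t: "t > 0"
  let ?\<beta> = "ennreal (exp (- (t * b\<^sup>2)))"
  have "gauss_form t \<mu> \<nu> = (\<integral>\<^sup>+z. \<integral>\<^sup>+w. ?f t z w + ?\<beta> \<partial>\<nu> \<partial>\<mu>)"
    unfolding gauss_form_def
  proof (rule nn_integral_cong_AE)
    show "AE z in \<mu>. (\<integral>\<^sup>+w. ennreal (exp (- (t * (dist z w)\<^sup>2))) \<partial>\<nu>) = (\<integral>\<^sup>+w. ?f t z w + ?\<beta> \<partial>\<nu>)"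
      using \<mu>.in_disc
    proof eventually_elim
      case z: (elim z)
      show ?case
        using \<nu>.in_disc
      proof (intro nn_integral_cong_AE, eventually_elim)
        case (elim w)
        have "(dist z w)\<^sup>2 \<le> b\<^sup>2" by (intro power_mono dist_le z elim) auto
        then have "exp (- (t * b\<^sup>2)) \<le> exp (- (t * (dist z w)\<^sup>2))" using t by simp
        then show ?case by (simp add: ennreal_plus[symmetric] del: ennreal_plus)
      qed
    qed
  qed
  also have "\<dots> = D t + ?\<beta>"
    unfolding D_def
    by (subst nn_integral_add, measurable, subst nn_integral_add, measurable)
       (simp add: \<mu>.emeasure_space_1[simplified] \<nu>.emeasure_space_1[simplified])
  finally show "D t + ?\<beta> = gauss_form t \<mu> \<nu>" ..
qed

text \<open>Positive definiteness for each Gaussian, integrated with the weight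
  \<open>1 / (2 * t)\<close>. For distinct measures the inequality is strict at every
  \<open>t > 0\<close>, hence strict after integration as long as the energies are finite.\<close>

theorem mutual_energy_positive_definite:
  assumes \<mu>: "disc_prob \<mu> B" and \<nu>: "disc_prob \<nu> B" and b: "b > 0" "2 * B \<le> b"
  shows "2 * mutual_energy b \<mu> \<nu> \<le> mutual_energy b \<mu> \<mu> + mutual_energy b \<nu> \<nu>"
    and "mutual_energy b \<mu> \<mu> + mutual_energy b \<nu> \<nu> \<le> 2 * mutual_energy b \<mu> \<nu> \<Longrightarrow>
      mutual_energy b \<mu> \<mu> < \<top> \<Longrightarrow> mutual_energy b \<nu> \<nu> < \<top> \<Longrightarrow> \<mu> = \<nu>"
proof -
  interpret \<mu>: disc_prob \<mu> B by (rule \<mu>)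
  interpret \<nu>: disc_prob \<nu> B by (rule \<nu>)
  have cp: "complex_prob \<mu>" "complex_prob \<nu>" ..
  let ?w = "\<lambda>t::real. ennreal (1 / (2 * t)) * indicator {0<..} t"
  obtain D where [measurable]: "D \<in> borel_measurable borel"
    and D: "mutual_energy b \<mu> \<nu> = (\<integral>\<^sup>+t. D t * ?w t \<partial>lborel)"
      "\<And>t. t > 0 \<Longrightarrow> D t + ennreal (exp (- (t * b\<^sup>2))) = gauss_form t \<mu> \<nu>"
    using mutual_energy_gauss[OF \<mu> \<nu> b] by blast
  obtain E where [measurable]: "E \<in> borel_measurable borel"
    and E: "mutual_energy b \<mu> \<mu> = (\<integral>\<^sup>+t. E t * ?w t \<partial>lborel)"
      "\<And>t. t > 0 \<Longrightarrow> E t + ennreal (exp (- (t * b\<^sup>2))) = gauss_form t \<mu> \<mu>"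
    using mutual_energy_gauss[OF \<mu> \<mu> b] by blast
  obtain F where [measurable]: "F \<in> borel_measurable borel"
    and F: "mutual_energy b \<nu> \<nu> = (\<integral>\<^sup>+t. F t * ?w t \<partial>lborel)"
      "\<And>t. t > 0 \<Longrightarrow> F t + ennreal (exp (- (t * b\<^sup>2))) = gauss_form t \<nu> \<nu>"
    using mutual_energy_gauss[OF \<nu> \<nu> b] by blast
  have L: "2 * mutual_energy b \<mu> \<nu> = (\<integral>\<^sup>+t. 2 * D t * ?w t \<partial>lborel)"
    unfolding D(1) mult.assoc by (intro nn_integral_cmult[symmetric]) measurable
  have R: "mutual_energy b \<mu> \<mu> + mutual_energy b \<nu> \<nu> = (\<integral>\<^sup>+t. (E t + F t) * ?w t \<partial>lborel)"
    unfolding E(1) F(1) distrib_right by (intro nn_integral_add[symmetric]) measurable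
  have form_D: "2 * gauss_form t \<mu> \<nu> = 2 * ennreal (exp (- (t * b\<^sup>2))) + 2 * D t"
    and form_EF: "gauss_form t \<mu> \<mu> + gauss_form t \<nu> \<nu> = 2 * ennreal (exp (- (t * b\<^sup>2))) + (E t + F t)"
    if "t > 0" for t
    using D(2)[OF that] E(2)[OF that] F(2)[OF that]
    by (simp_all add: distrib_left mult_2[of "ennreal _"] ac_simps flip: D(2)[OF that] E(2)[OF that] F(2)[OF that])
  have fin: "2 * ennreal (exp (- (t * b\<^sup>2))) \<noteq> \<top>" for t by (simp add: ennreal_mult_eq_top_iff)
  have le: "2 * D t \<le> E t + F t" if "t > 0" for t
    using gauss_form_positive_definite(1)[OF cp that] fin
    unfolding form_D[OF that] form_EF[OF that] by (simp add: ennreal_add_left_cancel_le)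
  show "2 * mutual_energy b \<mu> \<nu> \<le> mutual_energy b \<mu> \<mu> + mutual_energy b \<nu> \<nu>"
    unfolding L R by (intro nn_integral_mono) (auto split: split_indicator intro!: mult_right_mono le)
  assume ge: "mutual_energy b \<mu> \<mu> + mutual_energy b \<nu> \<nu> \<le> 2 * mutual_energy b \<mu> \<nu>"
    and finite: "mutual_energy b \<mu> \<mu> < \<top>" "mutual_energy b \<nu> \<nu> < \<top>"
  show "\<mu> = \<nu>"
  proof (rule ccontr)
    assume "\<mu> \<noteq> \<nu>"
    have gt: "\<not> E t + F t \<le> 2 * D t" if "t > 0" for t
    proof
      assume "E t + F t \<le> 2 * D t"
      then have "gauss_form t \<mu> \<mu> + gauss_form t \<nu> \<nu> \<le> 2 * gauss_form t \<mu> \<nu>"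
        unfolding form_D[OF that] form_EF[OF that] by (intro add_left_mono)
      with gauss_form_positive_definite(2)[OF cp that \<mu>.in_disc \<nu>.in_disc] \<open>\<mu> \<noteq> \<nu>\<close> show False by simp
    qed
    have "(\<integral>\<^sup>+t. 2 * D t * ?w t \<partial>lborel) < (\<integral>\<^sup>+t. (E t + F t) * ?w t \<partial>lborel)"
    proof (rule nn_integral_less)
      have "(\<integral>\<^sup>+t. 2 * D t * ?w t \<partial>lborel) \<le> mutual_energy b \<mu> \<mu> + mutual_energy b \<nu> \<nu>"
        unfolding R by (intro nn_integral_mono) (auto split: split_indicator intro!: mult_right_mono le)
      then show "(\<integral>\<^sup>+t. 2 * D t * ?w t \<partial>lborel) \<noteq> \<infinity>"
        using finite by (auto simp: top_unique)
      show "AE t in lborel. 2 * D t * ?w t \<le> (E t + F t) * ?w t"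
        by (intro AE_I2) (auto split: split_indicator intro!: mult_right_mono le)
      show "\<not> (AE t in lborel. (E t + F t) * ?w t \<le> 2 * D t * ?w t)"
      proof
        assume "AE t in lborel. (E t + F t) * ?w t \<le> 2 * D t * ?w t"
        then have "AE t::real in lborel. \<not> t > 0"
        proof eventually_elim
          case (elim t)
          show ?case
          proof
            assume "t > 0"
            then have "ennreal (1 / (2 * t)) * (E t + F t) \<le> ennreal (1 / (2 * t)) * (2 * D t)"
              using elim by (simp add: mult.commute)
            then have "E t + F t \<le> 2 * D t"
              using \<open>t > 0\<close> by (subst (asm) ennreal_mult_le_mult_iff) auto
            with gt[OF \<open>t > 0\<close>] show False ..
          qed
        qed
        then have "{0<..} \<in> null_sets (lborel :: real measure)"
          by (subst AE_iff_null_sets) auto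
        then have "{0<..<1} \<in> null_sets (lborel :: real measure)"
          by (rule null_sets_subset) auto
        then show False by (auto simp: null_sets_def)
      qed
    qed measurable
    with ge show False unfolding L R by simp
  qed
qed

section \<open>Equilibrium measures\<close>

lemma prob_measures_on_iff:
  assumes "closed C"
  shows "\<mu> \<in> prob_measures_on C \<longleftrightarrow> complex_prob \<mu> \<and> (AE z in \<mu>. z \<in> C)"
proof
  assume "\<mu> \<in> prob_measures_on C"
  then have \<mu>: "sets \<mu> = sets borel" "prob_space \<mu>" "emeasure \<mu> C = 1"
    by (auto simp: prob_measures_on_def)
  interpret complex_prob \<mu>
    using \<mu> by (intro complex_prob.intro complex_prob_axioms.intro)
  have "C \<in> events" using assms by (simp add: sets_eq_borel borel_closed)
  then show "complex_prob \<mu> \<and> (AE z in \<mu>. z \<in> C)"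
    using \<mu>(3) prob_eq_1 complex_prob_axioms by (simp add: emeasure_eq_measure)
next
  assume r: "complex_prob \<mu> \<and> (AE z in \<mu>. z \<in> C)"
  interpret complex_prob \<mu> using r by blast
  have "C \<in> events" using assms by (simp add: sets_eq_borel borel_closed)
  then show "\<mu> \<in> prob_measures_on C"
    using r prob_eq_1 prob_space_axioms by (simp add: emeasure_eq_measure prob_measures_on_def sets_eq_borel)
qed

lemma prob_measures_on_disc_prob:
  assumes "\<mu> \<in> prob_measures_on C" "closed C" "C \<subseteq> cball 0 B"
  shows "disc_prob \<mu> B"
proof -
  have "complex_prob \<mu>" "AE z in \<mu>. z \<in> C" using assms prob_measures_on_iff by auto
  moreover from this(2) have "AE z in \<mu>. z \<in> cball 0 B"
    by eventually_elim (use assms(3) in auto)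
  ultimately show ?thesis by (simp add: disc_prob_def disc_prob_axioms_def)
qed

lemma prob_measures_on_mono:
  assumes "\<mu> \<in> prob_measures_on C" "closed C" "closed D" "C \<subseteq> D"
  shows "\<mu> \<in> prob_measures_on D"
  using assms by (auto simp: prob_measures_on_iff intro: eventually_mono)

text \<open>For \<open>y \<le> c\<close> and \<open>c \<ge> 0\<close> the positive parts satisfy
  \<open>y\<^sup>+ + (c - y)\<^sup>+ = y\<^sup>- + c\<close>. Integrating replaces the difference of
  two integrals by a single integral of a nonnegative function, which is the passage from
  \<open>log_energy\<close> to \<open>mutual_energy\<close>.\<close>

lemma ereal_integral_bounded_above:
  assumes M: "prob_space M" and f [measurable]: "f \<in> borel_measurable M"
    and le: "AE x in M. f x \<le> ereal c" and c: "c \<ge> 0"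
  shows "ereal_integral M f = ereal c - enn2ereal (\<integral>\<^sup>+x. e2ennreal (ereal c - f x) \<partial>M)"
proof -
  interpret prob_space M by (rule M)
  have split: "e2ennreal y + e2ennreal (ereal c - y) = e2ennreal (- y) + ennreal c" if "y \<le> ereal c" for y
  proof (cases y)
    case (real r)
    then have "r \<le> c" using that by simp
    then have "ennreal r + ennreal (c - r) = ennreal (- r) + ennreal c"
      using c by (cases "r \<ge> 0") (simp_all add: ennreal_neg flip: ennreal_plus)
    then show ?thesis using real by (simp add: e2ennreal_ereal)
  qed (use that in auto)
  let ?P = "\<integral>\<^sup>+x. e2ennreal (f x) \<partial>M" and ?N = "\<integral>\<^sup>+x. e2ennreal (- f x) \<partial>M"
    and ?Q = "\<integral>\<^sup>+x. e2ennreal (ereal c - f x) \<partial>M"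
  have "?P + ?Q = (\<integral>\<^sup>+x. e2ennreal (f x) + e2ennreal (ereal c - f x) \<partial>M)"
    by (rule nn_integral_add[symmetric]) measurable
  also have "\<dots> = (\<integral>\<^sup>+x. e2ennreal (- f x) + ennreal c \<partial>M)"
    by (rule nn_integral_cong_AE, use le in eventually_elim) (rule split)
  also have "\<dots> = ?N + ennreal c"
    by (subst nn_integral_add) (auto simp: emeasure_space_1)
  finally have eq: "?P + ?Q = ?N + ennreal c" .
  have "?P \<le> (\<integral>\<^sup>+x. ennreal c \<partial>M)"
    by (rule nn_integral_mono_AE, use le in eventually_elim)
       (metis e2ennreal_ereal e2ennreal_mono)
  then have "?P \<noteq> \<top>" by (auto simp: emeasure_space_1 top_unique)
  then obtain p where p: "?P = ennreal p" "p \<ge> 0" by (cases ?P) auto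
  show ?thesis
  proof (cases ?N)
    case (real n)
    have "?Q \<noteq> \<top>" using eq real by (metis ennreal_add_eq_top ennreal_neq_top)
    then obtain q where q: "?Q = ennreal q" "q \<ge> 0" by (cases ?Q) auto
    have "p + q = n + c"
      using eq p q real c by (simp flip: ennreal_plus)
    then show ?thesis unfolding ereal_integral_def p q real using p(2) q(2) real(1)
      by (simp add: enn2ereal_ennreal)
  next
    case top
    then have "?Q = \<top>" using eq p by (cases ?Q) (auto simp flip: ennreal_plus)
    then show ?thesis unfolding ereal_integral_def top p using p(2) by (simp add: enn2ereal_ennreal)
  qed
qed

lemma measurable_log_kernel [measurable]:
  "(\<lambda>(z, w). log_kernel z w) \<in> borel_measurable (borel \<Otimes>\<^sub>M borel)"
  unfolding log_kernel_def by measurable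

lemma log_potential_eq:
  assumes \<mu>: "complex_prob \<mu>" and "AE w in \<mu>. dist z w \<le> b" and b: "b \<ge> 1"
  shows "log_potential \<mu> z = ereal (ln b) - enn2ereal (\<integral>\<^sup>+w. log_ker b z w \<partial>\<mu>)"
proof -
  interpret complex_prob \<mu> by (rule \<mu>)
  have ker: "e2ennreal (ereal (ln b) - log_kernel z w) = log_ker b z w" for w
    using b by (auto simp: log_kernel_def log_ker_def ln_div dist_norm e2ennreal_ereal)
  have "AE w in \<mu>. log_kernel z w \<le> ereal (ln b)"
    using assms(2) by eventually_elim (use b in \<open>auto simp: log_kernel_def dist_norm\<close>)
  then show ?thesis
    unfolding log_potential_def using b
    by (subst ereal_integral_bounded_above[of _ _ "ln b"]) (simp_all add: prob_space_axioms ker)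
qed

lemma log_energy_eq:
  assumes \<mu>: "disc_prob \<mu> B" and b: "b \<ge> 1" "2 * B \<le> b"
  shows "log_energy \<mu> = ereal (ln b) - enn2ereal (mutual_energy b \<mu> \<mu>)"
proof -
  interpret disc_prob \<mu> B by (rule \<mu>)
  have cp: "complex_prob \<mu>" ..
  have pot: "AE z in \<mu>. log_potential \<mu> z = ereal (ln b) - enn2ereal (\<integral>\<^sup>+w. log_ker b z w \<partial>\<mu>)"
    using in_disc
  proof eventually_elim
    case z: (elim z)
    show ?case
    proof (rule log_potential_eq[OF cp _ b(1)])
      show "AE w in \<mu>. dist z w \<le> b"
        using in_disc
      proof eventually_elim
        case (elim w)
        then show ?case using z b dist_triangle2[of z w 0] by (simp add: dist_commute)
      qed
    qed
  qed
  have ub: "AE z in \<mu>. log_potential \<mu> z \<le> ereal (ln b)"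
    using pot
  proof eventually_elim
    case (elim z)
    have "ereal x - enn2ereal y \<le> ereal x" for x y
      by (cases y) (auto simp: enn2ereal_ennreal)
    then show ?case unfolding elim .
  qed
  have [measurable]: "log_potential \<mu> \<in> borel_measurable \<mu>"
    unfolding log_potential_def[abs_def] ereal_integral_def by measurable
  have "(\<integral>\<^sup>+z. e2ennreal (ereal (ln b) - log_potential \<mu> z) \<partial>\<mu>) = mutual_energy b \<mu> \<mu>"
    unfolding mutual_energy_def
  proof (rule nn_integral_cong_AE, use pot in eventually_elim)
    case (elim z)
    have "ereal x - (ereal x - enn2ereal y) = enn2ereal y" for x y
      by (cases y) (auto simp: enn2ereal_ennreal)
    then show ?case unfolding elim by simp
  qed
  then show ?thesis
    unfolding log_energy_def using b ub
    by (subst ereal_integral_bounded_above[of _ _ "ln b"]) (simp_all add: prob_space_axioms)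
qed

section \<open>Lower semicontinuity of the energy along weak limits\<close>

lemma log_ker_less_eventually:
  assumes b: "b > 0" and lim: "x \<longlonglongrightarrow> z" "y \<longlonglongrightarrow> w" and c: "c < log_ker b z w"
  shows "\<forall>\<^sub>F n in sequentially. c < log_ker b (x n) (y n)"
proof (cases "z = w")
  case True
  have "c < \<top>" using c by (auto intro: less_le_trans)
  then obtain r where r: "c = ennreal r" "r \<ge> 0" by (cases c) auto
  have "(\<lambda>n. dist (x n) (y n)) \<longlonglongrightarrow> 0"
    using tendsto_dist[OF lim] True by simp
  \<comment> \<open>At distance \<open>b * exp (- (r + 1))\<close> the kernel has the value
    \<open>r + 1\<close>, so it exceeds \<open>r\<close> for all closer pairs.\<close>
  then have "\<forall>\<^sub>F n in sequentially. dist (x n) (y n) < b * exp (- (r + 1))"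
    using b by (intro order_tendstoD) auto
  then show ?thesis
  proof eventually_elim
    case (elim n)
    show ?case
    proof (cases "x n = y n")
      case False
      then have "ln (dist (x n) (y n)) < ln (b * exp (- (r + 1)))"
        using elim b by (subst ln_less_cancel_iff) auto
      then have "r < ln (b / dist (x n) (y n))"
        using False b by (simp add: ln_mult ln_div)
      then show ?thesis using False r by (simp add: log_ker_def ennreal_less_iff)
    qed (simp add: log_ker_def r)
  qed
next
  case False
  have d: "(\<lambda>n. dist (x n) (y n)) \<longlonglongrightarrow> dist z w" by (rule tendsto_dist[OF lim])
  have "(\<lambda>n. ennreal (ln (b / dist (x n) (y n)))) \<longlonglongrightarrow> ennreal (ln (b / dist z w))"
    using False b by (intro tendsto_intros d) auto
  then have "\<forall>\<^sub>F n in sequentially. c < ennreal (ln (b / dist (x n) (y n)))"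
    using c False by (intro order_tendstoD) (auto simp: log_ker_def)
  then show ?thesis
    by eventually_elim (auto simp: log_ker_def intro: less_le_trans)
qed

lemma log_ker_le_liminf:
  assumes "b > 0" "x \<longlonglongrightarrow> z" "y \<longlonglongrightarrow> w" and T: "T \<longlonglongrightarrow> \<top>"
  shows "log_ker b z w \<le> liminf (\<lambda>n. min (log_ker b (x n) (y n)) (T n))"
  unfolding le_Liminf_iff
proof (intro allI impI)
  fix c assume c: "c < log_ker b z w"
  then have "\<forall>\<^sub>F n in sequentially. c < T n"
    by (intro order_tendstoD(1)[OF T] order.strict_trans2[OF c top_greatest])
  with log_ker_less_eventually[OF assms(1-3) c]
  show "\<forall>\<^sub>F n in sequentially. c < min (log_ker b (x n) (y n)) (T n)"
    by eventually_elim simp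
qed

text \<open>The cut makes the energy of a finite sum of point masses finite. With levels tending to
  infinity it still bounds the full energy of a weak limit; the level \<open>\<top>\<close> gives
  the energy itself.\<close>

definition truncated_energy :: "ennreal \<Rightarrow> real \<Rightarrow> complex measure \<Rightarrow> ennreal" where
  "truncated_energy T b \<mu> = (\<integral>\<^sup>+z. \<integral>\<^sup>+w. min (log_ker b z w) T \<partial>\<mu> \<partial>\<mu>)"

lemma truncated_energy_top: "truncated_energy \<top> b \<mu> = mutual_energy b \<mu> \<mu>"
  by (simp add: truncated_energy_def mutual_energy_def)

text \<open>The double integrals become integrals over two independent copies \<open>s\<close>,
  \<open>t\<close> of the sample point, where the variables converge pointwise. Fatou's lemma is
  then applied once in each copy.\<close>

lemma mutual_energy_le_liminf:
  fixes P :: "real measure"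
  assumes P: "prob_space P" and X [measurable]: "\<And>n. X n \<in> borel_measurable P"
    and Y [measurable]: "Y \<in> borel_measurable P"
    and lim: "\<And>\<omega>. \<omega> \<in> space P \<Longrightarrow> (\<lambda>n. X n \<omega>) \<longlonglongrightarrow> Y \<omega>"
    and b: "b > 0" and T: "T \<longlonglongrightarrow> \<top>"
  shows "mutual_energy b (distr P borel Y) (distr P borel Y)
    \<le> liminf (\<lambda>n. truncated_energy (T n) b (distr P borel (X n)))"
proof -
  interpret P: prob_space P by (rule P)
  interpret PY: prob_space "distr P borel Y" by (rule P.prob_space_distr) measurable
  have PX: "prob_space (distr P borel (X n))" for n by (rule P.prob_space_distr) measurable
  have "mutual_energy b (distr P borel Y) (distr P borel Y)
      = (\<integral>\<^sup>+s. \<integral>\<^sup>+t. log_ker b (Y s) (Y t) \<partial>P \<partial>P)"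
    unfolding mutual_energy_def by (simp add: nn_integral_distr)
  also have "\<dots> \<le> (\<integral>\<^sup>+s. liminf (\<lambda>n. \<integral>\<^sup>+t. min (log_ker b (X n s) (X n t)) (T n) \<partial>P) \<partial>P)"
  proof (rule nn_integral_mono)
    fix s assume s: "s \<in> space P"
    have "(\<integral>\<^sup>+t. log_ker b (Y s) (Y t) \<partial>P) \<le> (\<integral>\<^sup>+t. liminf (\<lambda>n. min (log_ker b (X n s) (X n t)) (T n)) \<partial>P)"
      by (intro nn_integral_mono log_ker_le_liminf b lim s T)
    also have "\<dots> \<le> liminf (\<lambda>n. \<integral>\<^sup>+t. min (log_ker b (X n s) (X n t)) (T n) \<partial>P)"
      by (rule nn_integral_liminf) measurable
    finally show "(\<integral>\<^sup>+t. log_ker b (Y s) (Y t) \<partial>P) \<le> \<dots>" .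
  qed
  also have "\<dots> \<le> liminf (\<lambda>n. \<integral>\<^sup>+s. \<integral>\<^sup>+t. min (log_ker b (X n s) (X n t)) (T n) \<partial>P \<partial>P)"
    by (rule nn_integral_liminf) measurable
  also have "(\<lambda>n. \<integral>\<^sup>+s. \<integral>\<^sup>+t. min (log_ker b (X n s) (X n t)) (T n) \<partial>P \<partial>P)
      = (\<lambda>n. truncated_energy (T n) b (distr P borel (X n)))"
  proof
    fix n
    interpret PX: prob_space "distr P borel (X n)" by (rule PX)
    show "(\<integral>\<^sup>+s. \<integral>\<^sup>+t. min (log_ker b (X n s) (X n t)) (T n) \<partial>P \<partial>P)
        = truncated_energy (T n) b (distr P borel (X n))"
      unfolding truncated_energy_def by (simp add: nn_integral_distr)
  qed
  finally show ?thesis .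
qed

text \<open>Serves two purposes. With level \<open>\<top>\<close> and one fixed set it yields
  minimizers. With growing finite levels and with preimages of a disc under iterates, which carry
  the measures only from some index on, it yields measures on filled Julia sets.\<close>

lemma disc_prob_subseq_limit:
  assumes \<sigma>: "\<And>n. disc_prob (\<sigma> n) B" and b: "b > 0" and T: "T \<longlonglongrightarrow> \<top>"
    and le: "\<And>n. truncated_energy (T n) b (\<sigma> n) \<le> f n" and f: "f \<longlonglongrightarrow> e"
    and C: "\<And>j. closed (C j)" "\<And>n j. n \<ge> j \<Longrightarrow> AE z in \<sigma> n. z \<in> C j"
  obtains \<mu> where "complex_prob \<mu>" "\<And>j. AE z in \<mu>. z \<in> C j" "mutual_energy b \<mu> \<mu> \<le> e"
proof -
  have cp: "complex_prob (\<sigma> n)" for n using \<sigma>[of n] by (simp add: disc_prob_def)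
  have 1: "sets (\<sigma> n) = sets borel" "prob_space (\<sigma> n)" for n
    using cp[of n] by (auto simp: complex_prob_def complex_prob_axioms_def)
  have 2: "AE z in \<sigma> n. z \<in> cball 0 B" for n using \<sigma>[of n] by (simp add: disc_prob_def disc_prob_axioms_def)
  obtain r :: "nat \<Rightarrow> nat" and P :: "real measure" and X :: "nat \<Rightarrow> real \<Rightarrow> complex" and Y
    where r: "strict_mono r" and P: "prob_space P"
    and X [measurable]: "\<And>n. X n \<in> borel_measurable P" and Y [measurable]: "Y \<in> borel_measurable P"
    and law: "\<And>n. distr P borel (X n) = \<sigma> (r n)"
    and lim: "\<And>\<omega>. \<omega> \<in> space P \<Longrightarrow> (\<lambda>n. X n \<omega>) \<longlonglongrightarrow> Y \<omega>"
    by (rule complex_skorohod_compactness[of \<sigma> B, OF 1 2]) blast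
  interpret P: prob_space P by (rule P)
  show thesis
  proof
    show "complex_prob (distr P borel Y)"
      by (intro complex_prob.intro P.prob_space_distr complex_prob_axioms.intro) auto
    have rT: "(\<lambda>n. T (r n)) \<longlonglongrightarrow> \<top>" using LIMSEQ_subseq_LIMSEQ[OF T r] by (simp add: comp_def)
    have "liminf (\<lambda>n. truncated_energy (T (r n)) b (\<sigma> (r n))) \<le> liminf (f \<circ> r)"
      by (intro Liminf_mono always_eventually) (auto simp: le)
    also have "\<dots> = e"
      by (intro lim_imp_Liminf LIMSEQ_subseq_LIMSEQ[OF f r]) simp
    finally show "mutual_energy b (distr P borel Y) (distr P borel Y) \<le> e"
      using mutual_energy_le_liminf[OF P X Y lim b rT] by (simp add: law)
    fix j
    have "AE \<omega> in P. \<forall>n. r n \<ge> j \<longrightarrow> X n \<omega> \<in> C j"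
    proof (intro AE_all_countable[THEN iffD2] allI)
      fix n
      have "AE \<omega> in P. X n \<omega> \<in> C j" if "r n \<ge> j"
        using C(2)[OF that] C(1)[of j] unfolding law[symmetric]
        by (subst (asm) AE_distr_iff) (auto simp: borel_closed)
      then show "AE \<omega> in P. r n \<ge> j \<longrightarrow> X n \<omega> \<in> C j" by auto
    qed
    then have "AE \<omega> in P. Y \<omega> \<in> C j"
    proof (rule AE_mp, intro AE_I2 impI)
      fix \<omega> assume \<omega>: "\<omega> \<in> space P" and in_C: "\<forall>n. r n \<ge> j \<longrightarrow> X n \<omega> \<in> C j"
      have "\<forall>\<^sub>F n in sequentially. X n \<omega> \<in> C j"
        using in_C seq_suble[OF r] by (intro eventually_sequentiallyI[of j]) (meson order_trans)
      then show "Y \<omega> \<in> C j"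
        using Lim_in_closed_set[OF C(1) _ _ lim[OF \<omega>]] by simp
    qed
    then show "AE z in distr P borel Y. z \<in> C j"
      using C(1)[of j] by (subst AE_distr_iff) (auto simp: borel_closed)
  qed
qed

section \<open>Convex combinations, existence and uniqueness of energy minimizers\<close>

definition mixture :: "real \<Rightarrow> complex measure \<Rightarrow> complex measure \<Rightarrow> complex measure" where
  "mixture p \<mu> \<nu> = measure_pmf (bernoulli_pmf p) \<bind> (\<lambda>x. if x then \<nu> else \<mu>)"

lemma mixture:
  assumes \<mu>: "complex_prob \<mu>" and \<nu>: "complex_prob \<nu>" and p: "0 \<le> p" "p \<le> 1"
  shows complex_prob_mixture: "complex_prob (mixture p \<mu> \<nu>)"
    and nn_integral_mixture: "f \<in> borel_measurable borel \<Longrightarrow>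
      (\<integral>\<^sup>+z. f z \<partial>mixture p \<mu> \<nu>) = ennreal p * (\<integral>\<^sup>+z. f z \<partial>\<nu>) + ennreal (1 - p) * (\<integral>\<^sup>+z. f z \<partial>\<mu>)"
proof -
  interpret \<mu>: complex_prob \<mu> by (rule \<mu>)
  interpret \<nu>: complex_prob \<nu> by (rule \<nu>)
  have *: "(\<lambda>x. if x then \<nu> else \<mu>) \<in> measurable (measure_pmf (bernoulli_pmf p)) (subprob_algebra borel)"
    using \<mu>.sets_eq_borel \<nu>.sets_eq_borel
    by (auto simp: space_subprob_algebra \<mu>.subprob_space_axioms \<nu>.subprob_space_axioms)
  show "complex_prob (mixture p \<mu> \<nu>)"
    unfolding mixture_def
  proof (intro complex_prob.intro complex_prob_axioms.intro)
    show "prob_space (measure_pmf (bernoulli_pmf p) \<bind> (\<lambda>x. if x then \<nu> else \<mu>))"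
      by (rule measure_pmf.prob_space_bind[OF _ *])
         (auto intro!: AE_I2 \<mu>.prob_space_axioms \<nu>.prob_space_axioms)
    show "sets (measure_pmf (bernoulli_pmf p) \<bind> (\<lambda>x. if x then \<nu> else \<mu>)) = sets borel"
      by (rule sets_bind) (auto simp: \<mu>.sets_eq_borel \<nu>.sets_eq_borel)
  qed
  assume f: "f \<in> borel_measurable borel"
  show "(\<integral>\<^sup>+z. f z \<partial>mixture p \<mu> \<nu>) = ennreal p * (\<integral>\<^sup>+z. f z \<partial>\<nu>) + ennreal (1 - p) * (\<integral>\<^sup>+z. f z \<partial>\<mu>)"
    unfolding mixture_def nn_integral_bind[OF f *] using p by (simp add: mult.commute)
qed

lemma AE_mixture:
  assumes \<mu>: "complex_prob \<mu>" and \<nu>: "complex_prob \<nu>" and p: "0 \<le> p" "p \<le> 1"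
    and C: "closed C" "AE z in \<mu>. z \<in> C" "AE z in \<nu>. z \<in> C"
  shows "AE z in mixture p \<mu> \<nu>. z \<in> C"
proof -
  interpret \<mu>: complex_prob \<mu> by (rule \<mu>)
  interpret \<nu>: complex_prob \<nu> by (rule \<nu>)
  interpret m: complex_prob "mixture p \<mu> \<nu>" by (rule complex_prob_mixture[OF \<mu> \<nu> p])
  have [measurable]: "C \<in> sets borel" using C(1) by (rule borel_closed)
  have "(\<integral>\<^sup>+z. indicator (- C) z \<partial>\<rho>) = 0" if "complex_prob \<rho>" "AE z in \<rho>. z \<in> C" for \<rho>
  proof -
    interpret complex_prob \<rho> by fact
    have "AE z in \<rho>. indicator (- C) z = (0::ennreal)" using that(2) by eventually_elim auto
    then show ?thesis by (subst nn_integral_0_iff_AE) auto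
  qed
  from this[OF \<mu> C(2)] this[OF \<nu> C(3)]
  have "(\<integral>\<^sup>+z. indicator (- C) z \<partial>mixture p \<mu> \<nu>) = 0"
    by (subst nn_integral_mixture[OF \<mu> \<nu> p]) auto
  then have "AE z in mixture p \<mu> \<nu>. indicator (- C) z = (0::ennreal)"
    by (subst (asm) nn_integral_0_iff_AE) auto
  then show ?thesis by eventually_elim (auto split: split_indicator_asm)
qed

lemma mutual_energy_mixture:
  assumes \<mu>: "complex_prob \<mu>" and \<nu>: "complex_prob \<nu>" and p: "0 \<le> p" "p \<le> 1"
  shows "mutual_energy b (mixture p \<mu> \<nu>) (mixture p \<mu> \<nu>) =
    ennreal ((1 - p)\<^sup>2) * mutual_energy b \<mu> \<mu> + ennreal (2 * p * (1 - p)) * mutual_energy b \<mu> \<nu>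
      + ennreal (p\<^sup>2) * mutual_energy b \<nu> \<nu>"
proof -
  interpret \<mu>: complex_prob \<mu> by (rule \<mu>)
  interpret \<nu>: complex_prob \<nu> by (rule \<nu>)
  have "mutual_energy b (mixture p \<mu> \<nu>) (mixture p \<mu> \<nu>)
    = (\<integral>\<^sup>+z. ennreal p * (\<integral>\<^sup>+w. log_ker b z w \<partial>\<nu>) + ennreal (1 - p) * (\<integral>\<^sup>+w. log_ker b z w \<partial>\<mu>) \<partial>mixture p \<mu> \<nu>)"
    unfolding mutual_energy_def by (intro nn_integral_cong nn_integral_mixture[OF \<mu> \<nu> p]) measurable
  also have "\<dots> = ennreal p * (ennreal p * mutual_energy b \<nu> \<nu> + ennreal (1 - p) * mutual_energy b \<nu> \<mu>)
      + ennreal (1 - p) * (ennreal p * mutual_energy b \<mu> \<nu> + ennreal (1 - p) * mutual_energy b \<mu> \<mu>)"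
    unfolding mutual_energy_def
    by (subst nn_integral_mixture[OF \<mu> \<nu> p], measurable)
       (simp add: nn_integral_add nn_integral_cmult)
  also have "\<dots> = ennreal ((1 - p)\<^sup>2) * mutual_energy b \<mu> \<mu> + ennreal (2 * p * (1 - p)) * mutual_energy b \<mu> \<nu>
      + ennreal (p\<^sup>2) * mutual_energy b \<nu> \<nu>"
  proof -
    have 1: "ennreal ((1 - p)\<^sup>2) = ennreal (1 - p) * ennreal (1 - p)"
      using p by (simp add: power2_eq_square ennreal_mult)
    have 2: "ennreal (2 * p * (1 - p)) = ennreal p * ennreal (1 - p) + ennreal p * ennreal (1 - p)"
      using p by (simp flip: ennreal_mult ennreal_plus)
    have 3: "ennreal (p\<^sup>2) = ennreal p * ennreal p"
      using p by (simp add: power2_eq_square ennreal_mult)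
    show ?thesis unfolding 1 2 3 mutual_energy_commute[OF \<nu> \<mu>]
      by (simp add: distrib_left distrib_right ac_simps)
  qed
  finally show ?thesis .
qed

definition energy_minimizer :: "real \<Rightarrow> complex set \<Rightarrow> complex measure \<Rightarrow> bool" where
  "energy_minimizer b C \<omega> \<longleftrightarrow> \<omega> \<in> prob_measures_on C \<and>
    (\<forall>\<nu>\<in>prob_measures_on C. mutual_energy b \<omega> \<omega> \<le> mutual_energy b \<nu> \<nu>)"

text \<open>The energy of \<open>mixture p \<omega> \<nu>\<close> is a quadratic polynomial in
  \<open>p\<close> with minimum over \<open>[0, 1]\<close> at \<open>p = 0\<close>, so its
  derivative there, twice the difference of the two sides, is nonnegative. This is an averaged form
  of Frostman's theorem.\<close>

lemma energy_minimizer_variation: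
  assumes \<omega>: "energy_minimizer b C \<omega>" and C: "closed C" "C \<subseteq> cball 0 B" and b: "b > 0" "2 * B \<le> b"
    and \<nu>: "\<nu> \<in> prob_measures_on C" "mutual_energy b \<nu> \<nu> < \<top>"
  shows "mutual_energy b \<omega> \<omega> \<le> mutual_energy b \<omega> \<nu>"
proof (rule ccontr)
  assume less: "\<not> mutual_energy b \<omega> \<omega> \<le> mutual_energy b \<omega> \<nu>"
  have min: "mutual_energy b \<omega> \<omega> \<le> mutual_energy b \<rho> \<rho>" if "\<rho> \<in> prob_measures_on C" for \<rho>
    using \<omega> that by (auto simp: energy_minimizer_def)
  have \<omega>C: "\<omega> \<in> prob_measures_on C" using \<omega> by (simp add: energy_minimizer_def)
  have cp: "complex_prob \<omega>" "complex_prob \<nu>" "AE z in \<omega>. z \<in> C" "AE z in \<nu>. z \<in> C"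
    using \<omega>C \<nu> C prob_measures_on_iff by auto
  have "mutual_energy b \<omega> \<omega> < \<top>" using min[OF \<nu>(1)] \<nu>(2) by simp
  then obtain e where e: "mutual_energy b \<omega> \<omega> = ennreal e" "e \<ge> 0" by (cases "mutual_energy b \<omega> \<omega>") auto
  have "mutual_energy b \<omega> \<nu> < \<top>" using less by (simp add: not_le) (metis ennreal_less_top e(1) order.strict_trans)
  then obtain x where x: "mutual_energy b \<omega> \<nu> = ennreal x" "x \<ge> 0" by (cases "mutual_energy b \<omega> \<nu>") auto
  obtain v where v: "mutual_energy b \<nu> \<nu> = ennreal v" "v \<ge> 0" using \<nu>(2) by (cases "mutual_energy b \<nu> \<nu>") auto
  have "x < e" using less e x by (simp add: ennreal_less_iff not_le)
  have quad: "e \<le> (1 - p)\<^sup>2 * e + 2 * p * (1 - p) * x + p\<^sup>2 * v" if p: "0 \<le> p" "p \<le> 1" for p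
  proof -
    have "mixture p \<omega> \<nu> \<in> prob_measures_on C"
      using complex_prob_mixture[OF cp(1,2) p] AE_mixture[OF cp(1,2) p C(1) cp(3,4)] C(1)
      by (simp add: prob_measures_on_iff)
    from min[OF this] have "ennreal e \<le> ennreal ((1 - p)\<^sup>2 * e + 2 * p * (1 - p) * x + p\<^sup>2 * v)"
      unfolding mutual_energy_mixture[OF cp(1,2) p] e x v
      using p e(2) x(2) v(2) by (simp flip: ennreal_mult ennreal_plus)
    then show ?thesis using p e(2) x(2) v(2) by (subst (asm) ennreal_le_iff) auto
  qed
  \<comment> \<open>\<open>s\<close> is the coefficient of \<open>p\<^sup>2\<close> and
    \<open>2 * (x - e) < 0\<close> that of \<open>p\<close>. The choice of \<open>p\<close> makes
    \<open>p * s \<le> e - x\<close>, half of what the linear term can absorb; the 1 in the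
    denominator avoids division by zero.\<close>
  define s where "s = e - 2 * x + v"
  define m where "m = \<bar>s\<bar>"
  define p where "p = min 1 ((e - x) / (1 + m))"
  have m: "m \<ge> 0" by (simp add: m_def)
  have p: "0 < p" "p \<le> 1" using \<open>x < e\<close> m by (auto simp: p_def)
  have "p * m \<le> e - x"
  proof -
    have "p * m \<le> (e - x) / (1 + m) * (1 + m)"
      using m \<open>x < e\<close> by (intro mult_mono) (auto simp: p_def)
    then show ?thesis using m by simp
  qed
  moreover have "p * s \<le> p * m" using p by (intro mult_left_mono) (auto simp: m_def)
  ultimately have "p * s \<le> e - x" by (rule order_trans[rotated])
  moreover have "2 * a + u < 0" if "u \<le> - a" "a < 0" for a u :: real using that by linarith
  ultimately have "2 * (x - e) + p * s < 0" using \<open>x < e\<close> by simp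
  then have "p * (2 * (x - e) + p * s) < 0" using p by (simp add: mult_pos_neg)
  moreover have "(1 - p)\<^sup>2 * e + 2 * p * (1 - p) * x + p\<^sup>2 * v - e = p * (2 * (x - e) + p * s)"
    by (simp add: s_def power2_eq_square algebra_simps)
  ultimately show False using quad[of p] p by simp
qed

text \<open>The variational inequality bounds the mutual energy below by both energies, which is the
  equality case of positive definiteness.\<close>

lemma energy_minimizer_unique:
  assumes \<omega>: "energy_minimizer b C \<omega>" and \<nu>: "\<nu> \<in> prob_measures_on C"
    and C: "closed C" "C \<subseteq> cball 0 B" and b: "b > 0" "2 * B \<le> b"
    and fin: "mutual_energy b \<omega> \<omega> < \<top>" and le: "mutual_energy b \<nu> \<nu> \<le> mutual_energy b \<omega> \<omega>"
  shows "\<nu> = \<omega>"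
proof -
  have \<omega>C: "\<omega> \<in> prob_measures_on C" using \<omega> by (simp add: energy_minimizer_def)
  have fin': "mutual_energy b \<nu> \<nu> < \<top>" using fin le by simp
  have "mutual_energy b \<omega> \<omega> + mutual_energy b \<nu> \<nu> \<le> 2 * mutual_energy b \<omega> \<nu>"
    using energy_minimizer_variation[OF \<omega> C b \<nu> fin'] le
    unfolding mult_2 by (intro add_mono) auto
  then show ?thesis
    using mutual_energy_positive_definite(2)[OF prob_measures_on_disc_prob[OF \<omega>C C] prob_measures_on_disc_prob[OF \<nu> C] b]
      fin fin' by simp
qed

lemma energy_minimizer_exists:
  assumes \<nu>: "\<nu> \<in> prob_measures_on C" and C: "closed C" "C \<subseteq> cball 0 B" and b: "b > 0"
  obtains \<omega> where "energy_minimizer b C \<omega>"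
proof -
  define m where "m = (INF \<rho>\<in>prob_measures_on C. mutual_energy b \<rho> \<rho>)"
  have "prob_measures_on C \<noteq> {}" using \<nu> by auto
  then obtain f where f: "range f \<subseteq> (\<lambda>\<rho>. mutual_energy b \<rho> \<rho>) ` prob_measures_on C"
    and lim: "f \<longlonglongrightarrow> m"
    using Inf_as_limit[of "(\<lambda>\<rho>. mutual_energy b \<rho> \<rho>) ` prob_measures_on C"] by (auto simp: m_def)
  have "\<forall>n. \<exists>\<rho>. \<rho> \<in> prob_measures_on C \<and> f n = mutual_energy b \<rho> \<rho>" using f by auto
  then obtain \<sigma> where \<sigma>: "\<And>n. \<sigma> n \<in> prob_measures_on C" "\<And>n. f n = mutual_energy b (\<sigma> n) (\<sigma> n)"
    by metis
  have "truncated_energy \<top> b (\<sigma> n) \<le> f n" for n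
    unfolding truncated_energy_top \<sigma>(2) ..
  from disc_prob_subseq_limit[OF prob_measures_on_disc_prob[OF \<sigma>(1) C] b tendsto_const this lim, of "\<lambda>_. C"]
  obtain \<omega> where \<omega>: "complex_prob \<omega>" "AE z in \<omega>. z \<in> C" "mutual_energy b \<omega> \<omega> \<le> m"
    using \<sigma>(1) C(1) by (auto simp: prob_measures_on_iff)
  have "energy_minimizer b C \<omega>"
    unfolding energy_minimizer_def
    using \<omega> C(1) by (auto simp: prob_measures_on_iff m_def intro: order_trans INF_lower2)
  then show thesis by (rule that)
qed

lemma ereal_minus_enn2ereal_le_iff:
  "ereal c - enn2ereal x \<le> ereal c - enn2ereal y \<longleftrightarrow> y \<le> x"
  by (cases x; cases y) (auto simp: enn2ereal_ennreal ennreal_le_iff top_unique)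

lemma is_equilibrium_measure_iff:
  assumes C: "closed C" "C \<subseteq> cball 0 B" and b: "b \<ge> 1" "2 * B \<le> b"
  shows "is_equilibrium_measure C \<omega> \<longleftrightarrow> energy_minimizer b C \<omega>"
proof -
  have "log_energy \<nu> \<le> log_energy \<mu> \<longleftrightarrow> mutual_energy b \<mu> \<mu> \<le> mutual_energy b \<nu> \<nu>"
    if "\<mu> \<in> prob_measures_on C" "\<nu> \<in> prob_measures_on C" for \<mu> \<nu>
    using log_energy_eq[OF prob_measures_on_disc_prob[OF that(1) C] b]
      log_energy_eq[OF prob_measures_on_disc_prob[OF that(2) C] b]
    by (simp add: ereal_minus_enn2ereal_le_iff)
  then show ?thesis by (auto simp: is_equilibrium_measure_def energy_minimizer_def)
qed

theorem equilibrium_measure_minimizer: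
  assumes C: "closed C" "C \<subseteq> cball 0 B" and b: "b \<ge> 1" "2 * B \<le> b"
    and \<nu>: "\<nu> \<in> prob_measures_on C" "mutual_energy b \<nu> \<nu> < \<top>"
  shows "energy_minimizer b C (equilibrium_measure C)"
    and "mutual_energy b (equilibrium_measure C) (equilibrium_measure C) < \<top>"
proof -
  have b0: "b > 0" using b by simp
  obtain \<omega> where \<omega>: "energy_minimizer b C \<omega>"
    using energy_minimizer_exists[OF \<nu>(1) C b0] by blast
  have fin: "mutual_energy b \<rho> \<rho> < \<top>" if "energy_minimizer b C \<rho>" for \<rho>
    using that \<nu> by (auto simp: energy_minimizer_def intro: le_less_trans)
  have "equilibrium_measure C = \<omega>"
    unfolding equilibrium_measure_def is_equilibrium_measure_iff[OF C b]
  proof (rule the_equality[where P = "energy_minimizer b C", OF \<omega>])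
    fix \<rho> assume \<rho>: "energy_minimizer b C \<rho>"
    show "\<rho> = \<omega>"
      by (rule energy_minimizer_unique[OF \<omega> _ C b0 b(2) fin[OF \<omega>]])
         (use \<rho> \<omega> in \<open>auto simp: energy_minimizer_def\<close>)
  qed
  then show "energy_minimizer b C (equilibrium_measure C)"
    "mutual_energy b (equilibrium_measure C) (equilibrium_measure C) < \<top>"
    using \<omega> fin by auto
qed

lemma nonpolar_finite_energy:
  assumes K: "\<not> polar K" "closed K" "K \<subseteq> cball 0 B" and b: "b \<ge> 1" "2 * B \<le> b"
  obtains \<nu> where "\<nu> \<in> prob_measures_on K" "mutual_energy b \<nu> \<nu> < \<top>"
proof -
  obtain C \<mu> where C: "compact C" "C \<subseteq> K" "\<mu> \<in> prob_measures_on C" "log_energy \<mu> \<noteq> -\<infinity>"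
    using K(1) unfolding polar_def by blast
  have \<mu>: "\<mu> \<in> prob_measures_on K"
    using prob_measures_on_mono[OF C(3) compact_imp_closed[OF C(1)] K(2) C(2)] .
  have "mutual_energy b \<mu> \<mu> \<noteq> \<top>"
    using C(4) log_energy_eq[OF prob_measures_on_disc_prob[OF \<mu> K(2,3)] b] by auto
  with \<mu> show thesis by (intro that) (auto simp: less_top)
qed

section \<open>Empirical measures and the energy of filled Julia sets\<close>

text \<open>Points are given as an indexed family so that a repeated root counts with its
  multiplicity.\<close>

definition empirical :: "'i set \<Rightarrow> ('i \<Rightarrow> complex) \<Rightarrow> complex measure" where
  "empirical A f = distr (measure_pmf (pmf_of_set A)) borel f"

context
  fixes A :: "'i set" and f :: "'i \<Rightarrow> complex"
  assumes A: "finite A" "A \<noteq> {}"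
begin

lemma complex_prob_empirical: "complex_prob (empirical A f)"
  unfolding empirical_def
  by (intro complex_prob.intro complex_prob_axioms.intro measure_pmf.prob_space_distr) auto

lemma nn_integral_empirical:
  "g \<in> borel_measurable borel \<Longrightarrow> (\<integral>\<^sup>+z. g z \<partial>empirical A f) = (\<Sum>i\<in>A. g (f i)) / of_nat (card A)"
  unfolding empirical_def using A by (simp add: nn_integral_distr nn_integral_pmf_of_set)

lemma integral_empirical:
  fixes g :: "complex \<Rightarrow> real"
  shows "g \<in> borel_measurable borel \<Longrightarrow> (\<integral>z. g z \<partial>empirical A f) = (\<Sum>i\<in>A. g (f i)) / real (card A)"
  unfolding empirical_def using A by (simp add: integral_distr integral_pmf_of_set)

lemma AE_empirical: "C \<in> sets borel \<Longrightarrow> (AE z in empirical A f. z \<in> C) \<longleftrightarrow> (\<forall>i\<in>A. f i \<in> C)"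
  unfolding empirical_def using A by (simp add: AE_distr_iff AE_measure_pmf_iff)

end

lemma truncated_energy_empirical:
  fixes f :: "'i \<Rightarrow> complex"
  assumes A: "finite A" "A \<noteq> {}"
  shows "truncated_energy T b (empirical A f) =
    (\<Sum>p\<in>A. \<Sum>p'\<in>A. min (log_ker b (f p) (f p')) T) / of_nat (card A) / of_nat (card A)"
proof -
  interpret complex_prob "empirical A f" by (rule complex_prob_empirical[OF A])
  have "truncated_energy T b (empirical A f)
      = (\<Sum>p\<in>A. (\<Sum>p'\<in>A. min (log_ker b (f p) (f p')) T) / of_nat (card A)) / of_nat (card A)"
    unfolding truncated_energy_def
    by (subst nn_integral_empirical[OF A], measurable)+
  then show ?thesis by (simp add: divide_ennreal_def sum_distrib_right)
qed

section \<open>Iterates, escaping orbits and equidistributed preimages\<close>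

definition iter_poly :: "complex poly \<Rightarrow> nat \<Rightarrow> complex poly" where
  "iter_poly q m = ((pcompose q) ^^ m) [:0, 1:]"

lemma poly_iter_poly: "poly (iter_poly q m) z = (poly q ^^ m) z"
  by (induction m) (simp_all add: iter_poly_def poly_pcompose)

lemma degree_iter_poly: "degree (iter_poly q m) = degree q ^ m"
  by (induction m) (simp_all add: iter_poly_def degree_pcompose)

lemma lead_coeff_iter_poly:
  assumes "degree q > 0"
  shows "lead_coeff (iter_poly q (Suc m)) = lead_coeff q * lead_coeff (iter_poly q m) ^ degree q"
proof -
  have "degree (iter_poly q m) > 0" using assms by (simp add: degree_iter_poly)
  from lead_coeff_comp[OF this, of q] show ?thesis by (simp add: iter_poly_def)
qed

text \<open>The leading coefficient of the \<open>m\<close>-th iterate is that of \<open>q\<close>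
  to the power \<open>1 + d + ... + d^(m-1)\<close> with \<open>d = degree q\<close>; the geometric
  sum is \<open>(d^m - 1) / (d - 1)\<close>.\<close>

lemma ln_lead_coeff_iter_poly:
  assumes "degree q \<ge> 2"
  shows "ln (cmod (lead_coeff (iter_poly q m))) =
    (real (degree q ^ m) - 1) * (ln (cmod (lead_coeff q)) / (real (degree q) - 1))"
proof -
  have q0: "q \<noteq> 0" "degree q > 0" using assms by auto
  define L where "L = ln (cmod (lead_coeff q)) / (real (degree q) - 1)"
  show ?thesis
    unfolding L_def[symmetric]
  proof (induction m)
    case 0
    show ?case by (simp add: iter_poly_def)
  next
    case (Suc m)
    have "iter_poly q m \<noteq> 0" using degree_iter_poly[of q m] q0 by (metis degree_0 power_eq_0_iff not_gr0)
    then have "ln (cmod (lead_coeff (iter_poly q (Suc m)))) =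
        ln (cmod (lead_coeff q)) + real (degree q) * ln (cmod (lead_coeff (iter_poly q m)))"
      unfolding lead_coeff_iter_poly[OF q0(2)] using q0
      by (simp add: norm_mult norm_power ln_mult ln_realpow)
    also have "ln (cmod (lead_coeff q)) = (real (degree q) - 1) * L" using assms by (simp add: L_def)
    also have "(real (degree q) - 1) * L + real (degree q) * ln (cmod (lead_coeff (iter_poly q m)))
        = (real (degree q ^ Suc m) - 1) * L"
      unfolding Suc.IH by (simp add: algebra_simps)
    finally show ?case .
  qed
qed

text \<open>Doubling of the modulus off the disc drives every orbit that leaves it to infinity, so
  the filled Julia set consists of the points whose orbits stay in the disc.\<close>

locale escaping_poly =
  fixes q :: "complex poly" and R :: real
  assumes deg: "degree q \<ge> 2" and R_pos: "R > 0"
    and escape: "\<And>z. cmod z \<ge> R \<Longrightarrow> 2 * cmod z \<le> cmod (poly q z)"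
begin

lemma iterate_escapes:
  assumes "cmod z \<ge> R"
  shows "2 ^ m * cmod z \<le> cmod ((poly q ^^ m) z)"
proof (induction m)
  case (Suc m)
  have "1 * cmod z \<le> 2 ^ m * cmod z" by (intro mult_right_mono) auto
  then have "R \<le> cmod ((poly q ^^ m) z)" using Suc assms by linarith
  from escape[OF this] Suc show ?case by simp
qed simp

text \<open>An orbit that has left the disc never returns. Preimages of points of the disc under the
  \<open>m\<close>-th iterate therefore lie in all earlier preimages of the disc.\<close>

lemma iterate_bound_mono:
  assumes "cmod ((poly q ^^ m) z) \<le> R" "j \<le> m"
  shows "cmod ((poly q ^^ j) z) \<le> R"
proof (rule ccontr)
  assume "\<not> ?thesis"
  then have *: "cmod ((poly q ^^ j) z) > R" by simp
  have "1 * cmod ((poly q ^^ j) z) \<le> 2 ^ (m - j) * cmod ((poly q ^^ j) z)"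
    by (intro mult_right_mono) auto
  also have "\<dots> \<le> cmod ((poly q ^^ (m - j)) ((poly q ^^ j) z))"
    using * by (intro iterate_escapes) auto
  also have "(poly q ^^ (m - j)) ((poly q ^^ j) z) = (poly q ^^ m) z"
    using assms(2) by (metis comp_apply funpow_add le_add_diff_inverse2)
  finally show False using * assms(1) by simp
qed

lemma filled_julia_eq: "filled_julia q = (\<Inter>m. {z. cmod ((poly q ^^ m) z) \<le> R})"
proof (intro equalityI subsetI)
  fix z assume "z \<in> filled_julia q"
  then have bdd: "bounded (range (\<lambda>j. (poly q ^^ j) z))" by (simp add: filled_julia_def)
  then obtain c where c: "\<And>j. cmod ((poly q ^^ j) z) \<le> c" by (auto simp: bounded_iff)
  show "z \<in> (\<Inter>m. {z. cmod ((poly q ^^ m) z) \<le> R})"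
  proof (rule ccontr)
    assume "\<not> ?thesis"
    then obtain m where m: "cmod ((poly q ^^ m) z) > R" by (auto simp: not_le)
    obtain n where n: "c / R < 2 ^ n" using real_arch_pow[of 2 "c / R"] by auto
    have "c < 2 ^ n * R" using n R_pos by (simp add: field_simps)
    also have "\<dots> \<le> 2 ^ n * cmod ((poly q ^^ m) z)" using m by (intro mult_left_mono) auto
    also have "\<dots> \<le> cmod ((poly q ^^ n) ((poly q ^^ m) z))"
      using m by (intro iterate_escapes) auto
    also have "(poly q ^^ n) ((poly q ^^ m) z) = (poly q ^^ (n + m)) z" by (simp add: funpow_add)
    finally show False using c[of "n + m"] by simp
  qed
next
  fix z assume "z \<in> (\<Inter>m. {z. cmod ((poly q ^^ m) z) \<le> R})"
  then show "z \<in> filled_julia q" by (auto simp: filled_julia_def bounded_iff)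
qed

lemma closed_preimage_disc: "closed {z. cmod ((poly q ^^ m) z) \<le> R}"
  unfolding poly_iter_poly[symmetric] by (intro closed_Collect_le continuous_intros)

lemma closed_filled_julia: "closed (filled_julia q)"
  unfolding filled_julia_eq by (intro closed_INT ballI closed_preimage_disc)

lemma filled_julia_subset: "filled_julia q \<subseteq> cball 0 R"
proof
  fix z assume "z \<in> filled_julia q"
  then have "cmod ((poly q ^^ 0) z) \<le> R" unfolding filled_julia_eq by blast
  then show "z \<in> cball 0 R" by simp
qed

lemma filled_julia_invariant: "z \<in> filled_julia q \<Longrightarrow> poly q z \<in> filled_julia q"
  unfolding filled_julia_eq by (auto simp: funpow_swap1[symmetric]) (metis funpow.simps(2) comp_apply)

text \<open>Pull back \<open>N\<close> distinct points \<open>w i\<close> under the \<open>m\<close>-th iterate. Only pairs of roots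
  belonging to the same \<open>w i\<close> need the truncation; for the others the product over the roots of
  one fibre evaluates the iterate.\<close>

lemma preimage_measure_energy:
  fixes w :: "nat \<Rightarrow> complex" and N m :: nat and T b :: real
  assumes b: "2 * R \<le> b" and w: "\<And>i. i < N \<Longrightarrow> cmod (w i) \<le> R" "inj_on w {..<N}" and N: "N > 0"
    and T: "T \<ge> 0"
  defines "D \<equiv> real (degree q ^ m)" and "L \<equiv> ln (cmod (lead_coeff q)) / (real (degree q) - 1)"
  obtains \<sigma> where "complex_prob \<sigma>" "\<And>j. j \<le> m \<Longrightarrow> AE z in \<sigma>. cmod ((poly q ^^ j) z) \<le> R"
    "truncated_energy (ennreal T) b \<sigma> \<le> ennreal (T / N + (1 - 1 / N) * (ln b + (1 - 1 / D) * L)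
      - (\<Sum>i<N. \<Sum>j\<in>{..<N}-{i}. ln (dist (w i) (w j))) / N\<^sup>2 / D)"
proof -
  let ?A = "lead_coeff (iter_poly q m)"
  let ?d = "degree q ^ m"
  have b0: "b > 0" using b R_pos by simp
  have d0: "?d > 0" using deg by simp
  have A0: "?A \<noteq> 0" using degree_iter_poly[of q m] d0 by (metis degree_0 leading_coeff_0_iff less_irrefl)
  define P where "P i = iter_poly q m + [:- w i:]" for i
  have degP: "degree (P i) = ?d" for i
    unfolding P_def using d0
    by (subst degree_add_eq_left) (simp_all add: degree_iter_poly)
  have leadP: "lead_coeff (P i) = ?A" for i
    unfolding degP[of i] using d0 by (simp add: P_def degree_iter_poly coeff_eq_0)
  have "\<forall>i. \<exists>\<zeta>. smult (lead_coeff (P i)) (\<Prod>s<degree (P i). [:-\<zeta> s, 1:]) = P i"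
    using complex_poly_decompose' by blast
  from choice[OF this] have "\<exists>\<zeta>. \<forall>i. smult (lead_coeff (P i)) (\<Prod>s<degree (P i). [:-\<zeta> i s, 1:]) = P i" .
  then obtain \<zeta> where "\<And>i. smult ?A (\<Prod>s<?d. [:-\<zeta> i s, 1:]) = P i"
    unfolding leadP unfolding degP by blast
  then have polyP: "poly (iter_poly q m) z - w i = ?A * (\<Prod>s<?d. z - \<zeta> i s)" for i z
  proof -
    assume *: "\<And>i. smult ?A (\<Prod>s<?d. [:-\<zeta> i s, 1:]) = P i"
    have "poly (P i) z = ?A * (\<Prod>s<?d. z - \<zeta> i s)"
      unfolding *[of i, symmetric] by (simp add: poly_prod)
    then show ?thesis by (simp add: P_def)
  qed
  have root: "(poly q ^^ m) (\<zeta> i s) = w i" if "s < ?d" for i s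
  proof -
    have "(\<Prod>t<?d. \<zeta> i s - \<zeta> i t) = 0" using that by (intro prod_zero) auto
    then show ?thesis using polyP[of "\<zeta> i s" i]
      by (simp only: poly_iter_poly mult_zero_right right_minus_eq)
  qed
  let ?I = "{..<N} \<times> {..<?d}"
  define \<sigma> where "\<sigma> = empirical ?I (\<lambda>(i, s). \<zeta> i s)"
  have I: "finite ?I" "?I \<noteq> {}" using N d0 by (auto simp: lessThan_empty_iff)
  have supp: "cmod ((poly q ^^ j) (\<zeta> i s)) \<le> R" if "j \<le> m" "i < N" "s < ?d" for i s j
    using iterate_bound_mono[OF _ that(1)] root[OF that(3)] w(1)[OF that(2)] by simp
  have dist_le: "dist (\<zeta> i s) (\<zeta> j t) \<le> b" if "i < N" "j < N" "s < ?d" "t < ?d" for i j s t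
    using supp[of 0 i s] supp[of 0 j t] that b dist_triangle2[of "\<zeta> i s" "\<zeta> j t" 0] by simp
  define K where "K = (\<lambda>p p'. min (log_ker b (case p of (i, s) \<Rightarrow> \<zeta> i s) (case p' of (i, s) \<Rightarrow> \<zeta> i s)) (ennreal T))"
  \<comment> \<open>\<open>V i j\<close> is the total interaction of one root over
    \<open>w i\<close> with the whole fibre over \<open>w j\<close>. Evaluating the iterate minus
    \<open>w j\<close> at a root over \<open>w i\<close> gives
    \<open>w i - w j = ?A * (\<Prod>t<?d. \<zeta> i s - \<zeta> j t)\<close>, so the sum does not
    depend on which root is taken.\<close>
  define V where "V i j = D * ln b - ln (dist (w i) (w j)) + ln (cmod ?A)" for i j
  have Dpos: "D > 0" using d0 by (simp add: D_def)
  have V_sum: "(\<Sum>t<?d. K (i, s) (j, t)) \<le> ennreal (V i j)" and V_nonneg: "V i j \<ge> 0"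
    if "i < N" "j < N" "i \<noteq> j" "s < ?d" for i j s
  proof -
    have "w i \<noteq> w j" using w(2) that by (auto simp: inj_on_def)
    have eq: "w i - w j = ?A * (\<Prod>t<?d. \<zeta> i s - \<zeta> j t)"
      using polyP[of "\<zeta> i s" j] root[OF that(4), of i] by (simp add: poly_iter_poly)
    have ne: "\<zeta> i s \<noteq> \<zeta> j t" if t: "t < ?d" for t
      using root[OF that, of j] root[OF \<open>s < ?d\<close>, of i] \<open>w i \<noteq> w j\<close> by auto
    have "dist (w i) (w j) = cmod ?A * (\<Prod>t<?d. dist (\<zeta> i s) (\<zeta> j t))"
      unfolding dist_norm eq by (simp add: norm_mult prod_norm)
    moreover have "(\<Prod>t<?d. dist (\<zeta> i s) (\<zeta> j t)) \<noteq> 0" using ne by simp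
    moreover have "ln (\<Prod>t<?d. dist (\<zeta> i s) (\<zeta> j t)) = (\<Sum>t<?d. ln (dist (\<zeta> i s) (\<zeta> j t)))"
      by (rule ln_prod) (use ne in auto)
    ultimately have "ln (dist (w i) (w j)) = ln (cmod ?A) + (\<Sum>t<?d. ln (dist (\<zeta> i s) (\<zeta> j t)))"
      using A0 by (simp add: ln_mult del: prod_zero_iff)
    then have V: "V i j = (\<Sum>t<?d. ln (b / dist (\<zeta> i s) (\<zeta> j t)))"
      unfolding V_def D_def using b0 ne by (simp add: ln_div sum_subtractf)
    have nonneg: "0 \<le> ln (b / dist (\<zeta> i s) (\<zeta> j t))" if "t < ?d" for t
      using dist_le[OF \<open>i < N\<close> \<open>j < N\<close> \<open>s < ?d\<close> that] ne[OF that] b0 by simp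
    show "V i j \<ge> 0" unfolding V by (intro sum_nonneg nonneg) auto
    have "(\<Sum>t<?d. K (i, s) (j, t)) \<le> (\<Sum>t<?d. ennreal (ln (b / dist (\<zeta> i s) (\<zeta> j t))))"
      by (intro sum_mono) (use ne in \<open>auto simp: K_def log_ker_def\<close>)
    also have "\<dots> = ennreal (V i j)" unfolding V by (intro sum_ennreal nonneg) auto
    finally show "(\<Sum>t<?d. K (i, s) (j, t)) \<le> ennreal (V i j)" .
  qed
  \<comment> \<open>Within its own fibre, where roots may coincide, a root contributes at most the
    level \<open>T\<close> for each of the \<open>D\<close> partners.\<close>
  define S where "S = (\<Sum>i<N. D * T + (\<Sum>j\<in>{..<N}-{i}. V i j))"
  have S_nonneg: "0 \<le> D * T + (\<Sum>j\<in>{..<N}-{i}. V i j)" if "i < N" for i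
    using V_nonneg[of i _ 0] that d0 T Dpos by (intro add_nonneg_nonneg sum_nonneg) auto
  have "(\<Sum>p\<in>?I. \<Sum>p'\<in>?I. K p p') = (\<Sum>i<N. \<Sum>s<?d. \<Sum>j<N. \<Sum>t<?d. K (i, s) (j, t))"
    by (simp only: sum.cartesian_product')
  also have "\<dots> \<le> (\<Sum>i<N. \<Sum>s<?d. ennreal (D * T + (\<Sum>j\<in>{..<N}-{i}. V i j)))"
  proof (intro sum_mono)
    fix i s assume i: "i \<in> {..<N}" and s: "s \<in> {..<?d}"
    have "(\<Sum>j<N. \<Sum>t<?d. K (i, s) (j, t)) = (\<Sum>t<?d. K (i, s) (i, t)) + (\<Sum>j\<in>{..<N}-{i}. \<Sum>t<?d. K (i, s) (j, t))"
      using i by (subst sum.remove[of _ i]) auto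
    also have "\<dots> \<le> (\<Sum>t<?d. ennreal T) + (\<Sum>j\<in>{..<N}-{i}. ennreal (V i j))"
      using i s by (intro add_mono sum_mono V_sum) (auto simp: K_def)
    also have "(\<Sum>t<?d. ennreal T) = ennreal (D * T)"
      using T by (simp add: D_def ennreal_mult ennreal_of_nat_eq_real_of_nat)
    also have "(\<Sum>j\<in>{..<N}-{i}. ennreal (V i j)) = ennreal (\<Sum>j\<in>{..<N}-{i}. V i j)"
      using i s by (intro sum_ennreal V_nonneg[where s = s]) auto
    also have "ennreal (D * T) + \<dots> = ennreal (D * T + (\<Sum>j\<in>{..<N}-{i}. V i j))"
      using T Dpos V_nonneg i s by (intro ennreal_plus[symmetric] sum_nonneg) auto
    finally show "(\<Sum>j<N. \<Sum>t<?d. K (i, s) (j, t)) \<le> ennreal (D * T + (\<Sum>j\<in>{..<N}-{i}. V i j))" .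
  qed
  also have "\<dots> = ennreal (D * S)"
    unfolding S_def sum_distrib_left D_def[symmetric]
    using S_nonneg Dpos
    by (subst sum_ennreal[symmetric]) (auto simp: ennreal_mult D_def ennreal_of_nat_eq_real_of_nat)
  finally have le: "(\<Sum>p\<in>?I. \<Sum>p'\<in>?I. K p p') \<le> ennreal (D * S)" .
  have card: "of_nat (card ?I) = ennreal (N * D)" by (simp add: D_def ennreal_of_nat_eq_real_of_nat)
  have ND: "N * D > 0" using N Dpos by simp
  have Spos: "S \<ge> 0" unfolding S_def by (intro sum_nonneg S_nonneg) auto
  have "truncated_energy (ennreal T) b \<sigma> = (\<Sum>p\<in>?I. \<Sum>p'\<in>?I. K p p') / ennreal (N * D) / ennreal (N * D)"
    unfolding \<sigma>_def truncated_energy_empirical[OF I] card K_def ..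
  also have "\<dots> \<le> ennreal (D * S) / ennreal (N * D) / ennreal (N * D)"
    by (intro divide_right_mono_ennreal le)
  also have "\<dots> = ennreal (D * S / (N * D) / (N * D))"
    using ND Dpos Spos by (simp add: divide_ennreal)
  also have "D * S / (N * D) / (N * D) = T / N + (1 - 1 / N) * (ln b + (1 - 1 / D) * L)
      - (\<Sum>i<N. \<Sum>j\<in>{..<N}-{i}. ln (dist (w i) (w j))) / N\<^sup>2 / D"
  proof -
    let ?W = "\<Sum>i<N. \<Sum>j\<in>{..<N}-{i}. ln (dist (w i) (w j))"
    have lnA: "ln (cmod ?A) = (D - 1) * L"
      unfolding D_def L_def by (rule ln_lead_coeff_iter_poly[OF deg])
    have V_row: "(\<Sum>j\<in>{..<N}-{i}. V i j) = (real N - 1) * (D * ln b + (D - 1) * L)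
        - (\<Sum>j\<in>{..<N}-{i}. ln (dist (w i) (w j)))" if "i < N" for i
      using that N unfolding V_def lnA by (simp add: sum.distrib sum_subtractf algebra_simps of_nat_diff)
    have "S = (\<Sum>i<N. D * T + ((real N - 1) * (D * ln b + (D - 1) * L)
        - (\<Sum>j\<in>{..<N}-{i}. ln (dist (w i) (w j)))))"
      unfolding S_def by (intro sum.cong) (simp_all add: V_row)
    then have S_eq: "S = N * (D * T + (real N - 1) * (D * ln b + (D - 1) * L)) - ?W"
      by (simp add: sum.distrib sum_subtractf algebra_simps)
    show ?thesis unfolding S_eq using N Dpos by (simp add: field_simps power2_eq_square)
  qed
  finally have energy: "truncated_energy (ennreal T) b \<sigma> \<le> ennreal (T / N + (1 - 1 / N) * (ln b + (1 - 1 / D) * L)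
      - (\<Sum>i<N. \<Sum>j\<in>{..<N}-{i}. ln (dist (w i) (w j))) / N\<^sup>2 / D)" .
  show thesis
  proof (rule that[OF _ _ energy])
    show "complex_prob \<sigma>" unfolding \<sigma>_def by (rule complex_prob_empirical[OF I])
    fix j assume "j \<le> m"
    then show "AE z in \<sigma>. cmod ((poly q ^^ j) z) \<le> R"
      unfolding \<sigma>_def using supp AE_empirical[OF I, of "{z. cmod ((poly q ^^ j) z) \<le> R}"]
        borel_closed[OF closed_preimage_disc[of j]] by auto
  qed
qed

text \<open>In the bound for preimage measures the equal-fibre pairs cost \<open>T / N\<close> and
  the base points cost their own interaction divided by \<open>D\<close>. Both vanish if
  \<open>T\<close> grows more slowly than \<open>N\<close> and the depth \<open>m\<close> is chosen
  after the base points; any distinct base points in the disc serve. A weak limit lives on all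
  preimages of the disc, that is, on the filled Julia set.\<close>

theorem filled_julia_energy:
  assumes b: "2 * R \<le> b"
  obtains \<mu> where "\<mu> \<in> prob_measures_on (filled_julia q)"
    "mutual_energy b \<mu> \<mu> \<le> ennreal (ln b + ln (cmod (lead_coeff q)) / (real (degree q) - 1))"
proof -
  let ?L = "ln (cmod (lead_coeff q)) / (real (degree q) - 1)"
  have b0: "b > 0" using b R_pos by simp
  define w where "w n i = complex_of_real (R * (real i / real (Suc n)))" for n i
  define W where "W n = (\<Sum>i<Suc n. \<Sum>j\<in>{..<Suc n}-{i}. ln (dist (w n i) (w n j))) / (Suc n)\<^sup>2" for n
  \<comment> \<open>The depth is at least \<open>n\<close>, so that each preimage of the disc
    eventually carries the measures, and so large that both \<open>1 / D n\<close> and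
    \<open>W n / D n\<close> are at most \<open>1 / Suc n\<close> in modulus.\<close>
  have "\<exists>m. m \<ge> n \<and> (1 + \<bar>W n\<bar>) * Suc n < real (degree q ^ m)" for n
  proof -
    obtain m where m: "(1 + \<bar>W n\<bar>) * Suc n < real (degree q) ^ m"
      using real_arch_pow[of "real (degree q)"] deg by auto
    also have "\<dots> \<le> real (degree q) ^ max m n" using deg by (intro power_increasing) auto
    finally show ?thesis by (intro exI[of _ "max m n"]) auto
  qed
  then obtain m where m: "\<And>n. m n \<ge> n" "\<And>n. (1 + \<bar>W n\<bar>) * Suc n < real (degree q ^ m n)" by metis
  define D where "D n = real (degree q ^ m n)" for n
  \<comment> \<open>The level \<open>sqrt (Suc n)\<close> tends to infinity, but its quotient by the
    number \<open>Suc n\<close> of base points tends to 0.\<close>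
  define F where "F n = sqrt (Suc n) / Suc n + (1 - 1 / Suc n) * (ln b + (1 - 1 / D n) * ?L) - W n / D n" for n
  have "\<exists>\<sigma>. complex_prob \<sigma> \<and> (\<forall>j\<le>m n. AE z in \<sigma>. cmod ((poly q ^^ j) z) \<le> R) \<and>
      truncated_energy (ennreal (sqrt (Suc n))) b \<sigma> \<le> ennreal (F n)" for n
  proof -
    have w: "cmod (w n i) \<le> R" if "i < Suc n" for i
    proof -
      have "R * (real i / real (Suc n)) \<le> R * 1" using that R_pos by (intro mult_left_mono) auto
      then show ?thesis using R_pos unfolding w_def norm_of_real by simp
    qed
    have inj: "inj_on (w n) {..<Suc n}"
      using R_pos by (auto simp: inj_on_def w_def simp del: of_nat_Suc)
    show ?thesis
    proof (rule preimage_measure_energy[where N = "Suc n" and w = "w n" and T = "sqrt (Suc n)" and m = "m n",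
          OF b w inj zero_less_Suc real_sqrt_ge_zero[OF of_nat_0_le_iff]], goal_cases)
      case (2 \<tau>)
      then show ?case
        unfolding F_def W_def D_def by (intro exI[of _ \<tau>] conjI allI impI)
    qed simp
  qed
  then obtain \<sigma> where \<sigma>: "\<And>n. complex_prob (\<sigma> n)"
      "\<And>n j. j \<le> m n \<Longrightarrow> AE z in \<sigma> n. cmod ((poly q ^^ j) z) \<le> R"
      "\<And>n. truncated_energy (ennreal (sqrt (Suc n))) b (\<sigma> n) \<le> ennreal (F n)"
    by metis
  have Dlim: "(\<lambda>n. 1 / D n) \<longlonglongrightarrow> 0" and Wlim: "(\<lambda>n. W n / D n) \<longlonglongrightarrow> 0"
  proof -
    have lim: "(\<lambda>n. 1 / real (Suc n)) \<longlonglongrightarrow> 0" by real_asymp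
    have D0: "D n > 0" for n using deg by (simp add: D_def)
    have key: "Suc n + \<bar>W n\<bar> * Suc n \<le> D n" for n
      using less_imp_le[OF m(2)[of n]] by (simp only: D_def distrib_right mult_1)
    have "Suc n \<le> D n" for n using key[of n] by (smt (verit) mult_nonneg_nonneg of_nat_0_le_iff abs_ge_zero)
    then have "norm (1 / D n) \<le> 1 / Suc n" for n
      using D0[of n] by (simp add: frac_le del: of_nat_Suc)
    then show "(\<lambda>n. 1 / D n) \<longlonglongrightarrow> 0"
      by (intro Lim_null_comparison[OF _ lim] always_eventually) simp
    have "\<bar>W n\<bar> * Suc n \<le> D n" for n using key[of n] by linarith
    then have "norm (W n / D n) \<le> 1 / Suc n" for n
      using D0[of n] by (simp add: pos_divide_le_eq pos_le_divide_eq del: of_nat_Suc)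
    then show "(\<lambda>n. W n / D n) \<longlonglongrightarrow> 0"
      by (intro Lim_null_comparison[OF _ lim] always_eventually) simp
  qed
  have "F \<longlonglongrightarrow> 0 + (1 - 0) * (ln b + (1 - 0) * ?L) - 0"
    unfolding F_def
  proof (intro tendsto_intros Dlim Wlim)
    show "(\<lambda>n. sqrt (Suc n) / Suc n) \<longlonglongrightarrow> 0" "(\<lambda>n. 1 / real (Suc n)) \<longlonglongrightarrow> 0" by real_asymp+
  qed
  then have F: "(\<lambda>n. ennreal (F n)) \<longlonglongrightarrow> ennreal (ln b + ?L)"
    by (intro tendsto_ennrealI) simp
  have T: "(\<lambda>n. ennreal (sqrt (Suc n))) \<longlonglongrightarrow> \<top>"
  proof -
    have "filterlim (\<lambda>n. sqrt (Suc n)) at_top sequentially" by real_asymp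
    then show ?thesis by (simp add: ennreal_tendsto_top_eq_at_top)
  qed
  have disc: "disc_prob (\<sigma> n) R" for n
    using \<sigma>(1)[of n] \<sigma>(2)[of 0 n] by (simp add: disc_prob_def disc_prob_axioms_def)
  have supp: "AE z in \<sigma> n. z \<in> {z. cmod ((poly q ^^ j) z) \<le> R}" if "n \<ge> j" for n j
    using \<sigma>(2)[of j n] m(1)[of n] that by simp
  show thesis
  proof (rule disc_prob_subseq_limit[where C = "\<lambda>j. {z. cmod ((poly q ^^ j) z) \<le> R}",
        OF disc b0 T \<sigma>(3) F closed_preimage_disc])
    fix n j :: nat assume "n \<ge> j"
    then show "AE z in \<sigma> n. z \<in> {z. cmod ((poly q ^^ j) z) \<le> R}" by (rule supp)
  next
    fix \<mu> assume \<mu>: "complex_prob \<mu>" "\<And>j. AE z in \<mu>. z \<in> {z. cmod ((poly q ^^ j) z) \<le> R}"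
      "mutual_energy b \<mu> \<mu> \<le> ennreal (ln b + ?L)"
    have "AE z in \<mu>. z \<in> filled_julia q"
      unfolding filled_julia_eq using \<mu>(2) by (simp add: AE_all_countable)
    with \<mu> show thesis
      by (intro that) (auto simp: prob_measures_on_iff[OF closed_filled_julia])
  qed
qed

end

section \<open>Logarithmic potentials off the support\<close>

text \<open>A real-valued version of the potential; it agrees with \<open>log_potential\<close> at
  points of positive distance from a bounded carrier of the measure.\<close>

definition log_pot :: "complex measure \<Rightarrow> complex \<Rightarrow> real" where
  "log_pot \<mu> z = (\<integral>w. ln (dist z w) \<partial>\<mu>)"

lemma integrable_ln_dist:
  assumes \<mu>: "complex_prob \<mu>" and "AE w in \<mu>. c \<le> dist z w \<and> dist z w \<le> C" and c: "c > 0"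
  shows "integrable \<mu> (\<lambda>w. ln (dist z w))"
proof -
  interpret complex_prob \<mu> by (rule \<mu>)
  show ?thesis
  proof (rule integrable_bounded)
    show "AE w in \<mu>. \<bar>ln (dist z w)\<bar> \<le> \<bar>ln c\<bar> + \<bar>ln C\<bar>"
      using assms(2)
    proof eventually_elim
      case (elim w)
      moreover from this c have "0 < dist z w" "0 < C" by linarith+
      ultimately have "ln c \<le> ln (dist z w)" "ln (dist z w) \<le> ln C" using c by simp_all
      then show ?case by linarith
    qed
  qed measurable
qed

lemma log_potential_eq_log_pot:
  assumes \<mu>: "complex_prob \<mu>" and ae: "AE w in \<mu>. c \<le> dist z w \<and> dist z w \<le> C" and c: "c > 0"
  shows "log_potential \<mu> z = ereal (log_pot \<mu> z)"
proof -
  interpret complex_prob \<mu> by (rule \<mu>)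
  let ?g = "\<lambda>w. ln (dist z w)"
  have int: "integrable \<mu> ?g" by (rule integrable_ln_dist[OF assms])
  have pos: "(\<integral>\<^sup>+w. e2ennreal (log_kernel z w) \<partial>\<mu>) = (\<integral>\<^sup>+w. ennreal (?g w) \<partial>\<mu>)"
    and neg: "(\<integral>\<^sup>+w. e2ennreal (- log_kernel z w) \<partial>\<mu>) = (\<integral>\<^sup>+w. ennreal (- ?g w) \<partial>\<mu>)"
    by (rule nn_integral_cong_AE, use ae in eventually_elim,
        use c in \<open>auto simp: log_kernel_def e2ennreal_ereal dist_norm\<close>)+
  have fin: "(\<integral>\<^sup>+w. ennreal (?g w) \<partial>\<mu>) \<noteq> \<top>" "(\<integral>\<^sup>+w. ennreal (- ?g w) \<partial>\<mu>) \<noteq> \<top>"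
    using int by (auto simp: real_integrable_def)
  have "enn2ereal x = ereal (enn2real x)" if "x \<noteq> \<top>" for x
    using that by (cases x) (auto simp: enn2ereal_ennreal)
  then show ?thesis
    unfolding log_potential_def ereal_integral_def log_pot_def pos neg real_lebesgue_integral_def[OF int]
    using fin by simp
qed

lemma log_pot_empirical:
  assumes p: "degree p > 0" and \<zeta>: "p = smult (lead_coeff p) (\<Prod>i<degree p. [:-\<zeta> i, 1:])"
    and z: "poly p z \<noteq> 0"
  shows "ln (cmod (poly p z)) / degree p = ln (cmod (lead_coeff p)) / degree p + log_pot (empirical {..<degree p} \<zeta>) z"
proof -
  have poly: "poly p z = lead_coeff p * (\<Prod>i<degree p. z - \<zeta> i)"
    by (subst \<zeta>) (simp add: poly_prod)
  have ne: "z \<noteq> \<zeta> i" if "i < degree p" for i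
    using z that unfolding poly by auto
  have "cmod (poly p z) = cmod (lead_coeff p) * (\<Prod>i<degree p. dist z (\<zeta> i))"
    unfolding poly by (simp add: norm_mult prod_norm dist_norm)
  moreover have "(\<Prod>i<degree p. dist z (\<zeta> i)) \<noteq> 0" using ne by simp
  moreover have "ln (\<Prod>i<degree p. dist z (\<zeta> i)) = (\<Sum>i<degree p. ln (dist z (\<zeta> i)))"
    by (rule ln_prod) (use ne in auto)
  moreover have "p \<noteq> 0" using p by auto
  ultimately have "ln (cmod (poly p z)) = ln (cmod (lead_coeff p)) + (\<Sum>i<degree p. ln (dist z (\<zeta> i)))"
    by (simp add: ln_mult del: prod_zero_iff)
  moreover have "log_pot (empirical {..<degree p} \<zeta>) z = (\<Sum>i<degree p. ln (dist z (\<zeta> i))) / degree p"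
    unfolding log_pot_def using p by (subst integral_empirical) (auto simp: lessThan_empty_iff)
  ultimately show ?thesis by (simp add: add_divide_distrib)
qed

text \<open>The quotient \<open>dist z w / cmod z\<close> lies between \<open>1 - x\<close> and
  \<open>1 + x\<close> with \<open>x = B / cmod z \<le> 1/2\<close>. The bound is uniform over all
  measures on the disc, which permits limits along varying measures at a fixed point.\<close>

lemma log_pot_at_infinity:
  assumes \<mu>: "disc_prob \<mu> B" and B: "B > 0" and z: "2 * B \<le> cmod z"
  shows "\<bar>log_pot \<mu> z - ln (cmod z)\<bar> \<le> 2 * B / cmod z"
proof -
  interpret disc_prob \<mu> B by (rule \<mu>)
  have cp: "complex_prob \<mu>" ..
  let ?r = "cmod z"
  have r: "?r > 0" using B z by linarith
  have ae: "AE w in \<mu>. ?r - B \<le> dist z w \<and> dist z w \<le> ?r + B"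
    using in_disc
  proof eventually_elim
    case (elim w)
    then show ?case
      using norm_triangle_ineq4[of z w] norm_triangle_ineq2[of z w] by (simp add: dist_norm)
  qed
  have pos: "?r - B > 0" using B z by linarith
  have int: "integrable \<mu> (\<lambda>w. ln (dist z w))" by (rule integrable_ln_dist[OF cp ae pos])
  have "log_pot \<mu> z - ln ?r = (\<integral>w. ln (dist z w) - ln ?r \<partial>\<mu>)"
    unfolding log_pot_def using int by (simp add: prob_space[simplified])
  also have "\<bar>\<dots>\<bar> \<le> (\<integral>w. \<bar>ln (dist z w) - ln ?r\<bar> \<partial>\<mu>)" by (rule integral_abs_bound)
  also have "\<dots> \<le> (\<integral>w. 2 * B / ?r \<partial>\<mu>)"
  proof (rule integral_mono_AE)
    show "AE w in \<mu>. \<bar>ln (dist z w) - ln ?r\<bar> \<le> 2 * B / ?r"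
      using ae
    proof eventually_elim
      case (elim w)
      have d: "dist z w > 0" using elim pos by linarith
      have x: "0 \<le> B / ?r" "B / ?r \<le> 1 / 2" using B z r by (auto simp: field_simps)
      have q: "ln (dist z w) - ln ?r = ln (dist z w / ?r)" using d r by (subst ln_div) auto
      have "ln (dist z w / ?r) \<le> ln (1 + B / ?r)"
        using elim d r B by (subst ln_le_cancel_iff) (auto simp: field_simps intro: add_pos_nonneg x)
      also have "\<dots> \<le> B / ?r" by (rule ln_add_one_self_le_self[OF x(1)])
      finally have 1: "ln (dist z w) - ln ?r \<le> B / ?r" unfolding q .
      have "- (B / ?r) - 2 * (B / ?r)\<^sup>2 \<le> ln (1 - B / ?r)" by (rule ln_one_minus_pos_lower_bound[OF x])
      also have "1 - B / ?r = (?r - B) / ?r" using r by (simp add: diff_divide_distrib)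
      also have "ln \<dots> \<le> ln (dist z w / ?r)"
        using elim pos d r by (subst ln_le_cancel_iff) (auto intro: divide_right_mono)
      finally have 2: "- (B / ?r) - 2 * (B / ?r)\<^sup>2 \<le> ln (dist z w) - ln ?r" unfolding q .
      have "2 * (B / ?r)\<^sup>2 \<le> 2 * (B / ?r * (1 / 2))"
        unfolding power2_eq_square by (intro mult_left_mono x) auto
      with 1 2 x show ?case by (simp add: abs_le_iff)
    qed
  qed (use int in auto)
  finally show ?thesis by (simp add: prob_space[simplified])
qed

text \<open>For \<open>w\<close> off the ball, \<open>ln |z - w| - ln |z0 - w|\<close> is the real
  part of \<open>Ln (1 + (z - z0) / (z0 - w))\<close>. Integrating its Taylor series term by term
  gives a power series in \<open>z - z0\<close>.\<close>

lemma log_pot_local_holomorphic: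
  assumes \<mu>: "disc_prob \<mu> B" and C: "AE w in \<mu>. w \<in> C" and r: "r > 0" "ball z0 r \<inter> C = {}"
  obtains H where "H holomorphic_on ball z0 r" "\<And>z. z \<in> ball z0 r \<Longrightarrow> log_pot \<mu> z = log_pot \<mu> z0 + Re (H z)"
proof -
  interpret disc_prob \<mu> B by (rule \<mu>)
  have cp: "complex_prob \<mu>" ..
  \<comment> \<open>Coefficients of the series of \<open>Ln (1 + u)\<close> with
    \<open>u = (z - z0) / (z0 - w)\<close>; for \<open>n = 0\<close> division by zero gives the
    correct coefficient 0.\<close>
  define c where "c n w = - ((- (1 / (z0 - w))) ^ n / of_nat n)" for n w
  define H where "H z = (\<integral>w. (\<Sum>n. c n w * (z - z0) ^ n) \<partial>\<mu>)" for z
  have far: "AE w in \<mu>. r \<le> cmod (z0 - w)"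
    using C by eventually_elim (use r(2) in \<open>auto simp: disjoint_iff dist_norm not_less\<close>)
  have c_power: "c n w * (z - z0) ^ n = - ((- ((z - z0) / (z0 - w))) ^ n) / of_nat n" for n w z
    unfolding c_def by (simp add: power_minus' power_divide) 
  have main: "(\<lambda>n. (\<integral>w. c n w \<partial>\<mu>) * (z - z0) ^ n) sums H z \<and> log_pot \<mu> z = log_pot \<mu> z0 + Re (H z)"
    if z: "z \<in> ball z0 r" for z
  proof -
    \<comment> \<open>\<open>\<theta>\<close> bounds \<open>|u|\<close> for almost all
      \<open>w\<close> at once, so the geometric series in \<open>\<theta>\<close> justifies
      exchanging sum and integral.\<close>
    define \<theta> where "\<theta> = dist z0 z / r"
    have \<theta>: "0 \<le> \<theta>" "\<theta> < 1" using z r by (auto simp: \<theta>_def)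
    have u: "cmod ((z - z0) / (z0 - w)) \<le> \<theta>" if "r \<le> cmod (z0 - w)" for w
      using that r unfolding \<theta>_def norm_divide by (intro frac_le) (auto simp: dist_norm norm_minus_commute)
    have bound: "norm (c n w * (z - z0) ^ n) \<le> \<theta> ^ n" if "r \<le> cmod (z0 - w)" for n w
    proof (cases "n = 0")
      case True
      then show ?thesis by (simp add: c_def)
    next
      case False
      have "norm (c n w * (z - z0) ^ n) = cmod ((z - z0) / (z0 - w)) ^ n / real n"
        unfolding c_power by (simp add: norm_divide norm_power)
      also have "\<dots> \<le> \<theta> ^ n / 1"
        using u[OF that] False \<theta> by (intro frac_le power_mono) auto
      finally show ?thesis by simp
    qed
    have meas [measurable]: "(\<lambda>w. c n w * (z - z0) ^ n) \<in> borel_measurable \<mu>" for n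
      unfolding c_def by measurable
    have int: "integrable \<mu> (\<lambda>w. c n w * (z - z0) ^ n)" for n
      by (rule integrable_const_bound[of _ "\<theta> ^ n"]) (use far bound in \<open>auto intro: eventually_mono\<close>)
    have geo: "summable (\<lambda>n. \<theta> ^ n)" using \<theta> by (intro summable_geometric) auto
    have summ: "AE w in \<mu>. summable (\<lambda>n. norm (c n w * (z - z0) ^ n))"
      using far
    proof eventually_elim
      case (elim w)
      show ?case by (rule summable_comparison_test'[OF geo, of 0]) (use bound[OF elim] in simp)
    qed
    have sint: "summable (\<lambda>n. \<integral>w. norm (c n w * (z - z0) ^ n) \<partial>\<mu>)"
    proof (rule summable_comparison_test'[OF geo, of 0])
      fix n
      have "(\<integral>w. norm (c n w * (z - z0) ^ n) \<partial>\<mu>) \<le> (\<integral>w. \<theta> ^ n \<partial>\<mu>)"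
        by (rule integral_mono_AE) (use int far bound in \<open>auto intro: eventually_mono\<close>)
      then show "norm (\<integral>w. norm (c n w * (z - z0) ^ n) \<partial>\<mu>) \<le> \<theta> ^ n"
        by (simp add: prob_space[simplified])
    qed
    have sums: "(\<lambda>n. \<integral>w. c n w * (z - z0) ^ n \<partial>\<mu>) sums H z"
      unfolding H_def by (rule sums_integral[OF int summ sint])
    have ints: "integrable \<mu> (\<lambda>w. \<Sum>n. c n w * (z - z0) ^ n)"
      by (rule integrable_suminf[OF int summ sint])
    have iln: "integrable \<mu> (\<lambda>w. ln (dist x w))" if x: "x \<in> ball z0 r" for x
    proof (rule integrable_ln_dist[OF cp])
      show "AE w in \<mu>. r - dist z0 x \<le> dist x w \<and> dist x w \<le> cmod x + B"
        using far in_disc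
      proof eventually_elim
        case (elim w)
        then show ?case
          using dist_triangle[of z0 w x] norm_triangle_ineq4[of x w] by (auto simp: dist_norm norm_minus_commute)
      qed
    qed (use x in auto)
    have "Re (H z) = (\<integral>w. Re (\<Sum>n. c n w * (z - z0) ^ n) \<partial>\<mu>)"
      unfolding H_def by (rule integral_bounded_linear[OF bounded_linear_Re ints, symmetric])
    also have "\<dots> = (\<integral>w. ln (dist z w) - ln (dist z0 w) \<partial>\<mu>)"
    proof (rule integral_cong_AE)
      show "AE w in \<mu>. Re (\<Sum>n. c n w * (z - z0) ^ n) = ln (dist z w) - ln (dist z0 w)"
        using far
      proof eventually_elim
        case (elim w)
        let ?u = "(z - z0) / (z0 - w)"
        have "z0 \<noteq> w" using elim r by auto
        have u1: "cmod ?u < 1" using u[OF elim] \<theta> by simp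
        have "(\<Sum>n. c n w * (z - z0) ^ n) = ln (1 + ?u)"
          using Ln_series'[OF u1] unfolding c_power by (simp add: sums_iff)
        moreover have 1: "1 + ?u = (z - w) / (z0 - w)" using \<open>z0 \<noteq> w\<close> by (simp add: field_simps)
        moreover have "1 + ?u \<noteq> 0" using u1 by (metis add_eq_0_iff norm_minus_cancel norm_one less_irrefl)
        moreover from this have "z \<noteq> w" unfolding 1 by auto
        ultimately show ?case
          using \<open>z0 \<noteq> w\<close> by (simp add: Re_Ln norm_divide ln_div dist_norm)
      qed
    qed measurable
    also have "\<dots> = log_pot \<mu> z - log_pot \<mu> z0"
      unfolding log_pot_def using iln[OF z] iln[of z0] r by (intro Bochner_Integration.integral_diff) auto
    finally have "log_pot \<mu> z = log_pot \<mu> z0 + Re (H z)" by simp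
    moreover have "(\<lambda>n. (\<integral>w. c n w \<partial>\<mu>) * (z - z0) ^ n) sums H z"
      using sums by simp
    ultimately show ?thesis by blast
  qed
  show thesis
  proof
    show "H holomorphic_on ball z0 r"
      by (rule power_series_holomorphic[of _ _ "\<lambda>n. \<integral>w. c n w \<partial>\<mu>"]) (use main in blast)
    show "log_pot \<mu> z = log_pot \<mu> z0 + Re (H z)" if "z \<in> ball z0 r" for z
      using main[OF that] by blast
  qed
qed

text \<open>A nonconstant \<open>H\<close> would map \<open>U\<close> onto an open set, which does
  not fit into the vertical line \<open>Re = c\<close>.\<close>

lemma holomorphic_Re_zero:
  assumes H: "H holomorphic_on S" "open S" "connected S" and U: "open U" "U \<subseteq> S" "U \<noteq> {}"
    and Re0: "\<And>z. z \<in> U \<Longrightarrow> Re (H z) = c" and z: "z \<in> S"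
  shows "Re (H z) = c"
proof -
  have "H constant_on S"
  proof (rule ccontr)
    assume "\<not> ?thesis"
    then have "open (H ` U)" by (rule open_mapping_thm[OF H U(1,2)])
    moreover obtain x where x: "x \<in> U" using U(3) by blast
    ultimately obtain e where e: "e > 0" "ball (H x) e \<subseteq> H ` U" by (meson imageI open_contains_ball)
    have "H x + of_real (e / 2) \<in> ball (H x) e" using e(1) by (simp add: dist_norm)
    then obtain y where "y \<in> U" "H y = H x + of_real (e / 2)" using e(2) by (metis imageE subsetD)
    then show False using Re0[of x] Re0[of y] x e(1) by simp
  qed
  then show ?thesis using U z Re0 by (metis constant_on_def subset_iff ex_in_conv)
qed

text \<open>\<open>P\<close> is local agreement of the potentials. On a ball missing
  \<open>C\<close> their difference is a constant plus the real part of a holomorphic function, so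
  agreement near one point spreads over the ball; connectedness of \<open>- C\<close> carries it
  from a point near infinity to \<open>z\<close>.\<close>

theorem log_pot_identity:
  assumes \<mu>: "disc_prob \<mu> B" "AE w in \<mu>. w \<in> C" and \<nu>: "disc_prob \<nu> B" "AE w in \<nu>. w \<in> C"
    and C: "closed C" "C \<subseteq> cball 0 B" "connected (- C)"
    and eq: "\<And>z. cmod z \<ge> R \<Longrightarrow> log_pot \<mu> z = log_pot \<nu> z" and z: "z \<notin> C"
  shows "log_pot \<mu> z = log_pot \<nu> z"
proof -
  define P where "P x \<longleftrightarrow> (\<exists>e>0. \<forall>y\<in>ball x e. log_pot \<mu> y = log_pot \<nu> y)" for x
  define M where "M = max R B + 2"
  define a where "a = complex_of_real (\<bar>M\<bar> + 1)"
  have Pa: "P a"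
    unfolding P_def
  proof (intro exI[of _ 1] conjI ballI eq)
    fix y assume "y \<in> ball a 1"
    then have "cmod a - cmod y < 1" using norm_triangle_ineq2[of a y] by (simp add: dist_norm)
    then show "R \<le> cmod y" by (simp add: a_def M_def)
  qed simp
  have "a \<in> - C" using C(2) by (auto simp: a_def M_def)
  have "z \<in> - C" using z by simp
  have "P z"
  proof (rule connected_induction_simple[where P = P, OF C(3) \<open>a \<in> - C\<close> \<open>z \<in> - C\<close> Pa])
    fix x assume x: "x \<in> - C"
    have "open (- C)" using C(1) by auto
    then obtain r where r: "r > 0" "ball x r \<subseteq> - C" using x open_contains_ball by blast
    then have dj: "ball x r \<inter> C = {}" by auto
    obtain F where F: "F holomorphic_on ball x r" "\<And>y. y \<in> ball x r \<Longrightarrow> log_pot \<mu> y = log_pot \<mu> x + Re (F y)"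
      using log_pot_local_holomorphic[OF \<mu> r(1) dj] by blast
    obtain G where G: "G holomorphic_on ball x r" "\<And>y. y \<in> ball x r \<Longrightarrow> log_pot \<nu> y = log_pot \<nu> x + Re (G y)"
      using log_pot_local_holomorphic[OF \<nu> r(1) dj] by blast
    have "P v" if u: "u \<in> ball x r" "P u" and v: "v \<in> ball x r" for u v
    proof -
      obtain e where e: "e > 0" "\<And>y. y \<in> ball u e \<Longrightarrow> log_pot \<mu> y = log_pot \<nu> y"
        using u(2) unfolding P_def by blast
      have all: "log_pot \<mu> y = log_pot \<nu> y" if y: "y \<in> ball x r" for y
      proof -
        have "Re (F y - G y) = log_pot \<nu> x - log_pot \<mu> x"
        proof (rule holomorphic_Re_zero[where H = "\<lambda>y. F y - G y" and S = "ball x r" and U = "ball u e \<inter> ball x r"])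
          show "(\<lambda>y. F y - G y) holomorphic_on ball x r" by (intro holomorphic_intros F G)
          show "ball u e \<inter> ball x r \<noteq> {}" using u(1) e(1) by (metis IntI centre_in_ball empty_iff)
          fix y assume "y \<in> ball u e \<inter> ball x r"
          then show "Re (F y - G y) = log_pot \<nu> x - log_pot \<mu> x"
            using F(2)[of y] G(2)[of y] e(2)[of y] by simp
        qed (use y in auto)
        then show ?thesis using F(2)[OF y] G(2)[OF y] by simp
      qed
      have "ball v (r - dist x v) \<subseteq> ball x r"
      proof
        fix y assume "y \<in> ball v (r - dist x v)"
        then show "y \<in> ball x r" using dist_triangle[of x y v] by simp
      qed
      then show "P v" unfolding P_def using v all by (intro exI[of _ "r - dist x v"]) auto
    qed
    note propagate = this
    show "\<exists>T. openin (top_of_set (- C)) T \<and> x \<in> T \<and> (\<forall>x\<in>T. \<forall>y\<in>T. P x \<longrightarrow> P y)"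
    proof (intro exI[of _ "ball x r"] conjI ballI impI)
      show "openin (top_of_set (- C)) (ball x r)"
        unfolding openin_open_eq[OF \<open>open (- C)\<close>] using r(2) by simp
      show "P v" if "u \<in> ball x r" "v \<in> ball x r" "P u" for u v
        using propagate[OF that(1,3,2)] .
    qed (use r(1) in simp)
  qed
  then obtain e where "e > 0" "\<forall>y\<in>ball z e. log_pot \<mu> y = log_pot \<nu> y" unfolding P_def by blast
  then show ?thesis by simp
qed

section \<open>Limits of equilibrium measures\<close>

lemma (in complex_prob) uniform_measure_complex_prob:
  assumes "K \<in> sets borel" "emeasure M K \<noteq> 0"
  shows "complex_prob (uniform_measure M K)"
proof (intro complex_prob.intro complex_prob_axioms.intro)
  show "prob_space (uniform_measure M K)"
    using assms by (intro prob_space_uniform_measure) (auto simp: emeasure_eq_measure)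
qed (simp add: sets_eq_borel)

text \<open>The integral over \<open>\<nu>\<close> is split at \<open>K\<close>. Off
  \<open>K\<close> the potential is bounded pointwise by hypothesis. On \<open>K\<close> the
  variational inequality is tested with the normalized restriction of \<open>\<nu>\<close>, which
  bounds the integral there without a pointwise statement.\<close>

lemma mutual_energy_minimizer_ge:
  assumes \<omega>: "energy_minimizer b K \<omega>" and K: "closed K" "K \<subseteq> cball 0 B" and b: "b > 0" "2 * B \<le> b"
    and \<nu>: "complex_prob \<nu>" "mutual_energy b \<nu> \<nu> < \<top>"
    and out: "AE z in \<nu>. z \<in> K \<or> mutual_energy b \<omega> \<omega> \<le> (\<integral>\<^sup>+w. log_ker b z w \<partial>\<omega>)"
  shows "mutual_energy b \<omega> \<omega> \<le> mutual_energy b \<nu> \<omega>"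
proof -
  interpret \<nu>: complex_prob \<nu> by (rule \<nu>(1))
  have \<omega>K: "\<omega> \<in> prob_measures_on K" using \<omega> by (simp add: energy_minimizer_def)
  then have cp: "complex_prob \<omega>" using K prob_measures_on_iff by blast
  interpret \<omega>: complex_prob \<omega> by (rule cp)
  let ?e = "mutual_energy b \<omega> \<omega>"
  define U where "U z = (\<integral>\<^sup>+w. log_ker b z w \<partial>\<omega>)" for z
  have [measurable]: "U \<in> borel_measurable borel" unfolding U_def[abs_def] by measurable
  have [measurable]: "K \<in> sets borel" using K by (simp add: borel_closed)
  define \<kappa> where "\<kappa> = emeasure \<nu> K"
  have \<kappa>_fin: "\<kappa> \<noteq> \<top>" by (simp add: \<kappa>_def \<nu>.emeasure_eq_measure)
  have in_K: "?e * \<kappa> \<le> (\<integral>\<^sup>+z. U z * indicator K z \<partial>\<nu>)"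
  proof (cases "\<kappa> = 0")
    case False
    let ?u = "uniform_measure \<nu> K"
    have u: "complex_prob ?u"
      using False unfolding \<kappa>_def by (intro \<nu>.uniform_measure_complex_prob) simp_all
    then interpret u: complex_prob ?u .
    have AEu: "AE z in ?u. z \<in> K" by (rule AE_uniform_measureI) (auto simp: \<nu>.sets_eq_borel)
    have uK: "?u \<in> prob_measures_on K" using u AEu K by (simp add: prob_measures_on_iff)
    have nnu: "(\<integral>\<^sup>+z. f z \<partial>?u) = (\<integral>\<^sup>+z. f z * indicator K z \<partial>\<nu>) / \<kappa>" if [measurable]: "f \<in> borel_measurable borel" for f
      unfolding \<kappa>_def by (rule nn_integral_uniform_measure) measurable
    \<comment> \<open>Because the kernel is nonnegative, restriction does not increase the
      unnormalized energy; normalization costs the factor \<open>1 / \<kappa>\<close> in each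
      variable.\<close>
    have "mutual_energy b ?u ?u \<le> mutual_energy b \<nu> \<nu> / \<kappa> / \<kappa>"
    proof -
      have "mutual_energy b ?u ?u = (\<integral>\<^sup>+z. (\<integral>\<^sup>+w. log_ker b z w \<partial>?u) * indicator K z \<partial>\<nu>) / \<kappa>"
        unfolding mutual_energy_def by (rule nnu) measurable
      also have "\<dots> \<le> (\<integral>\<^sup>+z. (\<integral>\<^sup>+w. log_ker b z w \<partial>\<nu>) / \<kappa> \<partial>\<nu>) / \<kappa>"
      proof (intro divide_right_mono_ennreal nn_integral_mono)
        fix z
        have "(\<integral>\<^sup>+w. log_ker b z w \<partial>?u) = (\<integral>\<^sup>+w. log_ker b z w * indicator K w \<partial>\<nu>) / \<kappa>"
          by (rule nnu) measurable
        also have "\<dots> \<le> (\<integral>\<^sup>+w. log_ker b z w \<partial>\<nu>) / \<kappa>"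
          by (intro divide_right_mono_ennreal nn_integral_mono) (auto split: split_indicator)
        finally show "(\<integral>\<^sup>+w. log_ker b z w \<partial>?u) * indicator K z \<le> (\<integral>\<^sup>+w. log_ker b z w \<partial>\<nu>) / \<kappa>"
          by (auto split: split_indicator)
      qed
      also have "\<dots> = mutual_energy b \<nu> \<nu> / \<kappa> / \<kappa>"
        unfolding mutual_energy_def by (subst nn_integral_divide) auto
      finally show ?thesis .
    qed
    also have "\<dots> < \<top>" using \<nu>(2) False
      by (simp add: less_top[symmetric] ennreal_divide_eq_top_iff)
    finally have "?e \<le> mutual_energy b \<omega> ?u"
      by (rule energy_minimizer_variation[OF \<omega> K b uK])
    also have "\<dots> = mutual_energy b ?u \<omega>" by (rule mutual_energy_commute[OF cp u])
    also have "\<dots> = (\<integral>\<^sup>+z. U z * indicator K z \<partial>\<nu>) / \<kappa>"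
      unfolding mutual_energy_def U_def by (rule nnu) measurable
    finally have "?e * \<kappa> \<le> (\<integral>\<^sup>+z. U z * indicator K z \<partial>\<nu>) / \<kappa> * \<kappa>" by (rule mult_right_mono) simp
    also have "\<dots> = (\<integral>\<^sup>+z. U z * indicator K z \<partial>\<nu>)"
      using False \<kappa>_fin by (simp add: ennreal_divide_times ennreal_times_divide[symmetric] ennreal_divide_self less_top)
    finally show ?thesis .
  qed simp
  have "?e * emeasure \<nu> (- K) = (\<integral>\<^sup>+z. ?e * indicator (- K) z \<partial>\<nu>)"
    by (subst nn_integral_cmult_indicator) (auto simp: \<nu>.sets_eq_borel)
  also have "\<dots> \<le> (\<integral>\<^sup>+z. U z * indicator (- K) z \<partial>\<nu>)"
    by (rule nn_integral_mono_AE, use out in eventually_elim) (auto simp: U_def split: split_indicator)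
  finally have "?e * \<kappa> + ?e * emeasure \<nu> (- K)
      \<le> (\<integral>\<^sup>+z. U z * indicator K z \<partial>\<nu>) + (\<integral>\<^sup>+z. U z * indicator (- K) z \<partial>\<nu>)"
    by (intro add_mono in_K)
  also have "\<dots> = (\<integral>\<^sup>+z. U z * indicator K z + U z * indicator (- K) z \<partial>\<nu>)"
    by (rule nn_integral_add[symmetric]) measurable
  also have "\<dots> = mutual_energy b \<nu> \<omega>"
    unfolding mutual_energy_def U_def by (intro nn_integral_cong) (auto split: split_indicator)
  also have "?e * \<kappa> + ?e * emeasure \<nu> (- K) = ?e"
  proof -
    have "\<kappa> + emeasure \<nu> (- K) = emeasure \<nu> (K \<union> - K)"
      unfolding \<kappa>_def by (rule plus_emeasure) (auto simp: \<nu>.sets_eq_borel)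
    also have "K \<union> - K = space \<nu>" by auto
    finally show ?thesis unfolding distrib_left[symmetric] by (simp only: \<nu>.emeasure_space_1 mult_1_right)
  qed
  finally show ?thesis .
qed

lemma finite_energy_singleton:
  assumes \<nu>: "complex_prob \<nu>" "mutual_energy b \<nu> \<nu> < \<top>"
  shows "emeasure \<nu> {z} = 0"
proof (rule ccontr)
  assume ne: "emeasure \<nu> {z} \<noteq> 0"
  interpret \<nu>: complex_prob \<nu> by (rule \<nu>(1))
  have sing: "(\<integral>\<^sup>+x. f x \<partial>\<nu>) = \<top>" if "f z = \<top>" for f
  proof -
    have "\<top> = \<top> * emeasure \<nu> {z}" using ne by (simp add: ennreal_top_mult)
    also have "\<dots> = (\<integral>\<^sup>+x. \<top> * indicator {z} x \<partial>\<nu>)"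
      by (rule nn_integral_cmult_indicator[symmetric]) (simp add: \<nu>.sets_eq_borel)
    also have "\<dots> \<le> (\<integral>\<^sup>+x. f x \<partial>\<nu>)"
      using that by (intro nn_integral_mono) (auto split: split_indicator)
    finally show ?thesis by (simp add: top_unique)
  qed
  have "mutual_energy b \<nu> \<nu> = \<top>"
    unfolding mutual_energy_def by (intro sing) (simp add: log_ker_def)
  then show False using \<nu>(2) by simp
qed

text \<open>At a point of modulus \<open>r\<close> all the potentials are within
  \<open>2 * B / r\<close> of \<open>ln r\<close>, so they cancel up to this error in
  \<open>A j + log_pot (\<tau> j) z - log_pot \<omega> z\<close>. Choosing
  \<open>r \<ge> 8 * B / \<epsilon>\<close> makes each error at most
  \<open>\<epsilon> / 4\<close>.\<close>

lemma lead_coeff_limit: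
  fixes A :: "nat \<Rightarrow> real"
  assumes \<omega>: "disc_prob \<omega> B" and \<tau>: "\<And>j. disc_prob (\<tau> j) B" and B: "B > 0"
    and lim: "\<And>z. cmod z \<ge> R \<Longrightarrow> (\<lambda>j. A j + log_pot (\<tau> j) z) \<longlonglongrightarrow> log_pot \<omega> z - I"
  shows "A \<longlonglongrightarrow> - I"
proof (rule tendstoI)
  fix \<epsilon> :: real assume \<epsilon>: "\<epsilon> > 0"
  define r where "r = max (max \<bar>R\<bar> (2 * B)) (8 * B / \<epsilon>)"
  let ?z = "complex_of_real r"
  have r: "r \<ge> \<bar>R\<bar>" "r \<ge> 2 * B" "r \<ge> 8 * B / \<epsilon>" "r > 0" using B by (auto simp: r_def)
  have z: "cmod ?z = r" using r by simp
  have small: "2 * B / r \<le> \<epsilon> / 4" using r \<epsilon> B by (simp add: field_simps)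
  have "\<forall>\<^sub>F j in sequentially. dist (A j + log_pot (\<tau> j) ?z) (log_pot \<omega> ?z - I) < \<epsilon> / 2"
    using lim[of ?z] \<epsilon> r z by (intro tendstoD) auto
  then show "\<forall>\<^sub>F j in sequentially. dist (A j) (- I) < \<epsilon>"
  proof eventually_elim
    case (elim j)
    have "\<bar>log_pot (\<tau> j) ?z - ln r\<bar> \<le> \<epsilon> / 4" "\<bar>log_pot \<omega> ?z - ln r\<bar> \<le> \<epsilon> / 4"
      using log_pot_at_infinity[OF \<tau> B, of ?z j] log_pot_at_infinity[OF \<omega> B, of ?z] r z small by auto
    with elim show ?case unfolding dist_real_def by linarith
  qed
qed

text \<open>The radius depends on the limiting potential only, not on the polynomial, so that all
  late terms of a regular sequence share one escape disc.\<close>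

lemma escape_radius:
  assumes \<omega>: "disc_prob \<omega> B" and B: "B > 0"
  obtains R1 where "R1 \<ge> R0"
    "\<And>(p :: complex poly) z. degree p \<ge> 2 \<Longrightarrow> cmod z \<ge> R1 \<Longrightarrow>
      \<bar>ln (cmod (poly p z)) / degree p - (log_pot \<omega> z - I)\<bar> < 1 \<Longrightarrow> 2 * cmod z \<le> cmod (poly p z)"
proof
  \<comment> \<open>\<open>2 * B\<close> keeps the potential within 1 of \<open>ln r\<close>,
    \<open>r = cmod z\<close>. With the tolerance 1 this gives
    \<open>ln |p z| / n > ln r - I - 2\<close>, and \<open>exp (2 * (I + 3))\<close> makes the right
    side at least \<open>ln r / 2 + 1\<close>. Multiplying by \<open>n \<ge> 2\<close> yields
    \<open>ln r + 2\<close>, and \<open>exp 2 \<ge> 2\<close>.\<close>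
  define R1 where "R1 = Max {R0, 2 * B, 1, exp (2 * (I + 3))}"
  show "R1 \<ge> R0" by (simp add: R1_def)
  have R1: "R1 \<ge> 2 * B" "R1 \<ge> 1" "R1 \<ge> exp (2 * (I + 3))" by (simp_all add: R1_def)
  fix p :: "complex poly" and z
  assume deg: "degree p \<ge> 2" and z: "cmod z \<ge> R1"
    and close: "\<bar>ln (cmod (poly p z)) / degree p - (log_pot \<omega> z - I)\<bar> < 1"
  let ?r = "cmod z" and ?n = "real (degree p)"
  have r: "?r \<ge> 1" "?r \<ge> 2 * B" "?r > 0" using R1 z by linarith+
  define a where "a = ln (cmod (poly p z)) / ?n"
  have "2 * (I + 3) \<le> ln ?r" using R1(3) z r by (subst ln_ge_iff) auto
  then have "2 * I + 6 \<le> ln ?r" by simp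
  moreover have "\<bar>log_pot \<omega> z - ln ?r\<bar> \<le> 1"
    by (rule order_trans[OF log_pot_at_infinity[OF \<omega> B r(2)]]) (use r in simp)
  moreover have "\<bar>a - (log_pot \<omega> z - I)\<bar> < 1" using close by (simp add: a_def)
  ultimately have "a \<ge> ln ?r / 2 + 1" by linarith
  then have "ln (cmod (poly p z)) / ?n \<ge> ln ?r / 2 + 1" unfolding a_def .
  then have "ln (cmod (poly p z)) \<ge> (ln ?r / 2 + 1) * ?n" using deg by (simp add: pos_le_divide_eq)
  also have "(ln ?r / 2 + 1) * ?n \<ge> (ln ?r / 2 + 1) * 2" using deg r by (intro mult_left_mono) auto
  finally have ge: "ln (cmod (poly p z)) \<ge> ln ?r + 2" by simp
  moreover have "ln ?r \<ge> 0" using r by simp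
  ultimately have "poly p z \<noteq> 0" by auto
  have "2 * ?r \<le> exp 2 * ?r" using exp_ge_add_one_self[of 2] r by (intro mult_right_mono) auto
  also have "\<dots> = exp (ln ?r + 2)" using r by (simp add: exp_add)
  also have "\<dots> \<le> cmod (poly p z)" using ge \<open>poly p z \<noteq> 0\<close> by (subst (asm) ln_ge_iff) auto
  finally show "2 * ?r \<le> cmod (poly p z)" .
qed

lemma proots_product:
  assumes "(p :: complex poly) = smult c (\<Prod>i<(n::nat). [:-\<zeta> i, 1:])" "c \<noteq> 0"
  shows "proots p = image_mset \<zeta> (mset_set {..<n})"
proof -
  have "proots p = (\<Sum>i<n. {#\<zeta> i#})"
    unfolding assms(1) using assms(2) by (simp add: proots_prod)
  also have "\<dots> = image_mset \<zeta> (mset_set {..<n})" by (induction n) (simp_all add: lessThan_Suc)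
  finally show ?thesis .
qed

text \<open>Points outside \<open>K\<close> that attract zeros are isolated, as only boundedly many zeros lie off a
  neighbourhood of \<open>K\<close>.\<close>

lemma countable_zero_limits:
  fixes Z :: "nat \<Rightarrow> complex multiset"
  assumes K: "closed K" "K \<noteq> {}"
    and count: "\<And>L. closed L \<Longrightarrow> L \<inter> K = {} \<Longrightarrow> \<exists>M. \<forall>j. size (filter_mset (\<lambda>z. z \<in> L) (Z j)) \<le> M"
  shows "countable {z. z \<notin> K \<and> (\<forall>\<delta>>0. \<forall>\<^sub>F j in sequentially. \<exists>\<zeta>\<in>#Z j. dist z \<zeta> < \<delta>)}" (is "countable ?Bad")
proof -
  define \<epsilon> where "\<epsilon> m = 1 / real (Suc m)" for m
  have \<epsilon>: "\<epsilon> m > 0" for m by (simp add: \<epsilon>_def)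
  have fin: "finite (?Bad \<inter> {z. infdist z K > \<epsilon> m})" for m
  proof (rule ccontr)
    assume inf: "infinite (?Bad \<inter> {z. infdist z K > \<epsilon> m})"
    define L where "L = {z. infdist z K \<ge> \<epsilon> m}"
    have "closed L" unfolding L_def by (intro closed_Collect_le continuous_intros)
    moreover have "L \<inter> K = {}" using \<epsilon>[of m] by (auto simp: L_def)
    ultimately obtain M where M: "\<And>j. size (filter_mset (\<lambda>z. z \<in> L) (Z j)) \<le> M" using count by blast
    obtain F where F: "finite F" "card F = Suc M" "F \<subseteq> ?Bad \<inter> {z. infdist z K > \<epsilon> m}"
      using infinite_arbitrarily_large[OF inf] by blast
    \<comment> \<open>Half the mutual distances force zeros near different points of
      \<open>F\<close> to differ; the gaps \<open>infdist z K - \<epsilon> m\<close> keep these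
      zeros in \<open>L\<close>. The element 1 makes the set nonempty.\<close>
    define D where "D = insert 1 ((\<lambda>z. infdist z K - \<epsilon> m) ` F \<union> (\<lambda>(x, y). dist x y / 2) ` (F \<times> F - Id))"
    have "finite D" using F(1) by (auto simp: D_def)
    have "D \<noteq> {}" by (simp add: D_def)
    define \<delta> where "\<delta> = Min D"
    have "\<delta> > 0" unfolding \<delta>_def using \<open>finite D\<close> \<open>D \<noteq> {}\<close> F(3) by (subst Min_gr_iff) (auto simp: D_def)
    have \<delta>1: "\<delta> \<le> infdist z K - \<epsilon> m" if "z \<in> F" for z
      unfolding \<delta>_def using \<open>finite D\<close> that by (intro Min_le) (auto simp: D_def)
    have \<delta>2: "\<delta> \<le> dist x y / 2" if "x \<in> F" "y \<in> F" "x \<noteq> y" for x y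
      unfolding \<delta>_def using \<open>finite D\<close> that by (intro Min_le) (force simp: D_def)+
    have "\<forall>\<^sub>F j in sequentially. \<forall>z\<in>F. \<exists>\<zeta>\<in>#Z j. dist z \<zeta> < \<delta>"
      using F \<open>\<delta> > 0\<close> by (intro eventually_ball_finite) auto
    then obtain j where "\<forall>z\<in>F. \<exists>\<zeta>\<in>#Z j. dist z \<zeta> < \<delta>" by (auto simp: eventually_sequentially)
    then obtain h where h: "\<And>z. z \<in> F \<Longrightarrow> h z \<in># Z j \<and> dist z (h z) < \<delta>" by metis
    have "inj_on h F"
    proof (rule inj_onI, rule ccontr)
      fix x y assume xy: "x \<in> F" "y \<in> F" "h x = h y" "x \<noteq> y"
      then have "dist x y < 2 * \<delta>" using h[of x] h[of y] dist_triangle2[of x y "h x"] by simp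
      with \<delta>2[OF xy(1,2,4)] show False by simp
    qed
    then have "Suc M = card (h ` F)" using F(2) by (simp add: card_image)
    have "h ` F \<subseteq> set_mset (filter_mset (\<lambda>z. z \<in> L) (Z j))"
    proof
      fix y assume "y \<in> h ` F"
      then obtain z where z: "z \<in> F" "y = h z" by blast
      have "infdist z K \<le> infdist (h z) K + dist z (h z)" by (rule infdist_triangle)
      then have "h z \<in> L" using h[OF z(1)] \<delta>1[OF z(1)] by (simp add: L_def)
      then show "y \<in> set_mset (filter_mset (\<lambda>z. z \<in> L) (Z j))" using h z by simp
    qed
    then have "card (h ` F) \<le> card (set_mset (filter_mset (\<lambda>z. z \<in> L) (Z j)))" by (intro card_mono) auto
    also have "card (set_mset (filter_mset (\<lambda>z. z \<in> L) (Z j))) \<le> size (filter_mset (\<lambda>z. z \<in> L) (Z j))"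
    proof -
      have "card (set_mset A) \<le> size A" for A :: "complex multiset"
        by (induction A) (auto simp: card_insert_if)
      then show ?thesis .
    qed
    also have "\<dots> \<le> M" by (rule M)
    finally show False using \<open>Suc M = card (h ` F)\<close> by simp
  qed
  have "?Bad \<subseteq> (\<Union>m. ?Bad \<inter> {z. infdist z K > \<epsilon> m})"
  proof
    fix z assume z: "z \<in> ?Bad"
    then have "infdist z K > 0" using K by (simp add: infdist_pos_not_in_closed)
    then obtain m where "\<epsilon> m < infdist z K" unfolding \<epsilon>_def using nat_approx_posE by blast
    with z show "z \<in> (\<Union>m. ?Bad \<inter> {z. infdist z K > \<epsilon> m})" by blast
  qed
  moreover have "countable (\<Union>m. ?Bad \<inter> {z. infdist z K > \<epsilon> m})"
    by (rule countable_UN) (simp_all only: countableI_type countable_finite fin)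
  ultimately show ?thesis by (rule countable_subset)
qed

section \<open>The limit of the Julia equilibrium measures\<close>

lemma green_function_eq_log_pot:
  assumes \<mu>: "disc_prob \<mu> B" and b: "b \<ge> 1" "2 * B \<le> b" and fin: "mutual_energy b \<mu> \<mu> < \<top>"
    and z: "cmod z > B"
  shows "log_potential \<mu> z - log_energy \<mu> = ereal (log_pot \<mu> z - (ln b - enn2real (mutual_energy b \<mu> \<mu>)))"
proof -
  interpret disc_prob \<mu> B by (rule \<mu>)
  have cp: "complex_prob \<mu>" ..
  have "AE w in \<mu>. cmod z - B \<le> dist z w \<and> dist z w \<le> cmod z + B"
    using in_disc
  proof eventually_elim
    case (elim w)
    then show ?case
      using norm_triangle_ineq4[of z w] norm_triangle_ineq2[of z w] by (simp add: dist_norm)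
  qed
  then have "log_potential \<mu> z = ereal (log_pot \<mu> z)"
    by (rule log_potential_eq_log_pot[OF cp]) (use z in simp)
  moreover obtain x where "mutual_energy b \<mu> \<mu> = ennreal x" "x \<ge> 0"
    using fin by (cases "mutual_energy b \<mu> \<mu>") auto
  ultimately show ?thesis
    using log_energy_eq[OF \<mu> b] by (simp add: enn2ereal_ennreal)
qed

text \<open>After passing to a subsequence the hypotheses of the theorem hold for every index and with a
  single radius \<open>R\<close>.\<close>

locale regular_centering =
  fixes K :: "complex set" and Q :: "nat \<Rightarrow> complex poly" and R R0 :: real
  assumes K: "closed K" "\<not> polar K" "connected (- K)" "K \<subseteq> cball 0 R" and R: "R \<ge> 1" "R0 > R"
    and escaping: "\<And>j. escaping_poly (Q j) R"
    and degree_lim: "filterlim (\<lambda>j. real (degree (Q j))) at_top sequentially"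
    and zeros: "\<And>j z. poly (Q j) z = 0 \<Longrightarrow> z \<in> cball 0 R"
    and few_zeros: "\<And>L. closed L \<Longrightarrow> L \<inter> K = {} \<Longrightarrow>
      \<exists>M. \<forall>j. size (filter_mset (\<lambda>z. z \<in> L) (proots (Q j))) \<le> M"
    and regular: "\<And>z. cmod z \<ge> R0 \<Longrightarrow>
      (\<lambda>j. ln (cmod (poly (Q j) z)) / degree (Q j)) \<longlonglongrightarrow> real_of_ereal (green_function K z)"
begin

definition "b = 2 * R"
definition "\<omega> = equilibrium_measure K"
definition "e = enn2real (mutual_energy b \<omega> \<omega>)"
definition "a j = ln (cmod (lead_coeff (Q j))) / degree (Q j)"
definition "\<zeta> j = (SOME \<zeta>. Q j = smult (lead_coeff (Q j)) (\<Prod>i<degree (Q j). [:-\<zeta> i, 1:]))"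
definition "\<tau> j = empirical {..<degree (Q j)} (\<zeta> j)"
definition "J j = filled_julia (Q j)"
definition "\<omega>J j = equilibrium_measure (J j)"

lemma b: "b \<ge> 1" "2 * R \<le> b" "b > 0"
  using R by (auto simp: b_def)

lemma deg: "degree (Q j) \<ge> 2" "degree (Q j) > 0" "{..<degree (Q j)} \<noteq> {}"
  using escaping_poly.deg[OF escaping[of j]] by (auto simp: lessThan_empty_iff)

lemma K_nonempty: "K \<noteq> {}"
proof
  assume "K = {}"
  obtain \<nu> where \<nu>: "\<nu> \<in> prob_measures_on K" using nonpolar_finite_energy[OF K(2,1,4) b(1,2)] by blast
  then show False using \<open>K = {}\<close> by (simp add: prob_measures_on_def)
qed

lemma \<omega>: "energy_minimizer b K \<omega>" "mutual_energy b \<omega> \<omega> = ennreal e" "\<omega> \<in> prob_measures_on K"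
  "disc_prob \<omega> R" "complex_prob \<omega>" "AE z in \<omega>. z \<in> K"
proof -
  obtain \<nu> where \<nu>: "\<nu> \<in> prob_measures_on K" "mutual_energy b \<nu> \<nu> < \<top>"
    using nonpolar_finite_energy[OF K(2,1,4) b(1,2)] by blast
  note eq = equilibrium_measure_minimizer[OF K(1,4) b(1,2) \<nu>]
  show min: "energy_minimizer b K \<omega>" unfolding \<omega>_def by (rule eq)
  show "mutual_energy b \<omega> \<omega> = ennreal e" using eq(2) by (simp add: e_def \<omega>_def)
  show \<omega>K: "\<omega> \<in> prob_measures_on K" using min by (simp add: energy_minimizer_def)
  show "disc_prob \<omega> R" by (rule prob_measures_on_disc_prob[OF \<omega>K K(1,4)])
  show "complex_prob \<omega>" "AE z in \<omega>. z \<in> K" using \<omega>K K(1) by (simp_all add: prob_measures_on_iff)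
qed

lemma green_function_off_disc:
  assumes z: "cmod z > R"
  shows "real_of_ereal (green_function K z) = log_pot \<omega> z - (ln b - e)"
proof -
  have "mutual_energy b \<omega> \<omega> < \<top>" by (simp add: \<omega>(2))
  from green_function_eq_log_pot[OF \<omega>(4) b(1,2) this z] show ?thesis
    unfolding green_function_def \<omega>_def[symmetric] e_def by (simp only: real_of_ereal.simps)
qed

lemma \<zeta>: "Q j = smult (lead_coeff (Q j)) (\<Prod>i<degree (Q j). [:-\<zeta> j i, 1:])"
proof -
  obtain f where "Q j = smult (lead_coeff (Q j)) (\<Prod>i<degree (Q j). [:-f i, 1:])"
    using complex_poly_decompose'[of "Q j"] by metis
  then show ?thesis
    unfolding \<zeta>_def
    by (rule someI[where P = "\<lambda>\<zeta>. Q j = smult (lead_coeff (Q j)) (\<Prod>i<degree (Q j). [:-\<zeta> i, 1:])"])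
qed

lemma Q_nonzero: "lead_coeff (Q j) \<noteq> 0"
  using deg(1)[of j] by (metis degree_0 leading_coeff_0_iff not_numeral_le_zero)

lemma proots_Q: "proots (Q j) = image_mset (\<zeta> j) (mset_set {..<degree (Q j)})"
  by (rule proots_product[OF \<zeta> Q_nonzero])

lemma root: "i < degree (Q j) \<Longrightarrow> poly (Q j) (\<zeta> j i) = 0"
  by (subst \<zeta>) (auto simp: poly_prod intro!: prod_zero)

lemma complex_prob_\<tau>: "complex_prob (\<tau> j)"
  unfolding \<tau>_def by (rule complex_prob_empirical) (simp_all add: deg)

lemma AE_\<tau>: "S \<in> sets borel \<Longrightarrow> (\<And>z. poly (Q j) z = 0 \<Longrightarrow> z \<in> S) \<Longrightarrow> AE z in \<tau> j. z \<in> S"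
  unfolding \<tau>_def by (subst AE_empirical) (auto simp: deg root)

lemma disc_prob_\<tau>: "disc_prob (\<tau> j) R"
  using complex_prob_\<tau> AE_\<tau>[of "cball 0 R" j] zeros
  by (simp add: disc_prob_def disc_prob_axioms_def)

lemma log_abs_poly:
  "poly (Q j) z \<noteq> 0 \<Longrightarrow> ln (cmod (poly (Q j) z)) / degree (Q j) = a j + log_pot (\<tau> j) z"
  unfolding a_def \<tau>_def by (rule log_pot_empirical[OF deg(2) \<zeta>])

lemma a_lim: "a \<longlonglongrightarrow> - (ln b - e)"
proof (rule lead_coeff_limit[OF \<omega>(4) disc_prob_\<tau>])
  fix z assume z: "cmod z \<ge> R0"
  have "poly (Q j) z \<noteq> 0" for j using zeros[of j z] z R(2) by auto
  then show "(\<lambda>j. a j + log_pot (\<tau> j) z) \<longlonglongrightarrow> log_pot \<omega> z - (ln b - e)"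
    using regular[OF z] green_function_off_disc[of z] z R(2) by (simp add: log_abs_poly)
qed (use R in simp)

lemma \<tau>_pot_lim:
  assumes z: "cmod z \<ge> R0"
  shows "(\<lambda>j. log_pot (\<tau> j) z) \<longlonglongrightarrow> log_pot \<omega> z"
proof -
  have "poly (Q j) z \<noteq> 0" for j using zeros[of j z] z R(2) by auto
  then have "(\<lambda>j. a j + log_pot (\<tau> j) z) \<longlonglongrightarrow> log_pot \<omega> z - (ln b - e)"
    using regular[OF z] green_function_off_disc[of z] z R(2) by (simp add: log_abs_poly)
  from tendsto_diff[OF this a_lim] show ?thesis by simp
qed

lemma J: "closed (J j)" "J j \<subseteq> cball 0 R" "z \<in> J j \<Longrightarrow> poly (Q j) z \<in> J j"
proof -
  interpret ep: escaping_poly "Q j" R by (rule escaping)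
  show "closed (J j)" "J j \<subseteq> cball 0 R" "z \<in> J j \<Longrightarrow> poly (Q j) z \<in> J j"
    unfolding J_def by (rule ep.closed_filled_julia ep.filled_julia_subset ep.filled_julia_invariant)+
qed

text \<open>This is \<open>ln b + log |lead_coeff| / (n - 1)\<close>, the energy bound for the
  filled Julia set, rewritten through \<open>a j\<close>, whose limit is known from
  regularity.\<close>

definition "c j = ln b + a j * (real (degree (Q j)) / (real (degree (Q j)) - 1))"

lemma \<omega>J: "mutual_energy b (\<omega>J j) (\<omega>J j) \<le> ennreal (c j)" "disc_prob (\<omega>J j) R"
  "complex_prob (\<omega>J j)" "AE z in \<omega>J j. z \<in> J j"
proof -
  interpret ep: escaping_poly "Q j" R by (rule escaping)
  obtain \<mu> where \<mu>: "\<mu> \<in> prob_measures_on (J j)"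
    "mutual_energy b \<mu> \<mu> \<le> ennreal (ln b + ln (cmod (lead_coeff (Q j))) / (real (degree (Q j)) - 1))"
    using ep.filled_julia_energy[OF b(2)] unfolding J_def by blast
  have c: "ln b + ln (cmod (lead_coeff (Q j))) / (real (degree (Q j)) - 1) = c j"
    using deg(2)[of j] by (simp add: c_def a_def)
  have "mutual_energy b \<mu> \<mu> < \<top>" using \<mu>(2) by (auto intro: le_less_trans)
  note min = equilibrium_measure_minimizer(1)[OF J(1,2) b(1,2) \<mu>(1) this, folded \<omega>J_def]
  show "mutual_energy b (\<omega>J j) (\<omega>J j) \<le> ennreal (c j)"
    using min \<mu> unfolding energy_minimizer_def c by (blast intro: order_trans)
  have mem: "\<omega>J j \<in> prob_measures_on (J j)" using min by (simp add: energy_minimizer_def)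
  show "disc_prob (\<omega>J j) R" by (rule prob_measures_on_disc_prob[OF mem J(1,2)])
  show "complex_prob (\<omega>J j)" "AE z in \<omega>J j. z \<in> J j" using mem J(1) by (simp_all add: prob_measures_on_iff)
qed

lemma c_lim: "c \<longlonglongrightarrow> e"
proof -
  have "((\<lambda>x::real. x / (x - 1)) \<longlongrightarrow> 1) at_top" by real_asymp
  from filterlim_compose[OF this degree_lim]
  have "(\<lambda>j. ln b + a j * (real (degree (Q j)) / (real (degree (Q j)) - 1))) \<longlonglongrightarrow> ln b + - (ln b - e) * 1"
    by (intro tendsto_intros a_lim)
  then show ?thesis by (simp add: c_def[abs_def])
qed

text \<open>Zero counting measures and Julia equilibrium measures must converge along the same
  indices, so the second selection is made inside the first. Each family has its own probability
  space.\<close>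

lemma common_subsequence:
  obtains r :: "nat \<Rightarrow> nat" and P P' :: "real measure" and X X' :: "nat \<Rightarrow> real \<Rightarrow> complex" and Y Y'
  where "strict_mono r" "prob_space P" "\<And>n. X n \<in> borel_measurable P" "Y \<in> borel_measurable P"
    "\<And>n. distr P borel (X n) = \<omega>J (r n)" "\<And>s. s \<in> space P \<Longrightarrow> (\<lambda>n. X n s) \<longlonglongrightarrow> Y s"
    "prob_space P'" "\<And>n. X' n \<in> borel_measurable P'" "Y' \<in> borel_measurable P'"
    "\<And>n. distr P' borel (X' n) = \<tau> (r n)" "\<And>s. s \<in> space P' \<Longrightarrow> (\<lambda>n. X' n s) \<longlonglongrightarrow> Y' s"
proof -
  have *: "sets \<mu> = sets borel" "prob_space \<mu>" "AE z in \<mu>. z \<in> cball 0 R" if "disc_prob \<mu> R" for \<mu>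
    using that by (auto simp: disc_prob_def disc_prob_axioms_def complex_prob_def complex_prob_axioms_def)
  obtain r1 :: "nat \<Rightarrow> nat" and P :: "real measure" and X :: "nat \<Rightarrow> real \<Rightarrow> complex" and Y
    where 1: "strict_mono r1" "prob_space P" "\<And>n. X n \<in> borel_measurable P" "Y \<in> borel_measurable P"
      "\<And>n. distr P borel (X n) = \<omega>J (r1 n)" "\<And>s. s \<in> space P \<Longrightarrow> (\<lambda>n. X n s) \<longlonglongrightarrow> Y s"
    by (rule complex_skorohod_compactness[of \<omega>J R, OF *[OF \<omega>J(2)]]) blast
  obtain r2 :: "nat \<Rightarrow> nat" and P' :: "real measure" and X' :: "nat \<Rightarrow> real \<Rightarrow> complex" and Y'
    where 2: "strict_mono r2" "prob_space P'" "\<And>n. X' n \<in> borel_measurable P'" "Y' \<in> borel_measurable P'"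
      "\<And>n. distr P' borel (X' n) = \<tau> (r1 (r2 n))" "\<And>s. s \<in> space P' \<Longrightarrow> (\<lambda>n. X' n s) \<longlonglongrightarrow> Y' s"
    by (rule complex_skorohod_compactness[of "\<lambda>n. \<tau> (r1 n)" R, OF *[OF disc_prob_\<tau>]]) blast
  show thesis
  proof (rule that[of "r1 \<circ> r2" P "\<lambda>n. X (r2 n)" Y P' X' Y'])
    show "strict_mono (r1 \<circ> r2)" by (rule strict_mono_o[OF 1(1) 2(1)])
    show "(\<lambda>n. X (r2 n) s) \<longlonglongrightarrow> Y s" if "s \<in> space P" for s
      using LIMSEQ_subseq_LIMSEQ[OF 1(6)[OF that] 2(1)] by (simp add: comp_def)
  qed (use 1 2 in auto)
qed

end

section \<open>The weak limits \<open>\<nu>\<close> of the Julia equilibrium measures and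
  \<open>\<sigma>\<close> of the zero counting measures\<close>

locale julia_limit = regular_centering +
  fixes r :: "nat \<Rightarrow> nat" and P P' :: "real measure" and X X' :: "nat \<Rightarrow> real \<Rightarrow> complex"
    and Y Y' :: "real \<Rightarrow> complex"
  assumes r: "strict_mono r" and P: "prob_space P" and X [measurable]: "\<And>n. X n \<in> borel_measurable P"
    and Y [measurable]: "Y \<in> borel_measurable P"
    and X_law: "\<And>n. distr P borel (X n) = \<omega>J (r n)"
    and X_lim: "\<And>s. s \<in> space P \<Longrightarrow> (\<lambda>n. X n s) \<longlonglongrightarrow> Y s"
    and P': "prob_space P'" and X' [measurable]: "\<And>n. X' n \<in> borel_measurable P'"
    and Y' [measurable]: "Y' \<in> borel_measurable P'"
    and X'_law: "\<And>n. distr P' borel (X' n) = \<tau> (r n)"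
    and X'_lim: "\<And>s. s \<in> space P' \<Longrightarrow> (\<lambda>n. X' n s) \<longlonglongrightarrow> Y' s"
begin

definition "\<nu> = distr P borel Y"
definition "\<sigma> = distr P' borel Y'"

sublocale P: prob_space P by (rule P)
sublocale P': prob_space P' by (rule P')
sublocale \<nu>: complex_prob \<nu>
  unfolding \<nu>_def by (intro complex_prob.intro P.prob_space_distr complex_prob_axioms.intro) auto
sublocale \<sigma>: complex_prob \<sigma>
  unfolding \<sigma>_def by (intro complex_prob.intro P'.prob_space_distr complex_prob_axioms.intro) auto

lemma AE_X: "AE s in P. \<forall>n. X n s \<in> J (r n)"
proof (intro AE_all_countable[THEN iffD2] allI)
  fix n
  show "AE s in P. X n s \<in> J (r n)"
    using \<omega>J(4)[of "r n"] J(1)[of "r n"] unfolding X_law[symmetric]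
    by (subst (asm) AE_distr_iff) (auto simp: borel_closed)
qed

lemma AE_X': "AE s in P'. \<forall>n. X' n s \<in> cball 0 R"
proof (intro AE_all_countable[THEN iffD2] allI)
  fix n
  show "AE s in P'. X' n s \<in> cball 0 R"
    using disc_prob.in_disc[OF disc_prob_\<tau>[of "r n"]] unfolding X'_law[symmetric]
    by (subst (asm) AE_distr_iff) (auto simp: borel_closed)
qed

lemma disc_prob_\<nu>: "disc_prob \<nu> R"
proof (intro disc_prob.intro disc_prob_axioms.intro)
  have "AE s in P. Y s \<in> cball 0 R"
    using AE_X
  proof (rule AE_mp, intro AE_I2 impI)
    fix s assume s: "s \<in> space P" and "\<forall>n. X n s \<in> J (r n)"
    then have "\<forall>n. X n s \<in> cball 0 R" using J(2) by blast
    then show "Y s \<in> cball 0 R"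
      using Lim_in_closed_set[OF closed_cball _ _ X_lim[OF s], of 0 R] by simp
  qed
  then show "AE z in \<nu>. z \<in> cball 0 R" unfolding \<nu>_def by (subst AE_distr_iff) auto
qed (rule \<nu>.complex_prob_axioms)

lemma AE_Y': "AE s in P'. Y' s \<in> cball 0 R"
  using AE_X'
proof (rule AE_mp, intro AE_I2 impI)
  fix s assume s: "s \<in> space P'" and "\<forall>n. X' n s \<in> cball 0 R"
  then show "Y' s \<in> cball 0 R"
    using Lim_in_closed_set[OF closed_cball _ _ X'_lim[OF s], of 0 R] by simp
qed

lemma disc_prob_\<sigma>: "disc_prob \<sigma> R"
proof (intro disc_prob.intro disc_prob_axioms.intro)
  show "AE z in \<sigma>. z \<in> cball 0 R" unfolding \<sigma>_def using AE_Y' by (subst AE_distr_iff) auto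
qed (rule \<sigma>.complex_prob_axioms)

lemma \<nu>_integral_lim:
  fixes f :: "complex \<Rightarrow> real"
  assumes f: "continuous_on UNIV f" and bound: "\<And>z. \<bar>f z\<bar> \<le> C"
  shows "(\<lambda>n. \<integral>z. f z \<partial>\<omega>J (r n)) \<longlonglongrightarrow> (\<integral>z. f z \<partial>\<nu>)"
proof -
  have [measurable]: "f \<in> borel_measurable borel" by (rule borel_measurable_continuous_onI[OF f])
  have "(\<lambda>n. \<integral>s. f (X n s) \<partial>P) \<longlonglongrightarrow> (\<integral>s. f (Y s) \<partial>P)"
  proof (rule integral_dominated_convergence[where w = "\<lambda>_. C"])
    show "AE s in P. (\<lambda>n. f (X n s)) \<longlonglongrightarrow> f (Y s)"
      by (intro AE_I2 continuous_on_tendsto_compose[OF f] X_lim) auto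
  qed (use bound in auto)
  then show ?thesis unfolding X_law[symmetric] \<nu>_def by (simp add: integral_distr)
qed

text \<open>The integrands may vary with \<open>n\<close> as long as they converge along convergent
  sequences of arguments; this admits logarithms with a moving pole.\<close>

lemma \<sigma>_integral_lim:
  fixes F :: "nat \<Rightarrow> complex \<Rightarrow> real"
  assumes [measurable]: "\<And>n. F n \<in> borel_measurable borel" "G \<in> borel_measurable borel"
    and lim: "\<And>w y. y \<longlonglongrightarrow> w \<Longrightarrow> w \<in> cball 0 R \<Longrightarrow> (\<lambda>n. F n (y n)) \<longlonglongrightarrow> G w"
    and bound: "\<And>n z. z \<in> cball 0 R \<Longrightarrow> \<bar>F n z\<bar> \<le> C"
  shows "(\<lambda>n. \<integral>z. F n z \<partial>\<tau> (r n)) \<longlonglongrightarrow> (\<integral>z. G z \<partial>\<sigma>)"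
proof -
  have "(\<lambda>n. \<integral>s. F n (X' n s) \<partial>P') \<longlonglongrightarrow> (\<integral>s. G (Y' s) \<partial>P')"
  proof (rule integral_dominated_convergence[where w = "\<lambda>_. C"])
    show "AE s in P'. (\<lambda>n. F n (X' n s)) \<longlonglongrightarrow> G (Y' s)"
      using AE_Y' AE_space by eventually_elim (intro lim X'_lim)
    show "AE s in P'. norm (F n (X' n s)) \<le> C" for n
      using AE_X' by eventually_elim (use bound in auto)
  qed auto
  then show ?thesis unfolding X'_law[symmetric] \<sigma>_def by (simp add: integral_distr)
qed

lemma \<nu>_energy: "mutual_energy b \<nu> \<nu> \<le> ennreal e"
proof -
  have "mutual_energy b \<nu> \<nu> \<le> liminf (\<lambda>n. truncated_energy \<top> b (distr P borel (X n)))"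
    unfolding \<nu>_def by (rule mutual_energy_le_liminf[OF P X Y X_lim b(3) tendsto_const])
  also have "\<dots> \<le> liminf (\<lambda>n. ennreal (c (r n)))"
    unfolding X_law truncated_energy_top by (intro Liminf_mono always_eventually allI \<omega>J)
  also have "\<dots> = ennreal e"
    using LIMSEQ_subseq_LIMSEQ[OF c_lim r]
    by (intro lim_imp_Liminf tendsto_ennrealI) (simp_all add: comp_def)
  finally show ?thesis .
qed

text \<open>Away from \<open>K\<close> there are at most \<open>M\<close> zeros, a proportion
  \<open>M / degree\<close> that tends to 0.\<close>

lemma \<sigma>_on_K: "AE z in \<sigma>. z \<in> K"
proof -
  have infd: "AE z in \<sigma>. infdist z K \<le> \<epsilon>" if \<epsilon>: "\<epsilon> > 0" for \<epsilon>
  proof -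
    define L where "L = {z. infdist z K \<ge> \<epsilon>}"
    have "closed L" unfolding L_def by (intro closed_Collect_le continuous_intros)
    moreover have "L \<inter> K = {}" using \<epsilon> by (auto simp: L_def)
    ultimately obtain M where M: "\<And>j. size (filter_mset (\<lambda>z. z \<in> L) (proots (Q j))) \<le> M"
      using few_zeros by blast
    \<comment> \<open>A continuous substitute for the indicator of \<open>L\<close>: it is at most
      1, vanishes off \<open>L\<close>, and is positive where
      \<open>infdist z K > \<epsilon>\<close>.\<close>
    define h where "h z = min 1 (max 0 (infdist z K - \<epsilon>))" for z
    have h: "0 \<le> h z" "h z \<le> 1" "z \<notin> L \<Longrightarrow> h z = 0" for z by (auto simp: h_def L_def)
    have conth: "continuous_on UNIV h" unfolding h_def by (intro continuous_intros)
    have [measurable]: "h \<in> borel_measurable borel" by (rule borel_measurable_continuous_onI[OF conth])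
    have le: "(\<integral>z. h z \<partial>\<tau> j) \<le> real M / degree (Q j)" for j
    proof -
      have "(\<integral>z. h z \<partial>\<tau> j) = (\<Sum>i<degree (Q j). h (\<zeta> j i)) / degree (Q j)"
        unfolding \<tau>_def by (subst integral_empirical) (simp_all add: deg)
      also have "(\<Sum>i<degree (Q j). h (\<zeta> j i)) \<le> (\<Sum>i<degree (Q j). if \<zeta> j i \<in> L then 1 else 0)"
        using h by (intro sum_mono) auto
      also have "\<dots> = real (card {i \<in> {..<degree (Q j)}. \<zeta> j i \<in> L})"
        by (simp add: sum.If_cases Int_def)
      also have "card {i \<in> {..<degree (Q j)}. \<zeta> j i \<in> L} = size (filter_mset (\<lambda>z. z \<in> L) (proots (Q j)))"
        unfolding proots_Q filter_mset_image_mset by simp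
      finally show ?thesis using M[of j] by (simp add: divide_right_mono order_trans)
    qed
    have "(\<lambda>n. \<integral>z. h z \<partial>\<tau> (r n)) \<longlonglongrightarrow> (\<integral>z. h z \<partial>\<sigma>)"
      by (rule \<sigma>_integral_lim[where C = 1]) (use h in \<open>auto intro: continuous_on_tendsto_compose[OF conth]\<close>)
    moreover have "(\<lambda>n. real M / degree (Q (r n))) \<longlonglongrightarrow> 0"
      using LIMSEQ_subseq_LIMSEQ[OF tendsto_divide_0[OF tendsto_const[of "real M"] filterlim_at_top_imp_at_infinity[OF degree_lim]] r]
      by (simp add: comp_def)
    ultimately have "(\<integral>z. h z \<partial>\<sigma>) \<le> 0"
      by (rule LIMSEQ_le) (use le in auto)
    moreover have hi: "integrable \<sigma> h" by (rule \<sigma>.integrable_bounded[of _ 1]) (use h in auto)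
    ultimately have "(\<integral>z. h z \<partial>\<sigma>) = 0" using h(1) by (intro antisym) auto
    then have "AE z in \<sigma>. h z = 0"
      using integral_nonneg_eq_0_iff_AE[OF hi] h(1) by simp
    then show ?thesis by eventually_elim (auto simp: h_def min_def max_def split: if_splits)
  qed
  have "AE z in \<sigma>. \<forall>m. infdist z K \<le> 1 / real (Suc m)"
    by (intro AE_all_countable[THEN iffD2] allI infd) simp
  then show ?thesis
  proof eventually_elim
    case (elim z)
    have "infdist z K \<le> 0"
      by (rule LIMSEQ_le_const[OF LIMSEQ_inverse_real_of_nat]) (use elim in \<open>auto simp: inverse_eq_divide\<close>)
    then show ?case using K(1) K_nonempty infdist_nonneg[of z K] by (simp add: in_closed_iff_infdist_zero)
  qed
qed

lemma \<sigma>_pot: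
  assumes z: "z \<notin> K"
  shows "log_pot \<sigma> z = log_pot \<omega> z"
proof (rule log_pot_identity[OF disc_prob_\<sigma> \<sigma>_on_K \<omega>(4,6) K(1,4,3) _ z])
  fix z assume z: "R0 \<le> cmod z"
  have d: "cmod z - R \<le> dist z w" "dist z w \<le> cmod z + R" "z \<noteq> w" if "w \<in> cball 0 R" for w
    using that z R norm_triangle_ineq4[of z w] norm_triangle_ineq2[of z w] by (auto simp: dist_norm)
  have "(\<lambda>n. \<integral>w. ln (dist z w) \<partial>\<tau> (r n)) \<longlonglongrightarrow> (\<integral>w. ln (dist z w) \<partial>\<sigma>)"
  proof (rule \<sigma>_integral_lim[where C = "\<bar>ln (cmod z - R)\<bar> + \<bar>ln (cmod z + R)\<bar>"])
    show "(\<lambda>n. ln (dist z (y n))) \<longlonglongrightarrow> ln (dist z w)" if "y \<longlonglongrightarrow> w" "w \<in> cball 0 R" for w y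
      using d(3)[OF that(2)] by (intro tendsto_intros that) auto
    show "\<bar>ln (dist z w)\<bar> \<le> \<bar>ln (cmod z - R)\<bar> + \<bar>ln (cmod z + R)\<bar>" if "w \<in> cball 0 R" for w
    proof -
      have "0 < cmod z - R" using z R by simp
      then have "ln (cmod z - R) \<le> ln (dist z w)" "ln (dist z w) \<le> ln (cmod z + R)"
        using d[OF that] by (auto simp: ln_le_cancel_iff)
      then show ?thesis by linarith
    qed
  qed auto
  then show "log_pot \<sigma> z = log_pot \<omega> z"
    using LIMSEQ_subseq_LIMSEQ[OF \<tau>_pot_lim[OF z] r]
    unfolding log_pot_def[symmetric] comp_def by (rule LIMSEQ_unique)
qed

text \<open>With \<open>eventually\<close>, finitely many bad points attract zeros of one and the
  same polynomial, as the counting argument demands. For a point off \<open>K\<close> and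
  \<open>Bad\<close> this leaves a ball that is free of zeros for infinitely many \<open>n\<close>,
  enough to contradict a property holding eventually.\<close>

definition "Bad = {z. z \<notin> K \<and> (\<forall>\<delta>>0. \<forall>\<^sub>F n in sequentially. \<exists>\<xi>\<in>#proots (Q (r n)). dist z \<xi> < \<delta>)}"

lemma \<nu>_Bad: "AE z in \<nu>. z \<notin> Bad"
proof -
  have count: "countable Bad"
    unfolding Bad_def
  proof (rule countable_zero_limits[OF K(1) K_nonempty])
    fix L :: "complex set" assume "closed L" "L \<inter> K = {}"
    from few_zeros[OF this] show "\<exists>M. \<forall>n. size (filter_mset (\<lambda>z. z \<in> L) (proots (Q (r n)))) \<le> M" by auto
  qed
  have "mutual_energy b \<nu> \<nu> < \<top>" using \<nu>_energy by (auto intro: le_less_trans)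
  then have null: "{z} \<in> null_sets \<nu>" for z
    using finite_energy_singleton[OF \<nu>.complex_prob_axioms] by (auto intro!: null_setsI simp: \<nu>.sets_eq_borel)
  have "(\<Union>z\<in>Bad. {z}) \<in> null_sets \<nu>" by (rule null_sets_UN'[OF count null])
  then have "Bad \<in> null_sets \<nu>" by simp
  then show ?thesis by (rule AE_not_in)
qed

text \<open>A limit point of points of the Julia sets that stays away from the zeros: there the potentials of
  the zero counting measures converge, and \<open>|q\<^sub>k| \<le> R\<close> on the Julia set of \<open>q\<^sub>k\<close>.\<close>

lemma pot_limit_point:
  assumes x: "x \<longlonglongrightarrow> z" "\<And>n. x n \<in> J (r n)" and z: "z \<notin> K" "z \<notin> Bad"
  shows "log_pot \<omega> z \<le> ln b - e"
proof -
  obtain \<delta> where \<delta>: "\<delta> > 0" and freq: "\<not> (\<forall>\<^sub>F n in sequentially. \<exists>\<xi>\<in>#proots (Q (r n)). dist z \<xi> < \<delta>)"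
    using z by (auto simp: Bad_def)
  have "infdist z K > 0" using K(1) K_nonempty z(1) by (simp add: infdist_pos_not_in_closed)
  \<comment> \<open>\<open>g\<close> cuts the logarithm off at \<open>\<eta>\<close> to make it
    bounded and continuous. The cut is invisible to \<open>\<sigma>\<close>, which lives at distance
    at least \<open>infdist z K\<close> from \<open>z\<close>, and to the zeros when they stay
    \<open>\<delta> / 2\<close> away from \<open>x n\<close>.\<close>
  define \<eta> where "\<eta> = min (\<delta> / 2) (infdist z K)"
  have \<eta>: "\<eta> > 0" "\<eta> \<le> \<delta> / 2" "\<eta> \<le> infdist z K" using \<delta> \<open>infdist z K > 0\<close> by (auto simp: \<eta>_def)
  define g where "g y w = ln (max \<eta> (dist y w))" for y w :: complex
  have xR: "x n \<in> cball 0 R" for n using x(2) J(2) by blast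
  have gl: "(\<lambda>n. \<integral>w. g (x n) w \<partial>\<tau> (r n)) \<longlonglongrightarrow> (\<integral>w. g z w \<partial>\<sigma>)"
  proof (rule \<sigma>_integral_lim[where C = "\<bar>ln \<eta>\<bar> + \<bar>ln (\<eta> + 2 * R)\<bar>"])
    show "(\<lambda>n. g (x n) (y n)) \<longlonglongrightarrow> g z w" if "y \<longlonglongrightarrow> w" for w y
      unfolding g_def using \<eta> by (intro tendsto_intros that x(1)) auto
    show "\<bar>g (x n) w\<bar> \<le> \<bar>ln \<eta>\<bar> + \<bar>ln (\<eta> + 2 * R)\<bar>" if "w \<in> cball 0 R" for n w
    proof -
      have "dist (x n) w \<le> 2 * R" using that xR[of n] dist_triangle2[of "x n" w 0] by (simp add: dist_commute)
      then have m: "\<eta> \<le> max \<eta> (dist (x n) w)" "max \<eta> (dist (x n) w) \<le> \<eta> + 2 * R"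
        using \<eta>(1) R(1) by auto
      have "ln \<eta> \<le> g (x n) w" unfolding g_def using m \<eta>(1) by (subst ln_le_cancel_iff) auto
      moreover have "g (x n) w \<le> ln (\<eta> + 2 * R)" unfolding g_def using m \<eta>(1) R(1) by (subst ln_le_cancel_iff) auto
      ultimately show ?thesis by linarith
    qed
    show "g (x n) \<in> borel_measurable borel" "g z \<in> borel_measurable borel" for n
      unfolding g_def[abs_def] by measurable
  qed
  have gz: "(\<integral>w. g z w \<partial>\<sigma>) = log_pot \<omega> z"
  proof -
    have "(\<integral>w. g z w \<partial>\<sigma>) = log_pot \<sigma> z"
      unfolding log_pot_def
    proof (rule integral_cong_AE)
      show "AE w in \<sigma>. g z w = ln (dist z w)"
        using \<sigma>_on_K
      proof eventually_elim
        case (elim w)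
        then have "infdist z K \<le> dist z w" by (rule infdist_le)
        then show ?case using \<eta>(3) by (simp add: g_def max_def)
      qed
    qed (simp_all add: g_def[abs_def])
    then show ?thesis using \<sigma>_pot[OF z(1)] by simp
  qed
  let ?d = "\<lambda>n. real (degree (Q (r n)))"
  have lim: "(\<lambda>n. a (r n) + (\<integral>w. g (x n) w \<partial>\<tau> (r n)) - ln R / ?d n) \<longlonglongrightarrow> - (ln b - e) + log_pot \<omega> z - 0"
  proof (intro tendsto_intros)
    show "(\<lambda>n. a (r n)) \<longlonglongrightarrow> - (ln b - e)" using LIMSEQ_subseq_LIMSEQ[OF a_lim r] by (simp add: comp_def)
    show "(\<lambda>n. \<integral>w. g (x n) w \<partial>\<tau> (r n)) \<longlonglongrightarrow> log_pot \<omega> z" using gl gz by simp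
    show "(\<lambda>n. ln R / ?d n) \<longlonglongrightarrow> 0"
      using LIMSEQ_subseq_LIMSEQ[OF tendsto_divide_0[OF tendsto_const[of "ln R"] filterlim_at_top_imp_at_infinity[OF degree_lim]] r]
      by (simp add: comp_def)
  qed
  show ?thesis
  proof (rule ccontr)
    assume "\<not> ?thesis"
    \<comment> \<open>Were the potential too large, the cut-off expression would eventually exceed
      \<open>ln R / ?d n\<close>. Without a zero within \<open>\<delta>\<close> of \<open>z\<close>
      it equals \<open>ln |Q (x n)| / ?d n\<close>, which is at most \<open>ln R / ?d n\<close>; so
      zeros would eventually come within \<open>\<delta>\<close>, against the choice of
      \<open>\<delta>\<close>.\<close>
    then have "\<forall>\<^sub>F n in sequentially. 0 < a (r n) + (\<integral>w. g (x n) w \<partial>\<tau> (r n)) - ln R / ?d n"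
      by (intro order_tendstoD(1)[OF lim]) simp
    moreover have "\<forall>\<^sub>F n in sequentially. dist (x n) z < \<delta> / 2" using \<delta> by (intro tendstoD[OF x(1)]) simp
    ultimately have "\<forall>\<^sub>F n in sequentially. \<exists>\<xi>\<in>#proots (Q (r n)). dist z \<xi> < \<delta>"
    proof eventually_elim
      case (elim n)
      show ?case
      proof (rule ccontr)
        assume no: "\<not> ?case"
        have far: "dist (x n) \<xi> \<ge> \<delta> / 2" if "poly (Q (r n)) \<xi> = 0" for \<xi>
        proof -
          have "\<xi> \<in># proots (Q (r n))" using that Q_nonzero[of "r n"] by auto
          then have "dist z \<xi> \<ge> \<delta>" using no by (auto simp: not_less)
          then show ?thesis using elim(2) dist_triangle[of z \<xi> "x n"] by (simp add: dist_commute)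
        qed
        then have ne: "poly (Q (r n)) (x n) \<noteq> 0" using \<delta> by fastforce
        have "AE w in \<tau> (r n). w \<in> {w. \<delta> / 2 \<le> dist (x n) w}"
          by (rule AE_\<tau>) (use far in auto)
        then have "(\<integral>w. g (x n) w \<partial>\<tau> (r n)) = log_pot (\<tau> (r n)) (x n)"
          unfolding log_pot_def
        proof (intro integral_cong_AE, goal_cases)
          case 3
          then show ?case by eventually_elim (use \<eta>(2) in \<open>auto simp: g_def max_def\<close>)
        qed (use complex_prob.sets_eq_borel[OF complex_prob_\<tau>] in \<open>auto simp: g_def[abs_def] cong: measurable_cong_sets\<close>)
        then have "a (r n) + (\<integral>w. g (x n) w \<partial>\<tau> (r n)) = ln (cmod (poly (Q (r n)) (x n))) / ?d n"
          using log_abs_poly[OF ne] by simp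
        also have "\<dots> \<le> ln R / ?d n"
        proof -
          have "poly (Q (r n)) (x n) \<in> cball 0 R" using J(3)[OF x(2)] J(2) by blast
          then have "ln (cmod (poly (Q (r n)) (x n))) \<le> ln R" using ne R by (subst ln_le_cancel_iff) auto
          then show ?thesis by (intro divide_right_mono) auto
        qed
        finally show False using elim(1) by simp
      qed
    qed
    with freq show False ..
  qed
qed

lemma \<nu>_eq_\<omega>: "\<nu> = \<omega>"
proof -
  have fin: "mutual_energy b \<nu> \<nu> < \<top>" using \<nu>_energy by (auto intro: le_less_trans)
  have good: "AE z in \<nu>. z \<in> K \<or> log_pot \<omega> z \<le> ln b - e"
  proof -
    have "AE s in P. Y s \<notin> Bad"
      using \<nu>_Bad unfolding \<nu>_def by (rule AE_distrD[rotated]) measurable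
    then have "AE s in P. Y s \<in> K \<or> log_pot \<omega> (Y s) \<le> ln b - e"
      using AE_X AE_space
    proof eventually_elim
      case (elim s)
      then show ?case using pot_limit_point[of "\<lambda>n. X n s" "Y s"] X_lim by blast
    qed
    moreover have "{z. z \<in> K \<or> log_pot \<omega> z \<le> ln b - e} \<in> sets borel"
    proof -
      interpret \<omega>: complex_prob \<omega> by (rule \<omega>)
      have [measurable]: "log_pot \<omega> \<in> borel_measurable borel" unfolding log_pot_def[abs_def] by measurable
      have [measurable]: "K \<in> sets borel" using K(1) by (rule borel_closed)
      show ?thesis by measurable
    qed
    ultimately show ?thesis unfolding \<nu>_def by (subst AE_distr_iff) auto
  qed
  \<comment> \<open>Off \<open>K\<close> the integral of the kernel against \<open>\<omega>\<close>
    is \<open>ln b - log_pot \<omega> z\<close>, so the upper bound for the potential becomes the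
    lower bound \<open>e\<close> for this integral.\<close>
  have out: "AE z in \<nu>. z \<in> K \<or> mutual_energy b \<omega> \<omega> \<le> (\<integral>\<^sup>+w. log_ker b z w \<partial>\<omega>)"
    using good disc_prob.in_disc[OF disc_prob_\<nu>]
  proof eventually_elim
    case (elim z)
    show ?case
    proof (cases "z \<in> K")
      case False
      interpret \<omega>: disc_prob \<omega> R by (rule \<omega>)
      have d0: "infdist z K > 0" using K(1) K_nonempty False by (simp add: infdist_pos_not_in_closed)
      have ae: "AE w in \<omega>. infdist z K \<le> dist z w \<and> dist z w \<le> b"
        using \<omega>(6) \<omega>.in_disc
      proof eventually_elim
        case w: (elim w)
        then show ?case using infdist_le[OF w(1)] elim(2) dist_triangle2[of z w 0] b(2) by simp
      qed
      have int: "integrable \<omega> (\<lambda>w. ln b - ln (dist z w))"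
        using integrable_ln_dist[OF \<omega>(5) ae d0] by simp
      have "(\<integral>\<^sup>+w. log_ker b z w \<partial>\<omega>) = (\<integral>\<^sup>+w. ennreal (ln b - ln (dist z w)) \<partial>\<omega>)"
        by (rule nn_integral_cong_AE, use ae in eventually_elim)
           (use d0 b(3) in \<open>auto simp: log_ker_def ln_div\<close>)
      also have "\<dots> = ennreal (\<integral>w. ln b - ln (dist z w) \<partial>\<omega>)"
      proof (rule nn_integral_eq_integral[OF int])
        show "AE w in \<omega>. 0 \<le> ln b - ln (dist z w)"
          using ae
        proof eventually_elim
          case (elim w)
          moreover from this d0 have "0 < dist z w" by linarith
          ultimately show ?case using b(3) by simp
        qed
      qed
      also have "(\<integral>w. ln b - ln (dist z w) \<partial>\<omega>) = ln b - log_pot \<omega> z"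
        unfolding log_pot_def using integrable_ln_dist[OF \<omega>(5) ae d0] by (simp add: \<omega>.prob_space[simplified])
      finally show ?thesis using elim(1) False by (simp add: \<omega>(2) ennreal_leI)
    qed simp
  qed
  have "mutual_energy b \<omega> \<omega> \<le> mutual_energy b \<nu> \<omega>"
    by (rule mutual_energy_minimizer_ge[OF \<omega>(1) K(1,4) b(3,2) \<nu>.complex_prob_axioms fin out])
  then have "mutual_energy b \<nu> \<nu> + mutual_energy b \<omega> \<omega> \<le> 2 * mutual_energy b \<nu> \<omega>"
    using \<nu>_energy unfolding mult_2 \<omega>(2) by (intro add_mono) auto
  then show ?thesis
    by (rule mutual_energy_positive_definite(2)[OF disc_prob_\<nu> \<omega>(4) b(3,2) _ fin]) (simp add: \<omega>(2))
qed

end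

lemma (in regular_centering) equilibrium_subsequence:
  obtains r :: "nat \<Rightarrow> nat" where "strict_mono r"
    "\<And>f C. continuous_on UNIV (f :: complex \<Rightarrow> real) \<Longrightarrow> (\<And>z. \<bar>f z\<bar> \<le> C) \<Longrightarrow>
      (\<lambda>n. \<integral>z. f z \<partial>equilibrium_measure (filled_julia (Q (r n)))) \<longlonglongrightarrow> (\<integral>z. f z \<partial>equilibrium_measure K)"
proof (rule common_subsequence)
  fix r :: "nat \<Rightarrow> nat" and P P' :: "real measure" and X X' :: "nat \<Rightarrow> real \<Rightarrow> complex" and Y Y'
  assume lim: "strict_mono r" "prob_space P" "\<And>n. X n \<in> borel_measurable P" "Y \<in> borel_measurable P"
    "\<And>n. distr P borel (X n) = \<omega>J (r n)" "\<And>s. s \<in> space P \<Longrightarrow> (\<lambda>n. X n s) \<longlonglongrightarrow> Y s"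
    "prob_space P'" "\<And>n. X' n \<in> borel_measurable P'" "Y' \<in> borel_measurable P'"
    "\<And>n. distr P' borel (X' n) = \<tau> (r n)" "\<And>s. s \<in> space P' \<Longrightarrow> (\<lambda>n. X' n s) \<longlonglongrightarrow> Y' s"
  interpret julia_limit K Q R R0 r P P' X X' Y Y'
    by (intro julia_limit.intro julia_limit_axioms.intro regular_centering_axioms lim)
  show thesis
  proof (rule that[OF r])
    fix f :: "complex \<Rightarrow> real" and C
    assume f: "continuous_on UNIV f" "\<And>z. \<bar>f z\<bar> \<le> C"
    show "(\<lambda>n. \<integral>z. f z \<partial>equilibrium_measure (filled_julia (Q (r n)))) \<longlonglongrightarrow> (\<integral>z. f z \<partial>equilibrium_measure K)"
      using \<nu>_integral_lim[OF f] unfolding \<nu>_eq_\<omega> \<omega>_def \<omega>J_def J_def .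
  qed
qed

section \<open>From subsequences to the full sequence\<close>

lemma LIMSEQ_by_subsequences:
  fixes x :: "nat \<Rightarrow> real"
  assumes "\<And>s :: nat \<Rightarrow> nat. strict_mono s \<Longrightarrow> \<exists>r :: nat \<Rightarrow> nat. strict_mono r \<and> (\<lambda>n. x (s (r n))) \<longlonglongrightarrow> l"
  shows "x \<longlonglongrightarrow> l"
proof (rule ccontr)
  assume "\<not> ?thesis"
  then obtain \<epsilon> where \<epsilon>: "\<epsilon> > 0" and freq: "\<And>N. \<exists>n\<ge>N. \<not> dist (x n) l < \<epsilon>"
    unfolding lim_sequentially by blast
  have "infinite {n. \<not> dist (x n) l < \<epsilon>}"
    unfolding infinite_nat_iff_unbounded_le using freq by auto
  then obtain s :: "nat \<Rightarrow> nat" where s: "strict_mono s" "\<And>n. s n \<in> {n. \<not> dist (x n) l < \<epsilon>}"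
    using infinite_enumerate by blast
  obtain r :: "nat \<Rightarrow> nat" where "(\<lambda>n. x (s (r n))) \<longlonglongrightarrow> l" using assms[OF s(1)] by blast
  then obtain n where "dist (x (s (r n))) l < \<epsilon>"
    using \<epsilon> unfolding lim_sequentially by blast
  then show False using s(2)[of "r n"] by simp
qed

theorem theorem3:
  fixes K :: "complex set" and q :: "nat \<Rightarrow> complex poly"
  assumes "compact K" and "\<not> polar K" and "polynomially_convex K"
    and "filterlim (\<lambda>k. degree (q k)) at_top sequentially"
    and "K_regular K q" and "centers_on q K"
  shows "weak_star_conv (\<lambda>k. equilibrium_measure (filled_julia (q k))) (equilibrium_measure K)"
proof -
  have K: "closed K" using assms(1) by (rule compact_imp_closed)
  obtain \<rho> where \<rho>: "\<rho> > 0" "K \<subseteq> ball 0 \<rho>"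
    and unif: "uniform_limit (- ball 0 \<rho>) (\<lambda>k z. ln (cmod (poly (q k) z)) / degree (q k))
      (\<lambda>z. real_of_ereal (green_function K z)) sequentially"
    using assms(5) unfolding K_regular_def by blast
  obtain N \<rho>' where \<rho>': "\<And>k. k \<ge> N \<Longrightarrow> {z. poly (q k) z = 0} \<subseteq> ball 0 \<rho>'"
    and few: "\<And>L. closed L \<Longrightarrow> L \<inter> K = {} \<Longrightarrow>
      \<exists>M. \<forall>k\<ge>N. size (filter_mset (\<lambda>z. z \<in> L) (proots (q k))) \<le> M"
    using assms(6) unfolding centers_on_def by metis
  have K_disc: "K \<subseteq> cball 0 \<rho>" using \<rho>(2) by auto
  define b where "b = max 1 (2 * \<rho>)"
  have b: "b \<ge> 1" "2 * \<rho> \<le> b" by (simp_all add: b_def)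
  let ?\<omega> = "equilibrium_measure K"
  obtain \<nu> where \<nu>: "\<nu> \<in> prob_measures_on K" "mutual_energy b \<nu> \<nu> < \<top>"
    by (rule nonpolar_finite_energy[OF assms(2) K K_disc b])
  note \<omega> = equilibrium_measure_minimizer[OF K K_disc b \<nu>]
  have \<omega>K: "?\<omega> \<in> prob_measures_on K" using \<omega>(1) by (simp add: energy_minimizer_def)
  have \<omega>_disc: "disc_prob ?\<omega> \<rho>" by (rule prob_measures_on_disc_prob[OF \<omega>K K K_disc])
  define I where "I = ln b - enn2real (mutual_energy b ?\<omega> ?\<omega>)"
  have green: "real_of_ereal (green_function K z) = log_pot ?\<omega> z - I" if z: "cmod z > \<rho>" for z
    using green_function_eq_log_pot[OF \<omega>_disc b \<omega>(2) z]
    unfolding green_function_def I_def by (simp only: real_of_ereal.simps)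
  \<comment> \<open>One disc for everything: it contains \<open>K\<close> and the zeros of all
    \<open>q k\<close> with \<open>k \<ge> N\<close>, its complement lies where the convergence is
    uniform, and it is an escape disc for all late \<open>q k\<close>.\<close>
  obtain R where R: "R \<ge> max (max 1 \<rho>) \<rho>' + 1"
    and esc: "\<And>(p :: complex poly) z. degree p \<ge> 2 \<Longrightarrow> cmod z \<ge> R \<Longrightarrow>
      \<bar>ln (cmod (poly p z)) / degree p - (log_pot ?\<omega> z - I)\<bar> < 1 \<Longrightarrow> 2 * cmod z \<le> cmod (poly p z)"
    by (rule escape_radius[OF \<omega>_disc \<rho>(1)]) blast
  have "\<forall>\<^sub>F k in sequentially. \<forall>z\<in>- ball 0 \<rho>.
      dist (ln (cmod (poly (q k) z)) / degree (q k)) (real_of_ereal (green_function K z)) < 1"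
    using uniform_limitD[OF unif zero_less_one] .
  moreover have "\<forall>\<^sub>F k in sequentially. degree (q k) \<ge> 2"
    using assms(4) by (simp add: filterlim_at_top)
  ultimately have "\<forall>\<^sub>F k in sequentially. k \<ge> N \<and> degree (q k) \<ge> 2 \<and> (\<forall>z\<in>- ball 0 \<rho>.
      dist (ln (cmod (poly (q k) z)) / degree (q k)) (real_of_ereal (green_function K z)) < 1)"
    using eventually_ge_at_top[of N] by eventually_elim simp
  then obtain N' where N'0: "\<And>k. k \<ge> N' \<Longrightarrow> k \<ge> N \<and> degree (q k) \<ge> 2 \<and> (\<forall>z\<in>- ball 0 \<rho>.
      dist (ln (cmod (poly (q k) z)) / degree (q k)) (real_of_ereal (green_function K z)) < 1)"
    unfolding eventually_sequentially by blast
  then have N': "\<And>k. k \<ge> N' \<Longrightarrow> k \<ge> N" "\<And>k. k \<ge> N' \<Longrightarrow> degree (q k) \<ge> 2"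
    "\<And>k z. k \<ge> N' \<Longrightarrow> cmod z \<ge> \<rho> \<Longrightarrow>
      \<bar>ln (cmod (poly (q k) z)) / degree (q k) - real_of_ereal (green_function K z)\<bar> < 1"
    by (auto simp: dist_real_def)
  show ?thesis
    unfolding weak_star_conv_def
  proof (intro allI impI, elim conjE, rule LIMSEQ_by_subsequences)
    fix f :: "complex \<Rightarrow> real" and s :: "nat \<Rightarrow> nat"
    assume f: "continuous_on UNIV f" "compact (closure {z. f z \<noteq> 0})" and s: "strict_mono s"
    \<comment> \<open>Compact support serves to make \<open>f\<close> bounded; convergence along the
      subsequence is available for all bounded continuous functions.\<close>
    obtain C where C: "\<And>z. \<bar>f z\<bar> \<le> C"
    proof -
      have "bounded (f ` closure {z. f z \<noteq> 0})"
        by (intro compact_imp_bounded compact_continuous_image continuous_on_subset[OF f(1)] f(2)) auto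
      then obtain C where C: "\<And>z. z \<in> closure {z. f z \<noteq> 0} \<Longrightarrow> \<bar>f z\<bar> \<le> C"
        by (auto simp: bounded_iff)
      have "\<bar>f z\<bar> \<le> max C 0" for z
        using C[of z] closure_subset[of "{z. f z \<noteq> 0}"] by (cases "f z = 0") auto
      then show thesis by (rule that)
    qed
    \<comment> \<open>The shift by \<open>N'\<close> makes the estimates hold for every index of the
      subsequence, since \<open>s (j + N') \<ge> N'\<close>.\<close>
    define Q where "Q j = q (s (j + N'))" for j
    have idx: "s (j + N') \<ge> N'" for j using seq_suble[OF s, of "j + N'"] by simp
    have s': "strict_mono (\<lambda>j. s (j + N'))" using s by (auto simp: strict_mono_def)
    interpret regular_centering K Q R "R + 1"
    proof (rule regular_centering.intro)
      show "closed K" "\<not> polar K" "connected (- K)" "K \<subseteq> cball 0 R" "R \<ge> 1" "R + 1 > R"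
        using K assms(2,3) K_disc R by (auto simp: polynomially_convex_def)
      show "escaping_poly (Q j) R" for j
      proof
        show "degree (Q j) \<ge> 2" unfolding Q_def by (rule N'(2)[OF idx])
        show "R > 0" using R by simp
        fix z assume z: "R \<le> cmod z"
        then have "cmod z > \<rho>" using R by simp
        then show "2 * cmod z \<le> cmod (poly (Q j) z)"
          using esc[OF N'(2)[OF idx[of j]] z] N'(3)[OF idx[of j], of z] green[of z] by (simp add: Q_def)
      qed
      show "filterlim (\<lambda>j. real (degree (Q j))) at_top sequentially"
        unfolding Q_def
        by (rule filterlim_compose[OF filterlim_real_sequentially
              filterlim_compose[OF assms(4) filterlim_subseq[OF s']]])
      show "z \<in> cball 0 R" if "poly (Q j) z = 0" for j z
        using that \<rho>'[OF N'(1)[OF idx[of j]]] R unfolding Q_def by fastforce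
      show "\<exists>M. \<forall>j. size (filter_mset (\<lambda>z. z \<in> L) (proots (Q j))) \<le> M" if "closed L" "L \<inter> K = {}" for L
        using few[OF that] N'(1)[OF idx] unfolding Q_def by blast
      show "(\<lambda>j. ln (cmod (poly (Q j) z)) / degree (Q j)) \<longlonglongrightarrow> real_of_ereal (green_function K z)"
        if "R + 1 \<le> cmod z" for z
      proof -
        have "z \<in> - ball 0 \<rho>" using that R by simp
        from LIMSEQ_subseq_LIMSEQ[OF tendsto_uniform_limitI[OF unif this] s']
        show ?thesis by (simp add: Q_def comp_def)
      qed
    qed
    obtain r :: "nat \<Rightarrow> nat" where r: "strict_mono r"
      "\<And>f C. continuous_on UNIV (f :: complex \<Rightarrow> real) \<Longrightarrow> (\<And>z. \<bar>f z\<bar> \<le> C) \<Longrightarrow>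
        (\<lambda>n. \<integral>z. f z \<partial>equilibrium_measure (filled_julia (Q (r n)))) \<longlonglongrightarrow> (\<integral>z. f z \<partial>equilibrium_measure K)"
      by (rule equilibrium_subsequence) blast
    show "\<exists>r :: nat \<Rightarrow> nat. strict_mono r \<and>
      (\<lambda>n. \<integral>z. f z \<partial>equilibrium_measure (filled_julia (q (s (r n))))) \<longlonglongrightarrow> (\<integral>z. f z \<partial>equilibrium_measure K)"
    proof (intro exI[of _ "\<lambda>n. r n + N'"] conjI)
      show "strict_mono (\<lambda>n. r n + N')" using r(1) by (auto simp: strict_mono_def)
      show "(\<lambda>n. \<integral>z. f z \<partial>equilibrium_measure (filled_julia (q (s (r n + N')))))
          \<longlonglongrightarrow> (\<integral>z. f z \<partial>equilibrium_measure K)"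
        using r(2)[OF f(1) C] by (simp only: Q_def)
    qed
  qed
qed

end
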